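(* Let $E$ be the set of equilibrium points of the primal-dual system $$\dot y = Y\Big[\tfrac{\partial}{\partial y}L(x,y)^T\Big]^+_{\rho},\qquad \dot x=-X\tfrac{\partial}{\partial x}L(x,y)^T ,$$ that is, $$E=\Big\{(x,y):\ \tfrac{\partial L}{\partial x}(x,y)=0,\ \Big[\tfrac{\partial L}{\partial y}(x,y)^T\Big]^+_{\rho}=0\Big\}.$$ Then the set $E$ is globally asymptotically stable for this system. Furthermore, each individual trajectory converges to a unique point within $E$ that is optimal with respect to the OLC problem.
   Context: Network. $(\mathcal N,\mathcal E)$ is a finite connected directed graph with $ij\in\mathcal E\Rightarrow ji\notin\mathcal E$; $\mathcal N=\mathcal G\cup\mathcal L$ is a partition into generator and load buses. Each line $e=ij$ has susceptance $B_{ij}>0$; $B=\mathrm{diag}(B_e)_{e\in\mathcal E}$. $C\in\mathbb R^{|\mathcal N|\times|\mathcal E|}$ is the incidence matrix: for $e=ij$, $C_{i,e}=1$, $C_{j,e}=-1$, and other entries are $0$. $L_B=CBC^T$. $D_i>0$ for $i\in\mathcal N$, $D=\mathrm{diag}(D_i)$. $P^{in}\in\mathbb R^{|\mathcal N|}$ is given. Areas. $\mathcal K$ is the finite set of control areas, $\mathcal N_k\subseteq\mathcal N$ the buses of area $k$, $\mathcal B_k\subseteq\mathcal E$ the edges with exactly one endpoint in $\mathcal N_k$. $\hat C\in\mathbb R^{|\mathcal K|\times|\mathcal E|}$: for $ij\in\mathcal B_k$, $\hat C_{k,ij}=1$ if $i\in\mathcal N_k$ and $-1$ if $j\in\mathcal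 N_k$; $\hat C_{k,ij}=0$ if $ij\notin\mathcal B_k$. $\hat P\in\mathbb R^{|\mathcal K|}$ and the limits $\overline P,\underline P=-\overline P\in\mathbb R^{|\mathcal E|}$ are given. Costs (Assumption 1). $c_i$ is $\alpha$-strongly convex and $C^2$ ($c_i''\ge\alpha>0$) in the interior of $\mathcal D_i=[\underline d_i,\overline d_i]\subseteq\mathbb R$ (possibly unbounded), and $c_i(d_i)\to+\infty$ as $d_i\to\partial\mathcal D_i$. Set $d_i(\cdot):=(c_i')^{-1}(\cdot)$. OLC problem: minimize $\sum_{i\in\mathcal N}c_i(d_i)$ over $(d,\omega,\theta)$ subject to $P^{in}-(d+D\omega)=L_B\theta$, $\omega=0$, $\hat CBC^T\theta=\hat P$, $\underline P\le BC^T\theta\le\overline P$. Assumption 2: OLC is feasible and has at least one feasible $(d,\omega,\theta)$ with $d\in\prod_i\mathrm{Int}\,\mathcal D_i$. Reduced Lagrangian. Let $x=(\phi,P)\in\mathbb R^{|\mathcal N|+|\mathcal E|}$, $\sigma=(\lambda,\nu,\pi,\rho^+,\rho^-)$ with $\lambda,\nu\in\mathbb R^{|\mathcal N|}$, $\pi\in\mathbb R^{|\mathcal K|}$, $\rho^\pm\in\mathbb R^{|\mathcal E|}$, $\rho=(\rho^+,\rho^-)$. Let $$\Phi_i(\lambda_i,\nu_i)=c_i(d_i(\lambda_i+\nu_i))-(\lambda_i+\nu_i)d_i(\lambda_i+\nu_i)-\tfrac{D_i}{2}\nu_i^2+(\lambda_i+\nu_i)P_i^{in},$$ $$L(x,\sigma)=\sum_{i\in\mathcal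 N}\Phi_i(\lambda_i,\nu_i)-P^TC^T\nu-\pi^T\hat P-\rho^{+T}\overline P+\rho^{-T}\underline P-\phi^T\big(L_B\lambda-CB\hat C^T\pi-CB(\rho^+-\rho^-)\big).$$ With $y=(\lambda,\nu_{\mathcal G},\pi,\rho^+,\rho^-)$, define $L(x,y)=\max_{\nu_{\mathcal L}}L(x,\sigma)$; the (unique) maximizer is denoted $\nu^*_{\mathcal L}(x,y)$. Dynamics. $X,Y$ are diagonal matrices of positive gains. The projection $[a]^+_\rho$ acts only on the components corresponding to $\rho$: there $[a_i]^+_{\rho_i}=a_i$ if $a_i>0$ or $\rho_i>0$, and $0$ otherwise; other components are unchanged. The state space is restricted to $\rho^+\ge0,\rho^-\ge0$ (preserved by the dynamics; in particular in $E$ and for initial conditions). Solutions are understood in the Carathéodory sense. A point $(x^*,y^* )\in E$ is optimal with respect to OLC if, setting $\nu^*_{\mathcal L}=\nu^*_{\mathcal L}(x^*,y^* )$, $\omega^*=\nu^*$, $d_i^*=d_i(\lambda_i^*+\nu_i^* )$ and any $\theta^*$ with $C^T\theta^*=C^T\phi^*$, the triple $(d^*,\omega^*,\theta^* )$ is an optimal solution of OLC. *)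

theory Defs
  imports "HOL-Analysis.Analysis"
begin

section \<open>Solutions and stability\<close>

text \<open>
  The pieces of a division are non-overlapping compact intervals, so this is the usual
  epsilon-delta definition on \<open>{a..b}\<close>.
\<close>
definition absolutely_continuous_on_interval ::
    "real \<Rightarrow> real \<Rightarrow> (real \<Rightarrow> 'a::real_normed_vector) \<Rightarrow> bool" where
  "absolutely_continuous_on_interval a b f \<longleftrightarrow>
     (\<forall>\<epsilon>>0. \<exists>\<delta>>0. \<forall>\<D> S. \<D> division_of S \<and> S \<subseteq> {a..b} \<and> (\<Sum>K\<in>\<D>. Sup K - Inf K) < \<delta> \<longrightarrow>
        (\<Sum>K\<in>\<D>. norm (f (Sup K) - f (Inf K))) < \<epsilon>)"

definition caratheodory_solution ::
    "('z::euclidean_space \<Rightarrow> 'z) \<Rightarrow> 'z set \<Rightarrow> (real \<Rightarrow> 'z) \<Rightarrow> bool" where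
  "caratheodory_solution F S z \<longleftrightarrow>
     (\<forall>t\<ge>0. z t \<in> S) \<and>
     (\<forall>T\<ge>0. absolutely_continuous_on_interval 0 T z) \<and>
     (AE t in lborel. t > 0 \<longrightarrow> (z has_vector_derivative F (z t)) (at t))"

text \<open>
  Non-emptiness is required explicitly because \<^term>\<open>infdist x {}\<close> is \<open>0\<close>.
\<close>
definition globally_asymptotically_stable ::
    "('z::euclidean_space \<Rightarrow> 'z) \<Rightarrow> 'z set \<Rightarrow> 'z set \<Rightarrow> bool" where
  "globally_asymptotically_stable F S A \<longleftrightarrow>
     A \<noteq> {} \<and> A \<subseteq> S \<and>
     (\<forall>\<epsilon>>0. \<exists>\<delta>>0. \<forall>z. caratheodory_solution F S z \<and> infdist (z 0) A < \<delta> \<longrightarrow>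
        (\<forall>t\<ge>0. infdist (z t) A < \<epsilon>)) \<and>
     (\<forall>z. caratheodory_solution F S z \<longrightarrow> ((\<lambda>t. infdist (z t) A) \<longlongrightarrow> 0) at_top)"

section \<open>Vectors, diagonal matrices, gradients, strong convexity\<close>

text \<open>
  For a subset \<open>A\<close> of a finite index type, the space of real vectors indexed by \<open>A\<close> is represented
  by the vectors that vanish off \<open>A\<close>. This admits an empty \<open>A\<close>, which a type of indices would not
  (for instance, a single bus has no lines).
\<close>
definition vecs_on :: "'i::finite set \<Rightarrow> (real^'i) set" where
  "vecs_on A = {v. \<forall>i. i \<notin> A \<longrightarrow> v $ i = 0}"

definition diag :: "real^'i \<Rightarrow> real^'i^'i" where
  "diag v = (\<chi> i j. if i = j then v $ i else 0)"

text \<open>The action of the diagonal matrix with diagonal \<open>g\<close>, on any Euclidean space.\<close>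
definition gain :: "'z::euclidean_space \<Rightarrow> 'z \<Rightarrow> 'z" where
  "gain g z = (\<Sum>b\<in>Basis. ((g \<bullet> b) * (z \<bullet> b)) *\<^sub>R b)"

definition gradient :: "('z::real_inner \<Rightarrow> real) \<Rightarrow> 'z \<Rightarrow> 'z" where
  "gradient f z = (THE g. GDERIV f z :> g)"

definition strongly_convex_on :: "real \<Rightarrow> real set \<Rightarrow> (real \<Rightarrow> real) \<Rightarrow> bool" where
  "strongly_convex_on \<alpha> I f \<longleftrightarrow>
     (\<forall>x\<in>I. \<forall>y\<in>I. \<forall>t\<in>{0..1}.
        f (t * x + (1 - t) * y) \<le> t * f x + (1 - t) * f y - \<alpha> / 2 * t * (1 - t) * (x - y)^2)"

section \<open>The network\<close>

text \<open>
  The buses are the elements of \<open>'n\<close>, and \<open>'k\<close> is a type of area names. A line is an ordered pair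
  of buses.
\<close>
record ('n::finite, 'k::finite) grid =
  generators :: "'n set"
  lines :: "('n \<times> 'n) set"
  susceptance :: "real^('n \<times> 'n)"
  damping :: "real^'n"
  P_in :: "real^'n"
  areas :: "'k set"
  area_buses :: "'k \<Rightarrow> 'n set"
  P_hat :: "real^'k"
  P_max :: "real^('n \<times> 'n)"
  cost :: "'n \<Rightarrow> real \<Rightarrow> real"
  d_lo :: "'n \<Rightarrow> ereal"
  d_hi :: "'n \<Rightarrow> ereal"

definition loads :: "('n::finite, 'k::finite) grid \<Rightarrow> 'n set" where
  "loads N = - generators N"

definition P_min :: "('n::finite, 'k::finite) grid \<Rightarrow> real^('n \<times> 'n)" where
  "P_min N = - P_max N"

definition network :: "('n::finite, 'k::finite) grid \<Rightarrow> bool" where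
  "network N \<longleftrightarrow>
     (\<forall>i j. (i, j) \<in> lines N \<longrightarrow> (j, i) \<notin> lines N) \<and>
     (\<forall>i j. (i, j) \<in> (lines N \<union> (lines N)\<inverse>)\<^sup>*) \<and>
     susceptance N \<in> vecs_on (lines N) \<and> (\<forall>e\<in>lines N. susceptance N $ e > 0) \<and>
     (\<forall>i. damping N $ i > 0) \<and>
     P_hat N \<in> vecs_on (areas N) \<and>
     P_max N \<in> vecs_on (lines N)"

definition incidence :: "('n::finite, 'k::finite) grid \<Rightarrow> real^('n \<times> 'n)^'n" where
  "incidence N = (\<chi> i e. if e \<in> lines N \<and> i = fst e then 1
                         else if e \<in> lines N \<and> i = snd e then - 1 else 0)"

definition B_mat :: "('n::finite, 'k::finite) grid \<Rightarrow> real^('n \<times> 'n)^('n \<times> 'n)" where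
  "B_mat N = diag (susceptance N)"

definition laplacian :: "('n::finite, 'k::finite) grid \<Rightarrow> real^'n^'n" where
  "laplacian N = incidence N ** B_mat N ** transpose (incidence N)"

definition boundary_lines :: "('n::finite, 'k::finite) grid \<Rightarrow> 'k \<Rightarrow> ('n \<times> 'n) set" where
  "boundary_lines N k =
     {e \<in> lines N. (fst e \<in> area_buses N k) \<noteq> (snd e \<in> area_buses N k)}"

definition area_incidence :: "('n::finite, 'k::finite) grid \<Rightarrow> real^('n \<times> 'n)^'k" where
  "area_incidence N = (\<chi> k e. if k \<in> areas N \<and> e \<in> boundary_lines N k
                              then (if fst e \<in> area_buses N k then 1 else - 1) else 0)"

section \<open>Costs and the OLC problem\<close>

definition demand_range :: "('n::finite, 'k::finite) grid \<Rightarrow> 'n \<Rightarrow> real set" where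
  "demand_range N i = {u. d_lo N i \<le> ereal u \<and> ereal u \<le> d_hi N i}"

text \<open>
  The limit is only imposed at the finite endpoints of the range; at an infinite endpoint it
  follows from strong convexity.
\<close>
definition cost_assumption :: "real \<Rightarrow> ('n::finite, 'k::finite) grid \<Rightarrow> bool" where
  "cost_assumption \<alpha> N \<longleftrightarrow> \<alpha> > 0 \<and>
     (\<forall>i. let c = cost N i; I = interior (demand_range N i) in
        strongly_convex_on \<alpha> I c \<and>
        (\<forall>u\<in>I. c differentiable (at u) \<and> deriv c differentiable (at u)) \<and>
        continuous_on I (deriv (deriv c)) \<and>
        (\<forall>u\<in>I. deriv (deriv c) u \<ge> \<alpha>) \<and>
        (\<forall>b\<in>frontier (demand_range N i). filterlim c at_top (at b within I)))"

text \<open>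
  A cost that blows up at a finite endpoint has the value \<open>\<infinity>\<close> there; the real function
  \<^const>\<open>cost\<close> is therefore only used in the interior of the range.
\<close>
definition extended_cost :: "('n::finite, 'k::finite) grid \<Rightarrow> 'n \<Rightarrow> real \<Rightarrow> ereal" where
  "extended_cost N i u =
     (if u \<in> interior (demand_range N i) then ereal (cost N i u) else \<infinity>)"

definition olc_feasible ::
    "('n::finite, 'k::finite) grid \<Rightarrow> real^'n \<Rightarrow> real^'n \<Rightarrow> real^'n \<Rightarrow> bool" where
  "olc_feasible N d \<omega> \<theta> \<longleftrightarrow>
     (\<forall>i. d $ i \<in> demand_range N i) \<and>
     P_in N - (d + diag (damping N) *v \<omega>) = laplacian N *v \<theta> \<and>
     \<omega> = 0 \<and>
     (area_incidence N ** B_mat N ** transpose (incidence N)) *v \<theta> = P_hat N \<and>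
     (\<forall>e\<in>lines N. P_min N $ e \<le> ((B_mat N ** transpose (incidence N)) *v \<theta>) $ e \<and>
                  ((B_mat N ** transpose (incidence N)) *v \<theta>) $ e \<le> P_max N $ e)"

definition olc_optimal ::
    "('n::finite, 'k::finite) grid \<Rightarrow> real^'n \<Rightarrow> real^'n \<Rightarrow> real^'n \<Rightarrow> bool" where
  "olc_optimal N d \<omega> \<theta> \<longleftrightarrow> olc_feasible N d \<omega> \<theta> \<and>
     (\<forall>d' \<omega>' \<theta>'. olc_feasible N d' \<omega>' \<theta>' \<longrightarrow>
        (\<Sum>i\<in>UNIV. extended_cost N i (d $ i)) \<le> (\<Sum>i\<in>UNIV. extended_cost N i (d' $ i)))"

definition olc_strictly_feasible :: "('n::finite, 'k::finite) grid \<Rightarrow> bool" where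
  "olc_strictly_feasible N \<longleftrightarrow>
     (\<exists>d \<omega> \<theta>. olc_feasible N d \<omega> \<theta> \<and> (\<forall>i. d $ i \<in> interior (demand_range N i)))"

section \<open>The reduced Lagrangian\<close>

text \<open>\<open>x = (\<phi>, P)\<close>\<close>
type_synonym 'n primal = "(real^'n) \<times> (real^('n \<times> 'n))"

text \<open>
  \<open>y = (\<lambda>, \<nu>\<^sub>G, \<pi>, \<rho>\<^sup>+, \<rho>\<^sup>-)\<close>, and also \<open>\<sigma> = (\<lambda>, \<nu>, \<pi>, \<rho>\<^sup>+, \<rho>\<^sup>-)\<close>
\<close>
type_synonym ('n, 'k) dual =
  "(real^'n) \<times> (real^'n) \<times> (real^'k) \<times> (real^('n \<times> 'n)) \<times> (real^('n \<times> 'n))"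

definition demand :: "('n::finite, 'k::finite) grid \<Rightarrow> 'n \<Rightarrow> real \<Rightarrow> real" where
  "demand N i = inv_into (interior (demand_range N i)) (deriv (cost N i))"

definition \<Phi> :: "('n::finite, 'k::finite) grid \<Rightarrow> 'n \<Rightarrow> real \<Rightarrow> real \<Rightarrow> real" where
  "\<Phi> N i l n =
     cost N i (demand N i (l + n)) - (l + n) * demand N i (l + n)
     - damping N $ i / 2 * n^2 + (l + n) * P_in N $ i"

definition lagrangian ::
    "('n::finite, 'k::finite) grid \<Rightarrow> 'n primal \<Rightarrow> ('n, 'k) dual \<Rightarrow> real" where
  "lagrangian N = (\<lambda>(\<phi>, P) (l, \<nu>, \<pi>, \<rho>p, \<rho>m).
     (\<Sum>i\<in>UNIV. \<Phi> N i (l $ i) (\<nu> $ i))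
     - P \<bullet> (transpose (incidence N) *v \<nu>) - \<pi> \<bullet> P_hat N
     - \<rho>p \<bullet> P_max N + \<rho>m \<bullet> P_min N
     - \<phi> \<bullet> (laplacian N *v l
            - (incidence N ** B_mat N ** transpose (area_incidence N)) *v \<pi>
            - (incidence N ** B_mat N) *v (\<rho>p - \<rho>m)))"

definition join_nu ::
    "('n::finite, 'k::finite) grid \<Rightarrow> ('n, 'k) dual \<Rightarrow> real^'n \<Rightarrow> ('n, 'k) dual" where
  "join_nu N = (\<lambda>(l, \<nu>\<^sub>G, \<pi>, \<rho>p, \<rho>m) \<nu>\<^sub>L.
     (l, (\<chi> i. if i \<in> generators N then \<nu>\<^sub>G $ i else \<nu>\<^sub>L $ i), \<pi>, \<rho>p, \<rho>m))"

definition nu_star ::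
    "('n::finite, 'k::finite) grid \<Rightarrow> 'n primal \<Rightarrow> ('n, 'k) dual \<Rightarrow> real^'n" where
  "nu_star N x y =
     arg_max_on (\<lambda>\<nu>\<^sub>L. lagrangian N x (join_nu N y \<nu>\<^sub>L)) (vecs_on (loads N))"

definition reduced_lagrangian ::
    "('n::finite, 'k::finite) grid \<Rightarrow> 'n primal \<Rightarrow> ('n, 'k) dual \<Rightarrow> real" where
  "reduced_lagrangian N x y = lagrangian N x (join_nu N y (nu_star N x y))"

section \<open>The primal-dual system\<close>

definition pos_proj :: "real^'i::finite \<Rightarrow> real^'i \<Rightarrow> real^'i" where
  "pos_proj \<rho> a = (\<chi> e. if a $ e > 0 \<or> \<rho> $ e > 0 then a $ e else 0)"

definition proj_rho ::
    "('n::finite, 'k::finite) dual \<Rightarrow> ('n, 'k) dual \<Rightarrow> ('n, 'k) dual" where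
  "proj_rho = (\<lambda>(l, \<nu>\<^sub>G, \<pi>, \<rho>p, \<rho>m) (gl, gn, gp, gplus, gminus).
     (gl, gn, gp, pos_proj \<rho>p gplus, pos_proj \<rho>m gminus))"

definition state_space ::
    "('n::finite, 'k::finite) grid \<Rightarrow> ('n primal \<times> ('n, 'k) dual) set" where
  "state_space N = {((\<phi>, P), (l, \<nu>\<^sub>G, \<pi>, \<rho>p, \<rho>m)).
     P \<in> vecs_on (lines N) \<and> \<nu>\<^sub>G \<in> vecs_on (generators N) \<and> \<pi> \<in> vecs_on (areas N) \<and>
     \<rho>p \<in> vecs_on (lines N) \<and> \<rho>m \<in> vecs_on (lines N) \<and>
     (\<forall>e. \<rho>p $ e \<ge> 0) \<and> (\<forall>e. \<rho>m $ e \<ge> 0)}"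

text \<open>
  \<^const>\<open>reduced_lagrangian\<close> does not depend on the coordinates outside the relevant index sets,
  so its gradient vanishes there and the system does not leave the represented coordinate subspace.
\<close>
definition primal_dual ::
    "('n::finite, 'k::finite) grid \<Rightarrow> 'n primal \<Rightarrow> ('n, 'k) dual \<Rightarrow>
     'n primal \<times> ('n, 'k) dual \<Rightarrow> 'n primal \<times> ('n, 'k) dual" where
  "primal_dual N X Y = (\<lambda>(x, y).
     (- gain X (gradient (\<lambda>x'. reduced_lagrangian N x' y) x),
      gain Y (proj_rho y (gradient (\<lambda>y'. reduced_lagrangian N x y') y))))"

definition equilibria ::
    "('n::finite, 'k::finite) grid \<Rightarrow> ('n primal \<times> ('n, 'k) dual) set" where
  "equilibria N = {(x, y) \<in> state_space N.
     gradient (\<lambda>x'. reduced_lagrangian N x' y) x = 0 \<and>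
     proj_rho y (gradient (\<lambda>y'. reduced_lagrangian N x y') y) = 0}"

definition olc_optimal_point ::
    "('n::finite, 'k::finite) grid \<Rightarrow> 'n primal \<times> ('n, 'k) dual \<Rightarrow> bool" where
  "olc_optimal_point N = (\<lambda>(x, y).
     case (x, join_nu N y (nu_star N x y)) of ((\<phi>, P), (l, \<nu>, \<pi>, \<rho>p, \<rho>m)) \<Rightarrow>
       (\<forall>\<theta>. transpose (incidence N) *v \<theta> = transpose (incidence N) *v \<phi> \<longrightarrow>
          olc_optimal N (\<chi> i. demand N i (l $ i + \<nu> $ i)) \<nu> \<theta>))"

end

theory Submission
  imports Defs
begin

text \<open>
  The reduced Lagrangian is a saddle function, and the pairing of its saddle-point operator at two points is
  \<open>\<Sum>\<^sub>i (d\<^sub>i(s\<^sub>i) - d\<^sub>i(s'\<^sub>i)) (s\<^sub>i - s'\<^sub>i) + D\<^sub>i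
  (\<nu>\<^sub>i - \<nu>'\<^sub>i)\<^sup>2\<close> with \<open>s = \<lambda> + \<nu>\<close>: the bilinear terms
  cancel (\<open>saddle_identity\<close>). Because demand increases with the price, this is nonnegative and
  vanishes only if the prices \<open>\<lambda>\<close> and the frequencies \<open>\<nu>\<close> agree. Hence the
  distance to every equilibrium, weighted with the reciprocal gains, is nonincreasing along trajectories
  (\<open>lyapunov_nonincreasing\<close>), which is stability. The rate of decrease also contains the
  multipliers \<open>\<rho>\<close> of lines that are not congested at the equilibrium
  (\<open>decay_bound\<close>).

  The decay vanishes on sets larger than the set of equilibria, so convergence needs an invariance argument. The
  vector field is discontinuous, and LaSalle's principle is replaced by the observation that, if
  \<open>V\<close> converges along a bounded trajectory and decreases at a rate bounded below by a continuous
  \<open>W\<close>, then \<open>W \<le> 0\<close> at every limit point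
  (\<open>decrease_rate_nonpos_at_omega_limit\<close>). Applied to the weighted distance it fixes
  \<open>\<lambda>\<close>, \<open>\<nu>\<close> and complementary slackness at the limit points. Applied with
  both signs to quantities thereby known to converge, namely the components of \<open>\<lambda>\<close>, of the
  generator frequencies, and then of \<open>C\<^sup>T \<phi>\<close>, it yields the remaining equilibrium
  equations. So every limit point is an equilibrium (\<open>omega_limit_subset_equilibria\<close>), and since
  the distance to this very equilibrium is nonincreasing, the whole trajectory converges to it.

  Equilibria are KKT points of OLC with zero frequency deviation, which gives optimality
  (\<open>equilibrium_optimal\<close>). They exist because the line flows range over a compact polytope, the
  costs blow up at the boundary of the demand ranges, and a polyhedral Farkas argument supplies multipliers for
  the affine constraints (\<open>equilibria_nonempty\<close>). That the gradients are the expected ones follows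
  from sandwiching increments of the reduced Lagrangian between its tangents
  (\<open>GDERIV_between_tangents\<close>).
\<close>

section \<open>Absolutely continuous functions and Caratheodory solutions\<close>

text \<open>
  Null sets enter the argument only through this covering property: the intervals of a partition that are tagged
  in the exceptional set can be kept inside an open set of small measure.
\<close>
lemma negligible_small_open_cover:
  fixes S :: "real set"
  assumes "negligible S" "e > 0"
  obtains U where "open U" "S \<subseteq> U" "U \<in> lmeasurable" "measure lebesgue U < e"
proof -
  have S: "S \<in> null_sets lebesgue" using assms(1) by (simp add: negligible_iff_null_sets)
  obtain U where U: "open U" "S \<subseteq> U" "U - S \<in> lmeasurable" "emeasure lebesgue (U - S) < ennreal e"
    using sets_lebesgue_outer_open[of S e] S assms(2) by blast
  have eq: "emeasure lebesgue U = emeasure lebesgue (U - S)"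
    using S U(1) by (simp add: borel_open emeasure_Diff_null_set)
  have "emeasure lebesgue U < \<infinity>"
    using U(4) eq by (metis ennreal_less_top infinity_ennreal_def less_trans)
  then have m: "U \<in> lmeasurable"
    using U(1) by (intro fmeasurableI) (auto simp: borel_open)
  have "ennreal (measure lebesgue U) < ennreal e"
    using U(4) unfolding eq[symmetric] emeasure_eq_measure2[OF m] .
  then have "measure lebesgue U < e"
    by (subst (asm) ennreal_less_iff) (rule measure_nonneg)
  then show ?thesis using that U(1,2) m by blast
qed

lemma sum_lengths_le_measure:
  fixes \<D> :: "real set set"
  assumes div: "\<D> division_of S" and sub: "S \<subseteq> U" and U: "U \<in> lmeasurable"
  shows "(\<Sum>K\<in>\<D>. Sup K - Inf K) \<le> measure lebesgue U"
proof -
  have "Sup K - Inf K = measure lborel K" if KD: "K \<in> \<D>" for K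
  proof -
    obtain u v where K: "K = cbox u v" using division_ofD(4)[OF div KD] by blast
    then have "u \<le> v" using division_ofD(3)[OF div KD] by simp
    then show ?thesis unfolding K by simp
  qed
  then have "(\<Sum>K\<in>\<D>. Sup K - Inf K) = (\<Sum>K\<in>\<D>. measure lborel K)" by simp
  also have "\<dots> = measure lebesgue S"
  proof -
    have "(\<Sum>K\<in>\<D>. measure lborel K) = sum (measure lebesgue) \<D>"
      using div by (intro sum.cong) (auto dest!: division_ofD(4))
    then show ?thesis using content_division[OF div] by simp
  qed
  also have "\<dots> \<le> measure lebesgue U"
    using lmeasurable_division[OF div] sub U by (intro measure_mono_fmeasurable) auto
  finally show ?thesis .
qed

text \<open>
  The a.e. derivative bound integrates because a Cousin partition of \<open>[a, b]\<close> can be chosen fine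
  enough that an interval tagged at a good point obeys the bound up to \<open>\<epsilon>\<close> times its
  length, while the intervals tagged at bad points lie in an open set of tiny measure, so that absolute
  continuity makes their total increment small.
\<close>
lemma absolutely_continuous_increment_le:
  fixes f :: "real \<Rightarrow> real"
  assumes ab: "a \<le> b"
    and ac: "absolutely_continuous_on_interval a b f"
    and ae: "AE t in lborel. a < t \<and> t < b \<longrightarrow> (\<exists>D\<le>m. (f has_real_derivative D) (at t))"
  shows "f b - f a \<le> m * (b - a)"
proof (rule field_le_epsilon)
  fix e0 :: real assume "e0 > 0"
  define e where "e = e0 / (b - a + 2)"
  have e: "e > 0" and ee: "e * (b - a + 2) = e0" using \<open>e0 > 0\<close> ab by (auto simp: e_def)
  \<comment> \<open>the end points are put into the exceptional set, so that derivatives are two-sided at the remaining tags\<close>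
  define bad where "bad = {t. \<not> (a < t \<and> t < b \<and> (\<exists>D\<le>m. (f has_real_derivative D) (at t)))} \<inter> {a..b}"
  obtain Z where Z: "\<And>t. t \<in> space lborel - Z \<Longrightarrow> a < t \<and> t < b \<longrightarrow> (\<exists>D\<le>m. (f has_real_derivative D) (at t))"
      "Z \<in> null_sets lborel"
    using AE_E3[OF ae] by blast
  have "negligible Z" using Z(2) by (metis negligible_iff_null_sets null_sets_completionI)
  then have "negligible (Z \<union> {a, b})" by (simp add: negligible_Un)
  moreover have "bad \<subseteq> Z \<union> {a, b}"
  proof
    fix t assume t: "t \<in> bad"
    show "t \<in> Z \<union> {a, b}"
    proof (rule ccontr)
      assume n: "t \<notin> Z \<union> {a, b}"
      then have "a < t" "t < b" using t by (auto simp: bad_def)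
      then show False using Z(1)[of t] n t by (auto simp: bad_def)
    qed
  qed
  ultimately have neg: "negligible bad" by (rule negligible_subset)
  obtain \<delta> where \<delta>: "\<delta> > 0" and small: "\<And>\<D> S. \<D> division_of S \<Longrightarrow> S \<subseteq> {a..b} \<Longrightarrow> (\<Sum>K\<in>\<D>. Sup K - Inf K) < \<delta>
      \<Longrightarrow> (\<Sum>K\<in>\<D>. norm (f (Sup K) - f (Inf K))) < e"
    using ac e unfolding absolutely_continuous_on_interval_def by meson
  define \<delta>' where "\<delta>' = min \<delta> (e / (\<bar>m\<bar> + 1))"
  have \<delta>': "\<delta>' > 0" "\<delta>' \<le> \<delta>" "\<bar>m\<bar> * \<delta>' \<le> e"
  proof -
    show "\<delta>' > 0" using \<delta> e by (auto simp: \<delta>'_def)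
    show "\<delta>' \<le> \<delta>" by (auto simp: \<delta>'_def)
    have "\<bar>m\<bar> * \<delta>' \<le> \<bar>m\<bar> * (e / (\<bar>m\<bar> + 1))" by (intro mult_left_mono) (auto simp: \<delta>'_def)
    also have "\<dots> \<le> e" using e by (simp add: field_simps)
    finally show "\<bar>m\<bar> * \<delta>' \<le> e" .
  qed
  obtain U where U: "open U" "bad \<subseteq> U" "U \<in> lmeasurable" "measure lebesgue U < \<delta>'"
    using negligible_small_open_cover[OF neg \<delta>'(1)] .
  \<comment> \<open>away from the null set, the derivative controls the increment over short intervals around \<open>t\<close>\<close>
  have "\<exists>r>0. \<forall>u v. u \<le> t \<and> t \<le> v \<and> {u..v} \<subseteq> ball t r \<longrightarrow> f v - f u \<le> (m + e) * (v - u)"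
    if t: "t \<in> {a..b} - bad" for t
  proof -
    obtain D where D: "D \<le> m" "(f has_real_derivative D) (at t)" using t by (auto simp: bad_def)
    then have "(f has_derivative (\<lambda>h. D * h)) (at t)" by (simp add: has_field_derivative_def)
    then obtain r where r: "r > 0" "\<And>u. \<bar>u - t\<bar> < r \<Longrightarrow> \<bar>f u - f t - D * (u - t)\<bar> \<le> e * \<bar>u - t\<bar>"
      using e unfolding has_derivative_at_alt by (metis real_norm_def)
    have "f v - f u \<le> (m + e) * (v - u)" if uv: "u \<le> t" "t \<le> v" "{u..v} \<subseteq> ball t r" for u v
    proof -
      have "u \<in> ball t r" "v \<in> ball t r" using uv by (auto simp del: mem_ball)
      then have "\<bar>u - t\<bar> < r" "\<bar>v - t\<bar> < r" by (auto simp: dist_real_def)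
      from r(2)[OF this(1)] r(2)[OF this(2)] uv(1,2)
      have "f t - f u \<le> D * (t - u) + e * (t - u)" "f v - f t \<le> D * (v - t) + e * (v - t)"
        by (auto simp: abs_le_iff algebra_simps)
      then have "f v - f u \<le> D * (v - u) + e * (v - u)" by (simp add: algebra_simps)
      also have "\<dots> \<le> m * (v - u) + e * (v - u)" using D(1) uv by (intro add_right_mono mult_right_mono) auto
      finally show ?thesis by (simp add: algebra_simps)
    qed
    then show ?thesis using r(1) by blast
  qed
  then obtain r where r: "\<And>t. t \<in> {a..b} - bad \<Longrightarrow> r t > 0"
    "\<And>t u v. t \<in> {a..b} - bad \<Longrightarrow> u \<le> t \<Longrightarrow> t \<le> v \<Longrightarrow> {u..v} \<subseteq> ball t (r t) \<Longrightarrow> f v - f u \<le> (m + e) * (v - u)"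
    by metis
  define \<gamma> where "\<gamma> t = (if t \<in> bad then U else if t \<in> {a..b} then ball t (r t) else UNIV)" for t
  have "gauge \<gamma>"
    unfolding gauge_def \<gamma>_def using U r(1) by auto
  then obtain p where p: "p tagged_division_of {a..b}" "\<gamma> fine p"
    using fine_division_exists_real by blast
  note pD = tagged_division_ofD[OF p(1)]
  have Kform: "\<exists>u v. K = {u..v} \<and> u \<le> x \<and> x \<le> v \<and> Inf K = u \<and> Sup K = v" if xK: "(x, K) \<in> p" for x K
  proof -
    obtain u v where "K = cbox u v" using pD(4)[OF xK] by blast
    moreover have "x \<in> K" using pD(2)[OF xK] .
    ultimately show ?thesis by auto
  qed
  define q where "q = {(x, K) \<in> p. x \<in> bad}"
  have qp: "q \<subseteq> p" unfolding q_def by blast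
  have fp: "finite p" by (rule pD(1))
  have qtp: "q tagged_partial_division_of {a..b}"
    using tagged_partial_division_subset[OF _ qp] p(1) unfolding tagged_division_of_def by blast
  have qdiv: "(snd ` q) division_of \<Union>(snd ` q)"
    using partial_division_of_tagged_division[OF qtp] .
  have qt: "q tagged_division_of \<Union>(snd ` q)"
    using tagged_partial_division_of_Union_self[OF qtp] .
  have qU: "\<Union>(snd ` q) \<subseteq> U"
  proof -
    have "K \<subseteq> U" if "(x, K) \<in> q" for x K
    proof -
      have "K \<subseteq> \<gamma> x" "x \<in> bad" using p(2) that by (auto simp: fine_def q_def)
      then show ?thesis by (simp add: \<gamma>_def)
    qed
    then show ?thesis by force
  qed
  have qab: "\<Union>(snd ` q) \<subseteq> {a..b}" using qp pD(3) by fastforce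
  have lens: "(\<Sum>K\<in>snd ` q. Sup K - Inf K) < \<delta>'"
    using sum_lengths_le_measure[OF qdiv qU U(3)] U(4) by linarith
  have over: "(\<Sum>(x,K)\<in>q. d K) = sum d (snd ` q)" if d0: "\<And>u v. box u v = {} \<Longrightarrow> cbox u v \<noteq> {} \<Longrightarrow> d (cbox u v) = (0::real)" for d
  proof -
    have ne: "K \<noteq> {}" if "K \<in> snd ` q" for K using that qp pD(2) by fastforce
    have "(\<Sum>(x,K)\<in>q. d K) = (\<Sum>(x,K)\<in>q. if K = {} then 0 else d K)"
      using ne by (intro sum.cong) force+
    also have "\<dots> = (\<Sum>K\<in>snd ` q. if K = {} then 0 else d K)"
      by (rule sum.over_tagged_division_lemma[OF qt]) (use d0 in simp)
    also have "\<dots> = sum d (snd ` q)" using ne by (intro sum.cong) auto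
    finally show ?thesis .
  qed
  have "(\<Sum>(x,K)\<in>q. \<bar>f (Sup K) - f (Inf K)\<bar>) = (\<Sum>K\<in>snd ` q. \<bar>f (Sup K) - f (Inf K)\<bar>)"
    by (rule over) auto
  also have "\<dots> < e" using small[OF qdiv qab] lens \<delta>'(2) by simp
  finally have osc: "(\<Sum>(x,K)\<in>q. \<bar>f (Sup K) - f (Inf K)\<bar>) < e" .
  have "(\<Sum>(x,K)\<in>q. Sup K - Inf K) = (\<Sum>K\<in>snd ` q. Sup K - Inf K)"
    by (rule over) auto
  then have qlen: "(\<Sum>(x,K)\<in>q. Sup K - Inf K) < \<delta>'" using lens by simp
  define g where "g = (\<lambda>(x::real, K). f (Sup K) - f (Inf K) - m * (Sup K - Inf K))"
  define len where "len = (\<lambda>(x::real, K::real set). Sup K - Inf K)"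
  have len0: "len y \<ge> 0" if "y \<in> p" for y
  proof -
    obtain x K where "y = (x, K)" by (cases y)
    then show ?thesis using Kform[of x K] that by (auto simp: len_def)
  qed
  have total: "sum len p = b - a"
    using additive_tagged_division_1[OF ab p(1), of "\<lambda>x. x"] by (simp add: len_def)
  have "sum g p = (\<Sum>(x,K)\<in>p. f (Sup K) - f (Inf K)) - (\<Sum>y\<in>p. m * len y)"
    unfolding sum_subtractf[symmetric] g_def len_def by (rule sum.cong) auto
  also have "\<dots> = f b - f a - m * (b - a)"
    unfolding additive_tagged_division_1[OF ab p(1)] total[symmetric] sum_distrib_left ..
  finally have "f b - f a - m * (b - a) = sum g p" by (rule sym)
  also have "\<dots> = sum g (p - q) + sum g q"
    using sum.subset_diff[OF qp fp] .
  also have "sum g (p - q) \<le> sum (\<lambda>y. e * len y) (p - q)"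
  proof (rule sum_mono)
    fix y assume y: "y \<in> p - q"
    obtain x K where xK: "y = (x, K)" by (cases y)
    have xKp: "(x, K) \<in> p" and xb: "x \<notin> bad" using y xK by (auto simp: q_def)
    obtain u v where uv: "K = {u..v}" "u \<le> x" "x \<le> v" "Inf K = u" "Sup K = v" using Kform[OF xKp] by blast
    have xab: "x \<in> {a..b}" using pD(2,3)[OF xKp] by auto
    have "K \<subseteq> \<gamma> x" using p(2) xKp by (auto simp: fine_def)
    then have "K \<subseteq> ball x (r x)" using xb xab by (simp add: \<gamma>_def)
    then have "{u..v} \<subseteq> ball x (r x)" using uv(1) by simp
    with r(2)[OF _ uv(2,3)] xab xb have "f v - f u \<le> (m + e) * (v - u)" by blast
    then show "g y \<le> e * len y" unfolding xK g_def len_def prod.case uv(4,5) by (simp add: algebra_simps)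
  qed
  also have "\<dots> \<le> sum (\<lambda>y. e * len y) p"
  proof (rule sum_mono2[OF fp Diff_subset])
    show "0 \<le> e * len y" if "y \<in> p - (p - q)" for y
      using len0[of y] that e by (intro mult_nonneg_nonneg) auto
  qed
  also have "\<dots> = e * (b - a)"
    unfolding total[symmetric] by (rule sum_distrib_left[symmetric])
  also have "sum g q \<le> (\<Sum>(x,K)\<in>q. \<bar>f (Sup K) - f (Inf K)\<bar> + \<bar>m\<bar> * (Sup K - Inf K))"
  proof (rule sum_mono)
    fix y assume y: "y \<in> q"
    obtain x K where xK: "y = (x, K)" by (cases y)
    have "y \<in> p" using y qp by blast
    then have "len (x, K) \<ge> 0" using len0[of y] unfolding xK by blast
    then have K0: "Sup K - Inf K \<ge> 0" unfolding len_def by simp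
    have "- m * (Sup K - Inf K) \<le> \<bar>m\<bar> * (Sup K - Inf K)" using K0 by (intro mult_right_mono) auto
    then show "g y \<le> (case y of (x,K) \<Rightarrow> \<bar>f (Sup K) - f (Inf K)\<bar> + \<bar>m\<bar> * (Sup K - Inf K))"
      using xK by (simp add: g_def)
  qed
  also have "\<dots> = (\<Sum>(x,K)\<in>q. \<bar>f (Sup K) - f (Inf K)\<bar>) + \<bar>m\<bar> * (\<Sum>(x,K)\<in>q. Sup K - Inf K)"
    unfolding sum_distrib_left sum.distrib[symmetric] by (rule sum.cong) auto
  also have "\<dots> \<le> e + \<bar>m\<bar> * \<delta>'"
    by (rule add_mono[OF less_imp_le[OF osc] mult_left_mono[OF less_imp_le[OF qlen] abs_ge_zero]])
  also have "\<dots> \<le> e + e" using \<delta>'(3) by simp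
  finally have "f b - f a - m * (b - a) \<le> e * (b - a) + (e + e)" by simp
  also have "\<dots> = e0" using ee by (simp add: algebra_simps)
  finally show "f b - f a \<le> m * (b - a) + e0" by simp
qed


lemma absolutely_continuous_subinterval:
  assumes "absolutely_continuous_on_interval a b f" "a \<le> a'" "b' \<le> b"
  shows "absolutely_continuous_on_interval a' b' f"
proof -
  have "{a'..b'} \<subseteq> {a..b}" using assms by auto
  then show ?thesis
    using assms(1) unfolding absolutely_continuous_on_interval_def by (meson order_trans)
qed

lemma absolutely_continuous_imp_continuous_on:
  assumes "absolutely_continuous_on_interval a b f"
  shows "continuous_on {a..b} f"
  unfolding continuous_on_iff
proof (intro ballI allI impI)
  fix s and e :: real assume s: "s \<in> {a..b}" and "0 < e"
  then obtain \<delta> where \<delta>: "\<delta> > 0" and small: "\<And>\<D> S. \<D> division_of S \<and> S \<subseteq> {a..b} \<and> (\<Sum>K\<in>\<D>. Sup K - Inf K) < \<delta>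
      \<longrightarrow> (\<Sum>K\<in>\<D>. norm (f (Sup K) - f (Inf K))) < e"
    using assms unfolding absolutely_continuous_on_interval_def by meson
  have close: "norm (f v - f u) < e" if uv: "u \<le> v" "v - u < \<delta>" "a \<le> u" "v \<le> b" for u v
  proof -
    have "{cbox u v} division_of cbox u v" using uv by (intro division_of_self) auto
    then show ?thesis using small[of "{cbox u v}" "cbox u v"] uv by simp
  qed
  show "\<exists>d>0. \<forall>t\<in>{a..b}. dist t s < d \<longrightarrow> dist (f t) (f s) < e"
  proof (intro exI[of _ \<delta>] conjI ballI impI \<delta>)
    fix t assume t: "t \<in> {a..b}" "dist t s < \<delta>"
    show "dist (f t) (f s) < e"
    proof (cases "s \<le> t")
      case True
      then show ?thesis using close[of s t] s t by (simp add: dist_norm)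
    next
      case False
      then show ?thesis using close[of t s] s t by (simp add: dist_norm norm_minus_commute)
    qed
  qed
qed

lemma absolutely_continuous_lipschitz_compose:
  assumes ac: "absolutely_continuous_on_interval a b f"
    and lip: "L-lipschitz_on (f ` {a..b}) V"
  shows "absolutely_continuous_on_interval a b (\<lambda>t. V (f t))"
  unfolding absolutely_continuous_on_interval_def
proof (intro allI impI)
  fix e :: real assume e: "e > 0"
  have L: "L \<ge> 0" using lip by (rule lipschitz_on_nonneg)
  have "e / (L + 1) > 0" using e L by simp
  then obtain \<delta> where \<delta>: "\<delta> > 0" and small: "\<And>\<D> S. \<D> division_of S \<and> S \<subseteq> {a..b} \<and> (\<Sum>K\<in>\<D>. Sup K - Inf K) < \<delta>
      \<longrightarrow> (\<Sum>K\<in>\<D>. norm (f (Sup K) - f (Inf K))) < e / (L + 1)"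
    using ac unfolding absolutely_continuous_on_interval_def by meson
  show "\<exists>\<delta>>0. \<forall>\<D> S. \<D> division_of S \<and> S \<subseteq> {a..b} \<and> (\<Sum>K\<in>\<D>. Sup K - Inf K) < \<delta> \<longrightarrow>
      (\<Sum>K\<in>\<D>. norm (V (f (Sup K)) - V (f (Inf K)))) < e"
  proof (intro exI[of _ \<delta>] conjI allI impI \<delta>)
    fix \<D> S assume D: "\<D> division_of S \<and> S \<subseteq> {a..b} \<and> (\<Sum>K\<in>\<D>. Sup K - Inf K) < \<delta>"
    have "(\<Sum>K\<in>\<D>. norm (V (f (Sup K)) - V (f (Inf K)))) \<le> (\<Sum>K\<in>\<D>. L * norm (f (Sup K) - f (Inf K)))"
    proof (rule sum_mono)
      fix K assume K: "K \<in> \<D>"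
      have div: "\<D> division_of S" using D by blast
      obtain u v where uv: "K = cbox u v" using division_ofD(4)[OF div K] by blast
      have "u \<le> v" using division_ofD(3)[OF div K] uv by simp
      moreover have "K \<subseteq> {a..b}" using division_ofD(2)[OF div K] D by blast
      ultimately have "Sup K \<in> {a..b}" "Inf K \<in> {a..b}" using uv by auto
      then show "norm (V (f (Sup K)) - V (f (Inf K))) \<le> L * norm (f (Sup K) - f (Inf K))"
        using lipschitz_onD[OF lip, of "f (Sup K)" "f (Inf K)"] by (simp add: dist_norm)
    qed
    also have "\<dots> = L * (\<Sum>K\<in>\<D>. norm (f (Sup K) - f (Inf K)))" by (rule sum_distrib_left[symmetric])
    also have "\<dots> \<le> L * (e / (L + 1))" using small[of \<D> S] D L by (intro mult_left_mono) auto
    also have "\<dots> < e" using L e by (simp add: field_simps)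
    finally show "(\<Sum>K\<in>\<D>. norm (V (f (Sup K)) - V (f (Inf K)))) < e" .
  qed
qed

text \<open>
  The only way in which the differential equation is used below: a bound on the derivative of a test function
  \<open>V\<close> along the vector field is a bound on its increments along Caratheodory solutions. A locally
  Lipschitz \<open>V\<close> keeps the composition absolutely continuous.
\<close>
lemma solution_increment_le:
  fixes V :: "'z::euclidean_space \<Rightarrow> real"
  assumes sol: "caratheodory_solution F S z"
    and V: "\<And>x. (V has_derivative V' x) (at x)"
    and lip: "\<And>R. \<exists>L. L-lipschitz_on (cball 0 R) V"
    and ab: "0 \<le> a" "a \<le> b"
    and le: "\<And>t. a < t \<Longrightarrow> t < b \<Longrightarrow> V' (z t) (F (z t)) \<le> m"
  shows "V (z b) - V (z a) \<le> m * (b - a)"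
proof -
  have ac: "absolutely_continuous_on_interval a b z"
    using sol ab absolutely_continuous_subinterval[of 0 b z a b]
    unfolding caratheodory_solution_def by simp
  have "bounded (z ` {a..b})"
    using absolutely_continuous_imp_continuous_on[OF ac]
    by (intro compact_imp_bounded compact_continuous_image) auto
  then obtain R where "\<forall>x\<in>z ` {a..b}. norm x \<le> R" unfolding bounded_iff by blast
  then have R: "z ` {a..b} \<subseteq> cball 0 R" by auto
  obtain L where "L-lipschitz_on (cball 0 R) V" using lip by blast
  then have "L-lipschitz_on (z ` {a..b}) V" using R lipschitz_on_subset by blast
  then have acV: "absolutely_continuous_on_interval a b (\<lambda>t. V (z t))"
    by (rule absolutely_continuous_lipschitz_compose[OF ac])
  have "AE t in lborel. t > 0 \<longrightarrow> (z has_vector_derivative F (z t)) (at t)"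
    using sol unfolding caratheodory_solution_def by blast
  then have ae: "AE t in lborel. a < t \<and> t < b \<longrightarrow> (\<exists>D\<le>m. ((\<lambda>t. V (z t)) has_real_derivative D) (at t))"
  proof (rule AE_mp, intro AE_I2 impI)
    fix t assume d: "t > 0 \<longrightarrow> (z has_vector_derivative F (z t)) (at t)" and t: "a < t \<and> t < b"
    then have "(z has_derivative (\<lambda>h. h *\<^sub>R F (z t))) (at t)"
      using ab by (simp add: has_vector_derivative_def)
    from has_derivative_compose[OF this V]
    have "((\<lambda>t. V (z t)) has_derivative (\<lambda>h. V' (z t) (h *\<^sub>R F (z t)))) (at t)" .
    moreover have "V' (z t) (h *\<^sub>R F (z t)) = V' (z t) (F (z t)) * h" for h
      using linear_scale[OF has_derivative_linear[OF V]] by simp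
    ultimately have "((\<lambda>t. V (z t)) has_real_derivative V' (z t) (F (z t))) (at t)"
      by (simp add: has_field_derivative_def)
    then show "\<exists>D\<le>m. ((\<lambda>t. V (z t)) has_real_derivative D) (at t)"
      using le t by blast
  qed
  show ?thesis by (rule absolutely_continuous_increment_le[OF ab(2) acV ae])
qed

lemma inner_lipschitz: "(norm v)-lipschitz_on A (\<lambda>x. v \<bullet> x)"
proof (rule lipschitz_onI)
  fix x y
  have "\<bar>v \<bullet> (x - y)\<bar> \<le> norm v * norm (x - y)" by (rule Cauchy_Schwarz_ineq2)
  then show "dist (v \<bullet> x) (v \<bullet> y) \<le> norm v * dist x y"
    by (simp add: dist_norm inner_diff_right)
qed simp

lemma inner_derivative: "((\<lambda>x. v \<bullet> x) has_derivative (\<lambda>h. v \<bullet> h)) (at x)"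
  by (rule bounded_linear_imp_has_derivative) (rule bounded_linear_inner_right)

lemma solution_lipschitz:
  assumes sol: "caratheodory_solution F S z"
    and M: "\<And>t. t \<ge> 0 \<Longrightarrow> norm (F (z t)) \<le> M"
    and ab: "0 \<le> a" "a \<le> b"
  shows "norm (z b - z a) \<le> M * (b - a)"
proof -
  define v where "v = z b - z a"
  have "v \<bullet> z b - v \<bullet> z a \<le> (norm v * M) * (b - a)"
  proof (rule solution_increment_le[OF sol inner_derivative _ ab])
    show "\<exists>L. L-lipschitz_on (cball 0 R) (\<lambda>x. v \<bullet> x)" for R using inner_lipschitz by blast
    fix t assume "a < t" "t < b"
    then have "norm (F (z t)) \<le> M" using M ab by simp
    then show "v \<bullet> F (z t) \<le> norm v * M"
      by (meson norm_cauchy_schwarz order_trans mult_left_mono norm_ge_zero)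
  qed
  then have "norm v * norm v \<le> norm v * (M * (b - a))"
    by (simp add: v_def inner_diff_right[symmetric] power2_norm_eq_inner[symmetric] power2_eq_square mult.assoc)
  moreover have "M \<ge> 0" using M[OF ab(1)] norm_ge_zero[of "F (z a)"] by linarith
  then have "M * (b - a) \<ge> 0" using ab(2) by simp
  ultimately show ?thesis
    by (cases "norm v = 0") (simp_all add: v_def)
qed

definition omega_limit :: "(real \<Rightarrow> 'z::topological_space) \<Rightarrow> 'z set" where
  "omega_limit z = {p. \<exists>s. filterlim s at_top sequentially \<and> (\<lambda>n. z (s n)) \<longlonglongrightarrow> p}"

text \<open>
  A substitute for LaSalle's invariance principle for discontinuous vector fields such as the projected one. If
  the decrease rate \<open>W\<close> were positive at a limit point \<open>p\<close>, it would exceed some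
  \<open>\<eta> > 0\<close> on a ball around \<open>p\<close>. By the speed limit \<open>M\<close> every late
  visit near \<open>p\<close> stays in the ball for a fixed time \<open>\<tau>\<close>, so \<open>V\<close>
  would drop by \<open>\<eta> \<tau>\<close> infinitely often, although it converges.
\<close>
lemma decrease_rate_nonpos_at_omega_limit:
  fixes V W :: "'z::euclidean_space \<Rightarrow> real"
  assumes sol: "caratheodory_solution F S z"
    and M: "\<And>t. t \<ge> 0 \<Longrightarrow> norm (F (z t)) \<le> M"
    and V: "\<And>x. (V has_derivative V' x) (at x)"
    and lip: "\<And>R. \<exists>L. L-lipschitz_on (cball 0 R) V"
    and le: "\<And>t. t \<ge> 0 \<Longrightarrow> V' (z t) (F (z t)) \<le> - W (z t)"
    and conv: "((\<lambda>t. V (z t)) \<longlongrightarrow> c) at_top"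
    and W: "isCont W p" and p: "p \<in> omega_limit z"
  shows "W p \<le> 0"
proof (rule ccontr)
  assume "\<not> W p \<le> 0"
  define \<eta> where "\<eta> = W p / 2"
  have \<eta>: "\<eta> > 0" using \<open>\<not> W p \<le> 0\<close> by (simp add: \<eta>_def)
  have "\<forall>\<^sub>F x in nhds p. W x > \<eta>"
    using W \<eta> unfolding isCont_def tendsto_at_iff_tendsto_nhds
    by (intro order_tendstoD) (auto simp: \<eta>_def)
  then obtain r where r: "r > 0" "\<And>x. dist x p < r \<Longrightarrow> W x > \<eta>"
    unfolding eventually_nhds_metric by blast
  have M0: "M \<ge> 0" using M[of 0] norm_ge_zero order_trans by blast
  define \<tau> where "\<tau> = r / (2 * (M + 1))"
  have \<tau>: "\<tau> > 0" using r M0 by (simp add: \<tau>_def)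
  have M\<tau>: "M * \<tau> < r / 2"
    using r M0 by (simp add: \<tau>_def field_simps)
  obtain s where s: "filterlim s at_top sequentially" "(\<lambda>n. z (s n)) \<longlonglongrightarrow> p"
    using p unfolding omega_limit_def by blast
  have drop: "\<forall>\<^sub>F n in sequentially. V (z (s n + \<tau>)) - V (z (s n)) \<le> - \<eta> * \<tau>"
  proof -
    have "\<forall>\<^sub>F n in sequentially. s n \<ge> 0"
      using s(1) unfolding filterlim_at_top by blast
    moreover have "\<forall>\<^sub>F n in sequentially. dist (z (s n)) p < r / 2"
      using s(2) r(1) by (intro tendstoD) auto
    ultimately show ?thesis
    proof eventually_elim
      case (elim n)
      have "V (z (s n + \<tau>)) - V (z (s n)) \<le> (- \<eta>) * (s n + \<tau> - s n)"
      proof (rule solution_increment_le[OF sol V lip])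
        fix t assume t: "s n < t" "t < s n + \<tau>"
        have "norm (z t - z (s n)) \<le> M * (t - s n)"
          using solution_lipschitz[OF sol M elim(1)] t by simp
        also have "\<dots> \<le> M * \<tau>" using t M0 by (intro mult_left_mono) auto
        finally have "dist (z t) (z (s n)) < r / 2" using M\<tau> by (simp add: dist_norm)
        then have "dist (z t) p < r" using elim(2) dist_triangle_half_r[of "z (s n)"] by (metis dist_commute)
        then have "W (z t) > \<eta>" by (rule r(2))
        then show "V' (z t) (F (z t)) \<le> - \<eta>" using le[of t] t elim(1) by linarith
      qed (use elim \<tau> in auto)
      then show ?case by simp
    qed
  qed
  have "(\<lambda>n. V (z (s n))) \<longlonglongrightarrow> c"
    using filterlim_compose[OF conv s(1)] .
  moreover have "filterlim (\<lambda>n. s n + \<tau>) at_top sequentially"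
    using filterlim_tendsto_add_at_top[OF tendsto_const s(1), of \<tau>] by (simp add: add.commute)
  from filterlim_compose[OF conv this] have "(\<lambda>n. V (z (s n + \<tau>))) \<longlonglongrightarrow> c" .
  ultimately have "(\<lambda>n. V (z (s n + \<tau>)) - V (z (s n))) \<longlonglongrightarrow> c - c" by (intro tendsto_diff)
  then have "c - c \<le> - \<eta> * \<tau>"
    by (rule tendsto_upperbound[OF _ drop]) simp
  moreover have "\<eta> * \<tau> > 0" using \<eta> \<tau> by simp
  ultimately show False by simp
qed

lemma sequence_has_omega_limit:
  fixes z :: "real \<Rightarrow> 'z::heine_borel"
  assumes bdd: "bounded (z ` {0..})" and s: "filterlim s at_top sequentially"
  obtains r p where "strict_mono r" "(\<lambda>n. z (s (r n))) \<longlonglongrightarrow> p" "p \<in> omega_limit z"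
proof -
  have "\<forall>\<^sub>F n in sequentially. s n \<ge> 0" using s unfolding filterlim_at_top by blast
  then obtain n0 where n0: "\<And>n. n \<ge> n0 \<Longrightarrow> s n \<ge> 0" unfolding eventually_sequentially by blast
  have "range (\<lambda>n. z (s (n + n0))) \<subseteq> z ` {0..}" using n0 by auto
  then have "bounded (range (\<lambda>n. z (s (n + n0))))" using bdd bounded_subset by blast
  from bounded_imp_convergent_subsequence[OF this] obtain p r
    where pr: "strict_mono r" "((\<lambda>n. z (s (n + n0))) \<circ> r) \<longlonglongrightarrow> p"
    by metis
  define r' where "r' n = r n + n0" for n
  have "strict_mono r'" using pr(1) by (auto simp: strict_mono_def r'_def)
  moreover have lim: "(\<lambda>n. z (s (r' n))) \<longlonglongrightarrow> p" using pr(2) by (simp add: o_def r'_def)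
  moreover have "filterlim (\<lambda>n. s (r' n)) at_top sequentially"
    using filterlim_compose[OF s filterlim_subseq[OF \<open>strict_mono r'\<close>]] .
  then have "p \<in> omega_limit z" unfolding omega_limit_def using lim by blast
  ultimately show thesis using that by blast
qed

lemma converges_if_constant_on_omega_limit:
  fixes z :: "real \<Rightarrow> 'z::heine_borel" and V :: "'z \<Rightarrow> real"
  assumes bdd: "bounded (z ` {0..})"
    and V: "continuous_on UNIV V" and c: "\<And>p. p \<in> omega_limit z \<Longrightarrow> V p = c"
  shows "((\<lambda>t. V (z t)) \<longlongrightarrow> c) at_top"
proof (rule ccontr)
  assume "\<not> ?thesis"
  then obtain e where e: "e > 0" "\<not> (\<forall>\<^sub>F t in at_top. dist (V (z t)) c < e)"
    unfolding tendsto_iff by blast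
  then have "\<forall>n::nat. \<exists>t\<ge>real n. dist (V (z t)) c \<ge> e"
    unfolding eventually_at_top_linorder by (metis not_less)
  then obtain s where s: "\<And>n::nat. s n \<ge> real n" "\<And>n. dist (V (z (s n))) c \<ge> e" by metis
  have "filterlim s at_top sequentially"
    by (rule filterlim_at_top_mono[OF filterlim_real_sequentially]) (simp add: s)
  then obtain r p where r: "strict_mono r" "(\<lambda>n. z (s (r n))) \<longlonglongrightarrow> p" "p \<in> omega_limit z"
    using sequence_has_omega_limit[OF bdd] by blast
  have "isCont V p" using V by (simp add: continuous_on_eq_continuous_at)
  then have "(\<lambda>n. V (z (s (r n)))) \<longlonglongrightarrow> V p" using r(2) by (rule isCont_tendsto_compose)
  then have "(\<lambda>n. dist (V (z (s (r n)))) c) \<longlonglongrightarrow> dist (V p) c" by (intro tendsto_dist tendsto_const)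
  then have "dist (V p) c \<ge> e" by (rule tendsto_lowerbound) (simp_all add: s)
  then show False using c[OF r(3)] e(1) by simp
qed


section \<open>Cost functions and demand\<close>

text \<open>
  If the derivative stayed below \<open>s\<close>, its growth rate \<open>\<alpha>\<close> would bound the
  interval \<open>I\<close> from above, and \<open>c\<close> would be bounded near the supremum of
  \<open>I\<close>, where it has to blow up.
\<close>
lemma derivative_unbounded_above:
  fixes c c' :: "real \<Rightarrow> real"
  assumes I: "open I" "convex I" "u0 \<in> I" and \<alpha>: "\<alpha> > 0"
    and der: "\<And>u. u \<in> I \<Longrightarrow> (c has_real_derivative c' u) (at u)"
    and mono: "\<And>u v. u \<in> I \<Longrightarrow> v \<in> I \<Longrightarrow> u \<le> v \<Longrightarrow> \<alpha> * (v - u) \<le> c' v - c' u"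
    and blow: "\<And>b K. b \<in> closure I \<Longrightarrow> b \<notin> I \<Longrightarrow> \<exists>d>0. \<forall>x\<in>I. \<bar>x - b\<bar> < d \<longrightarrow> c x > K"
  shows "\<exists>u\<in>I. s \<le> c' u"
proof (rule ccontr)
  assume "\<not> ?thesis"
  then have less: "c' u < s" if "u \<in> I" for u using that by force
  have upper: "u \<le> u0 + (s - c' u0) / \<alpha>" if u: "u \<in> I" for u
  proof (cases "u0 \<le> u")
    case True
    then have "\<alpha> * (u - u0) \<le> s - c' u0" using mono[OF I(3) u] less[OF u] by linarith
    then show ?thesis using \<alpha> by (simp add: field_simps)
  next
    case False
    then show ?thesis using less[OF I(3)] \<alpha> by (simp add: add_increasing2)
  qed
  then have bdd: "bdd_above I" by (rule bdd_aboveI)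
  define b where "b = Sup I"
  have ne: "I \<noteq> {}" using I(3) by blast
  have le: "u \<le> b" if "u \<in> I" for u unfolding b_def by (rule cSup_upper[OF that bdd])
  have clos: "b \<in> closure I" unfolding b_def by (rule closure_contains_Sup[OF ne bdd])
  have notin: "b \<notin> I"
  proof
    assume "b \<in> I"
    then obtain e where e: "e > 0" "ball b e \<subseteq> I" using I(1) openE by blast
    have "b + e / 2 \<in> ball b e" using e(1) by (simp add: dist_real_def)
    then show False using e le[of "b + e / 2"] by auto
  qed
  have bound: "c u \<le> c u0 + (b - u0) * \<bar>s\<bar>" if u: "u \<in> I" "u0 < u" for u
  proof -
    have "{u0..u} \<subseteq> I"
      using I(2,3) u(1) convex_contains_segment closed_segment_eq_real_ivl u(2) by (metis less_imp_le)
    then obtain w where w: "u0 < w" "w < u" "c u - c u0 = (u - u0) * c' w"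
      using MVT2[OF u(2), of c c'] der by (metis atLeastAtMost_iff subsetD)
    have "w \<in> I" using w \<open>{u0..u} \<subseteq> I\<close> by auto
    have "(u - u0) * c' w \<le> (u - u0) * \<bar>s\<bar>"
      using less[OF \<open>w \<in> I\<close>] u by (intro mult_left_mono) auto
    also have "\<dots> \<le> (b - u0) * \<bar>s\<bar>" using le[OF u(1)] by (intro mult_right_mono) auto
    finally show ?thesis using w by linarith
  qed
  obtain d where d: "d > 0" "\<And>x. x \<in> I \<Longrightarrow> \<bar>x - b\<bar> < d \<Longrightarrow> c x > c u0 + (b - u0) * \<bar>s\<bar>"
    using blow[OF clos notin] by blast
  have "u0 < b" using le[OF I(3)] notin I(3) by (metis order_le_less)
  then have "max u0 (b - d) < Sup I" using d(1) by (simp add: b_def)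
  then obtain u where u: "u \<in> I" "max u0 (b - d) < u"
    using less_cSup_iff[OF ne bdd] by blast
  then have "c u > c u0 + (b - u0) * \<bar>s\<bar>" using le[OF u(1)] by (intro d(2)) auto
  then show False using bound[OF u(1)] u(2) by simp
qed

lemma derivative_surjective:
  fixes c c' :: "real \<Rightarrow> real"
  assumes I: "open I" "convex I" "u0 \<in> I" and \<alpha>: "\<alpha> > 0"
    and der: "\<And>u. u \<in> I \<Longrightarrow> (c has_real_derivative c' u) (at u)"
    and mono: "\<And>u v. u \<in> I \<Longrightarrow> v \<in> I \<Longrightarrow> u \<le> v \<Longrightarrow> \<alpha> * (v - u) \<le> c' v - c' u"
    and blow: "\<And>b K. b \<in> closure I \<Longrightarrow> b \<notin> I \<Longrightarrow> \<exists>d>0. \<forall>x\<in>I. \<bar>x - b\<bar> < d \<longrightarrow> c x > K"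
    and cont: "continuous_on I c'"
  shows "\<exists>u\<in>I. c' u = s"
proof -
  obtain v where v: "v \<in> I" "s \<le> c' v"
    using derivative_unbounded_above[OF I \<alpha> der mono blow] by blast
  \<comment> \<open>the lower bound is the upper bound for the reflected function\<close>
  have "\<exists>u\<in>uminus ` I. - s \<le> - c' (- u)"
  proof (rule derivative_unbounded_above[where c = "\<lambda>u. c (- u)" and \<alpha> = \<alpha>])
    show "open (uminus ` I)" "convex (uminus ` I)" "- u0 \<in> uminus ` I" "\<alpha> > 0"
      using I \<alpha> by (auto simp: open_negations convex_negations)
    show "((\<lambda>u. c (- u)) has_real_derivative - c' (- u)) (at u)" if "u \<in> uminus ` I" for u
    proof -
      have "(c has_real_derivative c' (- u)) (at (- u))" using der that by auto
      then show ?thesis by (simp add: DERIV_mirror)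
    qed
    show "\<alpha> * (w - u) \<le> - c' (- w) - - c' (- u)" if "u \<in> uminus ` I" "w \<in> uminus ` I" "u \<le> w" for u w
      using mono[of "- w" "- u"] that by auto
    show "\<exists>d>0. \<forall>x\<in>uminus ` I. \<bar>x - b\<bar> < d \<longrightarrow> K < c (- x)" if b: "b \<in> closure (uminus ` I)" "b \<notin> uminus ` I" for b K
    proof -
      have "uminus ` closure I = closure (uminus ` I)"
        by (rule closure_injective_linear_image) (auto simp: linear_uminus)
      then have "b \<in> uminus ` closure I" using b(1) by blast
      then have "- b \<in> closure I" by auto
      moreover have "- b \<notin> I"
      proof
        assume "- b \<in> I"
        then have "- (- b) \<in> uminus ` I" by (rule imageI)
        then show False using b(2) by simp
      qed
      ultimately obtain d where d: "d > 0" "\<And>x. x \<in> I \<Longrightarrow> \<bar>x - - b\<bar> < d \<Longrightarrow> K < c x"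
        using blow by blast
      have "K < c (- x)" if x: "x \<in> uminus ` I" "\<bar>x - b\<bar> < d" for x
      proof (rule d(2))
        show "- x \<in> I" using x(1) by auto
        show "\<bar>- x - - b\<bar> < d" using x(2) by linarith
      qed
      then show ?thesis using d(1) by blast
    qed
  qed
  then obtain w where w: "w \<in> uminus ` I" "- s \<le> - c' (- w)" by blast
  then have u: "- w \<in> I" "c' (- w) \<le> s" by auto
  have "connected (c' ` I)"
    by (rule connected_continuous_image[OF cont convex_connected[OF I(2)]])
  from connectedD_interval[OF this imageI[OF u(1)] imageI[OF v(1)] u(2) v(2)]
  show ?thesis by blast
qed

locale olc =
  fixes N :: "('n::finite, 'k::finite) grid" and \<alpha> :: real
  assumes net: "network N" and costs: "cost_assumption \<alpha> N" and slater: "olc_strictly_feasible N"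
begin

abbreviation demand_interior :: "'n \<Rightarrow> real set" where
  "demand_interior i \<equiv> interior (demand_range N i)"

abbreviation marginal_cost :: "'n \<Rightarrow> real \<Rightarrow> real" where
  "marginal_cost i \<equiv> deriv (cost N i)"

lemma \<alpha>_pos: "\<alpha> > 0"
  using costs by (simp add: cost_assumption_def)

lemma convex_demand_interior: "convex (demand_interior i)"
proof -
  have "is_interval (demand_range N i)"
    unfolding is_interval_1 demand_range_def
    by (intro ballI allI impI CollectI) (metis (mono_tags, lifting) mem_Collect_eq ereal_less_eq(3) order_trans)
  then show ?thesis by (simp add: is_interval_convex convex_interior)
qed

lemma demand_interior_nonempty: "\<exists>u. u \<in> demand_interior i"
  using slater unfolding olc_strictly_feasible_def by blast

lemma cost_derivative:
  assumes "u \<in> demand_interior i"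
  shows "(cost N i has_real_derivative marginal_cost i u) (at u)"
    and "(marginal_cost i has_real_derivative deriv (marginal_cost i) u) (at u)"
    and "deriv (marginal_cost i) u \<ge> \<alpha>"
  using costs assms unfolding cost_assumption_def Let_def
  by (simp_all add: DERIV_deriv_iff_real_differentiable)

lemma Icc_in_demand_interior:
  assumes "u \<in> demand_interior i" "v \<in> demand_interior i" "u \<le> w" "w \<le> v"
  shows "w \<in> demand_interior i"
  using convex_demand_interior[of i] assms unfolding is_interval_convex_1[symmetric] is_interval_1 by blast

lemma marginal_cost_increasing:
  assumes "u \<in> demand_interior i" "v \<in> demand_interior i" "u \<le> v"
  shows "\<alpha> * (v - u) \<le> marginal_cost i v - marginal_cost i u"
proof (cases "u = v")
  case False
  then have "u < v" using assms by simp
  moreover have "(marginal_cost i has_real_derivative deriv (marginal_cost i) w) (at w)"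
    if "u \<le> w" "w \<le> v" for w
    using cost_derivative(2) Icc_in_demand_interior assms that by blast
  ultimately obtain w where w: "u < w" "w < v"
    "marginal_cost i v - marginal_cost i u = (v - u) * deriv (marginal_cost i) w"
    using MVT2 by blast
  have "w \<in> demand_interior i" using Icc_in_demand_interior[OF assms(1,2)] w by simp
  from cost_derivative(3)[OF this] have "\<alpha> * (v - u) \<le> deriv (marginal_cost i) w * (v - u)"
    using assms(3) by (intro mult_right_mono) auto
  then show ?thesis using w(3) by (simp add: mult.commute)
qed simp

lemma cost_above_tangent:
  assumes "u \<in> demand_interior i" "v \<in> demand_interior i"
  shows "cost N i u + marginal_cost i u * (v - u) \<le> cost N i v"
proof (rule linorder_cases[of u v])
  assume "u < v"
  then obtain w where w: "u < w" "w < v" "cost N i v - cost N i u = (v - u) * marginal_cost i w"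
    using MVT2[of u v "cost N i" "marginal_cost i"] cost_derivative(1) Icc_in_demand_interior assms by metis
  have "w \<in> demand_interior i" using Icc_in_demand_interior[OF assms] w by simp
  then have "marginal_cost i u \<le> marginal_cost i w"
    using marginal_cost_increasing[OF assms(1) _ less_imp_le[OF w(1)]] \<alpha>_pos w(1)
    by (smt (verit) mult_pos_pos)
  then have "marginal_cost i u * (v - u) \<le> marginal_cost i w * (v - u)"
    using \<open>u < v\<close> by (intro mult_right_mono) auto
  then show ?thesis using w(3) by (simp add: mult.commute)
next
  assume "v < u"
  then obtain w where w: "v < w" "w < u" "cost N i u - cost N i v = (u - v) * marginal_cost i w"
    using MVT2[of v u "cost N i" "marginal_cost i"] cost_derivative(1) Icc_in_demand_interior assms by metis
  have "w \<in> demand_interior i" using Icc_in_demand_interior[OF assms(2,1)] w by simp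
  then have "marginal_cost i w \<le> marginal_cost i u"
    using marginal_cost_increasing[OF _ assms(1) less_imp_le[OF w(2)]] \<alpha>_pos w(2)
    by (smt (verit) mult_pos_pos)
  then have "marginal_cost i w * (u - v) \<le> marginal_cost i u * (u - v)"
    using \<open>v < u\<close> by (intro mult_right_mono) auto
  then show ?thesis using w(3) by (simp add: algebra_simps)
qed simp

lemma cost_blows_up:
  assumes "b \<in> closure (demand_interior i)" "b \<notin> demand_interior i"
  shows "\<exists>d>0. \<forall>x\<in>demand_interior i. \<bar>x - b\<bar> < d \<longrightarrow> cost N i x > K"
proof -
  have "b \<in> closure (demand_range N i)"
    using assms(1) closure_mono[OF interior_subset] by blast
  then have "b \<in> frontier (demand_range N i)" using assms(2) by (simp add: frontier_def)
  then have "filterlim (cost N i) at_top (at b within demand_interior i)"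
    using costs unfolding cost_assumption_def Let_def by blast
  then have "\<forall>\<^sub>F x in at b within demand_interior i. cost N i x > K"
    unfolding filterlim_at_top_dense by blast
  then obtain d where "d > 0" "\<And>x. x \<in> demand_interior i \<Longrightarrow> x \<noteq> b \<Longrightarrow> dist x b < d \<Longrightarrow> cost N i x > K"
    unfolding eventually_at by blast
  then show ?thesis using assms(2) by (metis dist_real_def)
qed

lemma continuous_on_marginal_cost: "continuous_on (demand_interior i) (marginal_cost i)"
  using cost_derivative(2) DERIV_isCont continuous_at_imp_continuous_on by blast

text \<open>
  The blow-up at finite end points and the growth of the marginal cost at infinite ones make the marginal cost a
  bijection onto the reals, so the inverse that defines \<^const>\<open>demand\<close> takes no default values.
\<close>
lemma demand_interior_demand: "demand N i s \<in> demand_interior i"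
  and marginal_cost_demand: "marginal_cost i (demand N i s) = s"
proof -
  obtain u0 where "u0 \<in> demand_interior i" using demand_interior_nonempty by blast
  then have "\<exists>u\<in>demand_interior i. marginal_cost i u = s"
    using derivative_surjective[OF open_interior convex_demand_interior _ \<alpha>_pos cost_derivative(1)
        marginal_cost_increasing cost_blows_up continuous_on_marginal_cost] by blast
  then have "s \<in> marginal_cost i ` demand_interior i" by blast
  then show "demand N i s \<in> demand_interior i" "marginal_cost i (demand N i s) = s"
    unfolding demand_def by (rule inv_into_into, rule f_inv_into_f)
qed

text \<open>
  Strong convexity of the cost turns into cocoercivity of demand, which makes prices dissipate.
\<close>
lemma demand_strongly_monotone:
  "\<alpha> * (demand N i s - demand N i s')\<^sup>2 \<le> (demand N i s - demand N i s') * (s - s')"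
proof (cases "demand N i s' \<le> demand N i s")
  case True
  have "\<alpha> * (demand N i s - demand N i s') \<le> s - s'"
    using marginal_cost_increasing[OF demand_interior_demand demand_interior_demand True]
    by (simp add: marginal_cost_demand)
  then have "(demand N i s - demand N i s') * (\<alpha> * (demand N i s - demand N i s')) \<le> (demand N i s - demand N i s') * (s - s')"
    using True by (intro mult_left_mono) auto
  then show ?thesis by (simp add: power2_eq_square algebra_simps)
next
  case False
  have "\<alpha> * (demand N i s' - demand N i s) \<le> s' - s"
    using marginal_cost_increasing[OF demand_interior_demand demand_interior_demand, of i s s'] False
    by (simp add: marginal_cost_demand)
  then have "(demand N i s' - demand N i s) * (\<alpha> * (demand N i s' - demand N i s)) \<le> (demand N i s' - demand N i s) * (s' - s)"
    using False by (intro mult_left_mono) auto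
  then show ?thesis by (simp add: power2_eq_square algebra_simps)
qed

lemma demand_monotone: "0 \<le> (demand N i s - demand N i s') * (s - s')"
  using demand_strongly_monotone[of i s s'] \<alpha>_pos zero_le_power2[of "demand N i s - demand N i s'"]
  by (meson mult_nonneg_nonneg less_imp_le order_trans)

lemma demand_product_zero_imp_eq:
  assumes "(demand N i s - demand N i s') * (s - s') = 0"
  shows "s = s'"
  using assms by (metis mult_eq_0_iff eq_iff_diff_eq_0 marginal_cost_demand)

lemma demand_marginal_cost:
  assumes "u \<in> demand_interior i"
  shows "demand N i (marginal_cost i u) = u"
proof -
  have "\<alpha> * \<bar>demand N i (marginal_cost i u) - u\<bar> \<le> 0"
    using marginal_cost_increasing[OF assms demand_interior_demand, of "marginal_cost i u"]
      marginal_cost_increasing[OF demand_interior_demand assms, of "marginal_cost i u"]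
    by (cases "u \<le> demand N i (marginal_cost i u)") (simp_all add: marginal_cost_demand)
  then show ?thesis using \<alpha>_pos by (simp add: mult_le_0_iff)
qed

lemma continuous_demand: "continuous_on UNIV (demand N i)"
proof -
  have "(1 / \<alpha>)-lipschitz_on UNIV (demand N i)"
  proof (rule lipschitz_onI)
    fix s s'
    define \<delta> where "\<delta> = \<bar>demand N i s - demand N i s'\<bar>"
    have "\<alpha> * \<delta> * \<delta> \<le> \<bar>s - s'\<bar> * \<delta>"
      using demand_strongly_monotone[of i s s'] abs_ge_self[of "(demand N i s - demand N i s') * (s - s')"]
      unfolding \<delta>_def by (simp add: abs_mult power2_eq_square mult.commute mult.left_commute)
    then have "\<alpha> * \<delta> \<le> \<bar>s - s'\<bar>"
      by (cases "\<delta> = 0") (use \<delta>_def in auto)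
    then show "dist (demand N i s) (demand N i s') \<le> 1 / \<alpha> * dist s s'"
      using \<alpha>_pos by (simp add: dist_real_def \<delta>_def field_simps)
  qed (use \<alpha>_pos in simp)
  then show ?thesis by (rule lipschitz_on_continuous_on)
qed

text \<open>
  The demand at price \<open>s\<close> minimizes cost minus \<open>s\<close> times consumption; this is the
  optimality certificate for OLC and also the concavity of the conjugate term in the Lagrangian.
\<close>
lemma cost_ge_tangent_at_demand:
  "u \<in> demand_interior i \<Longrightarrow> cost N i (demand N i s) + s * (u - demand N i s) \<le> cost N i u"
  using cost_above_tangent[OF demand_interior_demand, of u i s] by (simp add: marginal_cost_demand)

end


section \<open>The gradient of the reduced Lagrangian\<close>

lemma gradient_eqI:
  assumes "GDERIV f z :> g"
  shows "gradient f z = g"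
  unfolding gradient_def
proof (rule the_equality)
  show "GDERIV f z :> g" by (rule assms)
  fix g' assume "GDERIV f z :> g'"
  then have "(\<lambda>h. h \<bullet> g') = (\<lambda>h. h \<bullet> g)"
    using assms unfolding gderiv_def by (rule has_derivative_unique)
  then show "g' = g" by (metis vector_eq_ldot)
qed

lemma GDERIV_if_remainder_le:
  fixes f :: "'z::real_inner \<Rightarrow> real"
  assumes g: "isCont g z"
    and rem: "\<And>w. \<bar>f w - f z - (w - z) \<bullet> g z\<bar> \<le> norm (w - z) * norm (g w - g z)"
  shows "GDERIV f z :> g z"
  unfolding gderiv_def has_derivative_at_alt
proof (intro conjI allI impI)
  show "bounded_linear (\<lambda>h. h \<bullet> g z)" by (rule bounded_linear_inner_left)
  fix e :: real assume "e > 0"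
  then obtain d where d: "d > 0" "\<And>w. dist w z < d \<Longrightarrow> dist (g w) (g z) < e"
    using g unfolding continuous_at_eps_delta by blast
  show "\<exists>d>0. \<forall>w. norm (w - z) < d \<longrightarrow> norm (f w - f z - (w - z) \<bullet> g z) \<le> e * norm (w - z)"
  proof (intro exI[of _ d] conjI allI impI d(1))
    fix w assume "norm (w - z) < d"
    then have "norm (g w - g z) \<le> e" using d(2)[of w] by (simp add: dist_norm)
    then have "norm (w - z) * norm (g w - g z) \<le> norm (w - z) * e" by (intro mult_left_mono) auto
    then show "norm (f w - f z - (w - z) \<bullet> g z) \<le> e * norm (w - z)"
      using rem[of w] by (simp add: mult.commute)
  qed
qed

text \<open>
  Convex and concave functions with a continuous choice of subgradients satisfy this two-sided bound, and the
  reduced Lagrangian is convex in the primal and concave in the dual variables.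
\<close>
lemma GDERIV_between_tangents:
  fixes f :: "'z::real_inner \<Rightarrow> real"
  assumes g: "isCont g z"
    and between: "\<And>w. f w - f z \<in> closed_segment ((w - z) \<bullet> g z) ((w - z) \<bullet> g w)"
  shows "GDERIV f z :> g z"
proof (rule GDERIV_if_remainder_le[OF g])
  fix w
  have "\<bar>f w - f z - (w - z) \<bullet> g z\<bar> \<le> \<bar>(w - z) \<bullet> g w - (w - z) \<bullet> g z\<bar>"
    using between[of w] unfolding closed_segment_eq_real_ivl by (auto split: if_splits)
  also have "\<dots> = \<bar>(w - z) \<bullet> (g w - g z)\<bar>" by (simp add: inner_diff_right)
  also have "\<dots> \<le> norm (w - z) * norm (g w - g z)" by (rule Cauchy_Schwarz_ineq2)
  finally show "\<bar>f w - f z - (w - z) \<bullet> g z\<bar> \<le> norm (w - z) * norm (g w - g z)" .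
qed

lemma inner_transpose: "(transpose A *v x) \<bullet> y = x \<bullet> (A *v y)" for A :: "real^'m^'n"
  by (simp add: transpose_matrix_vector dot_lmul_matrix)

lemma inner_matrix_transpose: "y \<bullet> (transpose A *v x) = (A *v y) \<bullet> x" for A :: "real^'m^'n"
  by (metis inner_transpose inner_commute)

lemma matrix_vector_diag: "diag v *v x = (\<chi> i. v $ i * x $ i)"
  unfolding diag_def matrix_vector_mult_def vec_eq_iff
  by (simp add: if_distrib[of "\<lambda>c. c * _"] cong: if_cong)

context olc
begin

abbreviation "inc \<equiv> incidence N"
abbreviation "area \<equiv> area_incidence N"
abbreviation "lap \<equiv> laplacian N"

definition flow :: "real^'n \<Rightarrow> real^('n \<times> 'n)" where
  "flow \<theta> = B_mat N *v (transpose inc *v \<theta>)"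

lemma flow_eq: "(B_mat N ** transpose inc) *v \<theta> = flow \<theta>"
  unfolding flow_def matrix_vector_mul_assoc ..

lemma laplacian_flow: "lap *v \<theta> = inc *v flow \<theta>"
  unfolding flow_def laplacian_def matrix_vector_mul_assoc matrix_mul_assoc ..

lemma area_flow: "(area ** B_mat N ** transpose inc) *v \<theta> = area *v flow \<theta>"
  unfolding flow_def matrix_vector_mul_assoc matrix_mul_assoc ..

lemma inner_B_mat: "(B_mat N *v a) \<bullet> b = a \<bullet> (B_mat N *v b)"
  by (simp add: B_mat_def matrix_vector_diag inner_vec_def mult_ac)

lemma inner_inc_B: "\<theta> \<bullet> ((inc ** B_mat N) *v f) = f \<bullet> flow \<theta>"
  by (metis flow_def inner_B_mat inner_commute inner_transpose matrix_vector_mul_assoc)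

lemma inner_area_price: "\<theta> \<bullet> ((inc ** B_mat N ** transpose area) *v \<pi>) = \<pi> \<bullet> (area *v flow \<theta>)"
  by (metis inner_inc_B inner_transpose matrix_vector_mul_assoc)

lemma inner_laplacian: "\<theta> \<bullet> (lap *v \<eta>) = (transpose inc *v \<theta>) \<bullet> flow \<eta>"
  by (metis inner_transpose laplacian_flow)

lemma inner_laplacian_commute: "\<theta> \<bullet> (lap *v \<eta>) = \<eta> \<bullet> (lap *v \<theta>)"
  by (metis flow_def inner_B_mat inner_commute inner_laplacian)

definition demands :: "real^'n \<Rightarrow> real^'n" where
  "demands s = (\<chi> i. demand N i (s $ i))"

definition grad_x :: "('n, 'k) dual \<Rightarrow> 'n primal" where
  "grad_x = (\<lambda>(l, \<nu>, \<pi>, \<rho>p, \<rho>m).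
     (- (lap *v l - (inc ** B_mat N ** transpose area) *v \<pi> - (inc ** B_mat N) *v (\<rho>p - \<rho>m)),
      - (transpose inc *v \<nu>)))"

definition grad_dual :: "'n primal \<Rightarrow> ('n, 'k) dual \<Rightarrow> ('n, 'k) dual" where
  "grad_dual = (\<lambda>(\<phi>, P) (l, \<nu>, \<pi>, \<rho>p, \<rho>m).
     (P_in N - demands (l + \<nu>) - lap *v \<phi>,
      P_in N - demands (l + \<nu>) - diag (damping N) *v \<nu> - inc *v P,
      area *v flow \<phi> - P_hat N, flow \<phi> - P_max N, P_min N - flow \<phi>))"

lemma damping_pos: "damping N $ i > 0"
  using net by (simp add: network_def)

lemma lagrangian_affine_primal:
  "lagrangian N x' \<sigma> - lagrangian N x \<sigma> = (x' - x) \<bullet> grad_x \<sigma>"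
  by (cases \<sigma>; cases x; cases x') (simp add: lagrangian_def grad_x_def algebra_simps inner_diff_left inner_diff_right inner_minus_right)

lemma Phi_strongly_concave:
  "\<Phi> N i l' n' - \<Phi> N i l n \<le> (l' - l) * (P_in N $ i - demand N i (l + n))
     + (n' - n) * (P_in N $ i - demand N i (l + n) - damping N $ i * n) - damping N $ i / 2 * (n' - n)\<^sup>2"
  using cost_ge_tangent_at_demand[OF demand_interior_demand, of i "l' + n'" "l + n"]
  unfolding \<Phi>_def by (simp add: algebra_simps power2_eq_square add_divide_distrib)

text \<open>
  Joint concavity in all multipliers, with a quadratic surplus in the frequencies that makes the eliminated load
  frequencies unique.
\<close>
lemma lagrangian_concave_dual:
  "lagrangian N x (l', \<nu>', \<pi>', \<rho>p', \<rho>m') - lagrangian N x (l, \<nu>, \<pi>, \<rho>p, \<rho>m)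
   \<le> ((l', \<nu>', \<pi>', \<rho>p', \<rho>m') - (l, \<nu>, \<pi>, \<rho>p, \<rho>m)) \<bullet> grad_dual x (l, \<nu>, \<pi>, \<rho>p, \<rho>m)
     - (\<Sum>i\<in>UNIV. damping N $ i / 2 * (\<nu>' $ i - \<nu> $ i)\<^sup>2)"
proof -
  obtain \<phi> P where x: "x = (\<phi>, P)" by (cases x)
  let ?d = "demands (l + \<nu>)"
  have "(\<Sum>i\<in>UNIV. \<Phi> N i (l' $ i) (\<nu>' $ i)) - (\<Sum>i\<in>UNIV. \<Phi> N i (l $ i) (\<nu> $ i))
     = (\<Sum>i\<in>UNIV. \<Phi> N i (l' $ i) (\<nu>' $ i) - \<Phi> N i (l $ i) (\<nu> $ i))"
    by (rule sum_subtractf[symmetric])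
  also have "\<dots> \<le> (\<Sum>i\<in>UNIV. (l' $ i - l $ i) * (P_in N $ i - demand N i (l $ i + \<nu> $ i))
     + (\<nu>' $ i - \<nu> $ i) * (P_in N $ i - demand N i (l $ i + \<nu> $ i) - damping N $ i * \<nu> $ i)
     - damping N $ i / 2 * (\<nu>' $ i - \<nu> $ i)\<^sup>2)"
    by (rule sum_mono) (rule Phi_strongly_concave)
  also have "\<dots> = (l' - l) \<bullet> (P_in N - ?d) + (\<nu>' - \<nu>) \<bullet> (P_in N - ?d - diag (damping N) *v \<nu>)
     - (\<Sum>i\<in>UNIV. damping N $ i / 2 * (\<nu>' $ i - \<nu> $ i)\<^sup>2)"
    by (simp add: inner_vec_def demands_def matrix_vector_diag sum.distrib sum_subtractf)
  finally have Phi: "(\<Sum>i\<in>UNIV. \<Phi> N i (l' $ i) (\<nu>' $ i)) - (\<Sum>i\<in>UNIV. \<Phi> N i (l $ i) (\<nu> $ i)) \<le> \<dots>" .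
  have linear: "P \<bullet> (transpose inc *v a) = a \<bullet> (inc *v P)" "\<phi> \<bullet> (lap *v b) = b \<bullet> (lap *v \<phi>)" for a b
    by (rule inner_matrix_transpose[THEN trans[OF _ inner_commute]], rule inner_laplacian_commute)
  show ?thesis
    using Phi unfolding x lagrangian_def grad_dual_def prod.case diff_Pair inner_Pair
      inner_diff_right[of \<phi>] inner_inc_B inner_area_price linear
    by (simp add: inner_diff_left inner_diff_right)
qed

definition load_frequency :: "'n \<Rightarrow> real \<Rightarrow> real \<Rightarrow> real" where
  "load_frequency i l q = (SOME n. P_in N $ i - demand N i (l + n) - damping N $ i * n - q = 0)"

text \<open>
  The left-hand side decreases strictly in the frequency and has both signs: moving the frequency by
  \<open>\<bar>T - d(l)\<bar> / D\<close> reaches the target \<open>T\<close>, since demand moves in the same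
  direction.
\<close>
lemma load_frequency: "P_in N $ i - demand N i (l + load_frequency i l q) - damping N $ i * load_frequency i l q - q = 0"
proof -
  define T where "T = P_in N $ i - q"
  define f where "f n = demand N i (l + n) + damping N $ i * n" for n
  define b where "b = \<bar>T - demand N i l\<bar> / damping N $ i"
  have D: "damping N $ i > 0" by (rule damping_pos)
  then have b: "b \<ge> 0" "damping N $ i * b = \<bar>T - demand N i l\<bar>" by (simp_all add: b_def)
  have mono: "demand N i u \<le> demand N i v" if "u \<le> v" for u v
    using demand_monotone[of i v u] that by (cases "u = v") (auto simp: zero_le_mult_iff)
  have "f (- b) \<le> T" "T \<le> f b"
    using mono[of "l + - b" l] mono[of l "l + b"] b by (auto simp: f_def)
  moreover have "continuous_on {- b..b} f"
    unfolding f_def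
    by (intro continuous_intros continuous_on_compose2[OF continuous_demand]) auto
  ultimately obtain n where "f n = T" using IVT'[of f "- b" T b] b(1) by auto
  then have "P_in N $ i - demand N i (l + n) - damping N $ i * n - q = 0" by (simp add: f_def T_def)
  then show ?thesis unfolding load_frequency_def by (rule someI)
qed

text \<open>
  If the total price \<open>l + n\<close> rises together with the frequency, demand does not fall and the
  balance equation bounds \<open>n - n'\<close> by the change of \<open>q\<close>; otherwise \<open>n -
  n'\<close> is bounded by the change of \<open>l\<close>.
\<close>
lemma load_frequency_estimate:
  assumes "P_in N $ i - demand N i (l + n) - damping N $ i * n - q = 0"
    and "P_in N $ i - demand N i (l' + n') - damping N $ i * n' - q' = 0"
  shows "\<bar>n - n'\<bar> \<le> \<bar>q - q'\<bar> / damping N $ i + \<bar>l - l'\<bar>"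
proof -
  have half: "n - n' \<le> \<bar>q - q'\<bar> / damping N $ i + \<bar>l - l'\<bar>"
    if "P_in N $ i - demand N i (l + n) - damping N $ i * n - q = 0"
      "P_in N $ i - demand N i (l' + n') - damping N $ i * n' - q' = 0" for n n' l l' q q'
  proof (cases "l' + n' < l + n")
    case True
    then have "demand N i (l' + n') \<le> demand N i (l + n)"
      using demand_monotone[of i "l + n" "l' + n'"] by (auto simp: zero_le_mult_iff)
    then have "damping N $ i * (n - n') \<le> \<bar>q - q'\<bar>" using that by (simp add: algebra_simps)
    then have "n - n' \<le> \<bar>q - q'\<bar> / damping N $ i"
      using damping_pos[of i] by (simp add: field_simps)
    then show ?thesis by simp
  next
    case False
    then have "n - n' \<le> \<bar>l - l'\<bar>" by simp
    moreover have "0 \<le> \<bar>q - q'\<bar> / damping N $ i" using damping_pos[of i] by simp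
    ultimately show ?thesis by linarith
  qed
  show ?thesis using half[OF assms] half[OF assms(2,1)] by (simp add: abs_minus_commute abs_le_iff)
qed

lemma load_frequency_unique:
  assumes "P_in N $ i - demand N i (l + n) - damping N $ i * n - q = 0"
  shows "n = load_frequency i l q"
  using load_frequency_estimate[OF assms load_frequency[of i l q]] by simp

lemma continuous_load_frequency: "continuous_on UNIV (\<lambda>p. load_frequency i (fst p) (snd p))"
proof -
  have "(1 / damping N $ i + 1)-lipschitz_on UNIV (\<lambda>p. load_frequency i (fst p) (snd p))"
  proof (rule lipschitz_onI)
    fix p p' :: "real \<times> real"
    have "\<bar>snd p - snd p'\<bar> / damping N $ i \<le> dist p p' / damping N $ i"
      using dist_snd_le[of p p'] damping_pos[of i] by (intro divide_right_mono) (auto simp: dist_real_def)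
    moreover have "\<bar>fst p - fst p'\<bar> \<le> dist p p'" using dist_fst_le[of p p'] by (simp add: dist_real_def)
    ultimately show "dist (load_frequency i (fst p) (snd p)) (load_frequency i (fst p') (snd p')) \<le> (1 / damping N $ i + 1) * dist p p'"
      using load_frequency_estimate[OF load_frequency load_frequency, of i "fst p" "snd p" "fst p'" "snd p'"]
      by (simp add: dist_real_def[of "load_frequency i _ _"] algebra_simps)
  qed (use damping_pos[of i] in simp)
  then show ?thesis by (rule lipschitz_on_continuous_on)
qed

definition frequency :: "'n primal \<Rightarrow> ('n, 'k) dual \<Rightarrow> real^'n" where
  "frequency = (\<lambda>(\<phi>, P) (l, \<nu>, \<pi>, \<rho>p, \<rho>m).
     (\<chi> i. if i \<in> generators N then \<nu> $ i else load_frequency i (l $ i) ((inc *v P) $ i)))"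

text \<open>
  The multiplier \<open>y\<close> with its load frequencies replaced by the maximizing ones.
\<close>
definition completed :: "'n primal \<Rightarrow> ('n, 'k) dual \<Rightarrow> ('n, 'k) dual" where
  "completed x = (\<lambda>(l, \<nu>, \<pi>, \<rho>p, \<rho>m). (l, frequency x (l, \<nu>, \<pi>, \<rho>p, \<rho>m), \<pi>, \<rho>p, \<rho>m))"

lemma grad_dual_load:
  assumes "i \<notin> generators N"
  shows "fst (snd (grad_dual x (completed x y))) $ i = 0"
  using assms load_frequency
  by (cases x; cases y) (simp add: grad_dual_def completed_def frequency_def demands_def matrix_vector_diag)

text \<open>
  The load components of the dual gradient vanish at a completed multiplier, so replacing load frequencies is
  invisible in inner products with it. This is the envelope property, and it carries every statement about the
  full Lagrangian over to the reduced one.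
\<close>
lemma inner_completed_diff:
  "(completed x' y' - completed x y) \<bullet> grad_dual x (completed x y) = (y' - y) \<bullet> grad_dual x (completed x y)"
proof -
  obtain l \<nu> \<pi> \<rho>p \<rho>m l' \<nu>' \<pi>' \<rho>p' \<rho>m' where y: "y = (l, \<nu>, \<pi>, \<rho>p, \<rho>m)" "y' = (l', \<nu>', \<pi>', \<rho>p', \<rho>m')"
    by (cases y; cases y')
  obtain gl gn gr where g: "grad_dual x (completed x y) = (gl, gn, gr)" by (cases "grad_dual x (completed x y)")
  have gn: "gn $ i = 0" if "i \<notin> generators N" for i using grad_dual_load[OF that, of x y] g by simp
  have gen: "frequency x y $ i = \<nu> $ i" "frequency x' y' $ i = \<nu>' $ i" if "i \<in> generators N" for i
    using that by (auto simp: y frequency_def split: prod.splits)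
  have "(frequency x' y' - frequency x y) \<bullet> gn = (\<nu>' - \<nu>) \<bullet> gn"
    unfolding inner_vec_def using gn gen by (intro sum.cong refl) (metis inner_zero_right vector_minus_component)
  then show ?thesis unfolding g by (simp add: completed_def y)
qed

lemma lagrangian_join_le:
  assumes "\<nu>\<^sub>L \<in> vecs_on (loads N)"
  shows "lagrangian N x (join_nu N y \<nu>\<^sub>L) \<le> lagrangian N x (completed x y)
     - (\<Sum>i\<in>loads N. damping N $ i / 2 * (\<nu>\<^sub>L $ i - frequency x y $ i)\<^sup>2)"
proof -
  obtain l \<nu> \<pi> \<rho>p \<rho>m where y: "y = (l, \<nu>, \<pi>, \<rho>p, \<rho>m)" by (cases y)
  define \<nu>' where "\<nu>' = (\<chi> i. if i \<in> generators N then \<nu> $ i else \<nu>\<^sub>L $ i)"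
  have j: "join_nu N y \<nu>\<^sub>L = (l, \<nu>', \<pi>, \<rho>p, \<rho>m)" by (simp add: join_nu_def y \<nu>'_def)
  have f: "completed x y = (l, frequency x y, \<pi>, \<rho>p, \<rho>m)" by (simp add: completed_def y)
  have gen: "frequency x y $ i = \<nu> $ i" if "i \<in> generators N" for i
    using that by (auto simp: y frequency_def split: prod.splits)
  obtain gl gn gr where g: "grad_dual x (completed x y) = (gl, gn, gr)" by (cases "grad_dual x (completed x y)")
  have gn: "gn $ i = 0" if "i \<notin> generators N" for i using grad_dual_load[OF that, of x y] g by simp
  have "(\<nu>' - frequency x y) \<bullet> gn = 0"
    unfolding inner_vec_def using gn gen by (intro sum.neutral) (auto simp: \<nu>'_def)
  then have "((l, \<nu>', \<pi>, \<rho>p, \<rho>m) - completed x y) \<bullet> grad_dual x (completed x y) = 0"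
    by (subst g) (simp add: f)
  moreover have "(\<Sum>i\<in>UNIV. damping N $ i / 2 * (\<nu>' $ i - frequency x y $ i)\<^sup>2)
      = (\<Sum>i\<in>loads N. damping N $ i / 2 * (\<nu>\<^sub>L $ i - frequency x y $ i)\<^sup>2)"
    by (rule sum.mono_neutral_cong_right) (auto simp: loads_def \<nu>'_def gen)
  ultimately show ?thesis
    using lagrangian_concave_dual[of x l \<nu>' \<pi> \<rho>p \<rho>m l "frequency x y" \<pi> \<rho>p \<rho>m] j f by simp
qed

lemma join_nu_star: "join_nu N y (nu_star N x y) = completed x y"
  and nu_star_loads: "nu_star N x y \<in> vecs_on (loads N)"
proof -
  let ?L = "\<lambda>\<nu>. lagrangian N x (join_nu N y \<nu>)"
  obtain l \<nu> \<pi> \<rho>p \<rho>m where y: "y = (l, \<nu>, \<pi>, \<rho>p, \<rho>m)" by (cases y)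
  have gen: "frequency x y $ i = \<nu> $ i" if "i \<in> generators N" for i
    using that by (auto simp: y frequency_def split: prod.splits)
  define \<nu>h where "\<nu>h = (\<chi> i. if i \<in> generators N then 0 else frequency x y $ i)"
  have \<nu>h: "\<nu>h \<in> vecs_on (loads N)" by (simp add: \<nu>h_def vecs_on_def loads_def)
  have jh: "join_nu N y \<nu>h = completed x y"
    using gen by (auto simp: join_nu_def completed_def y \<nu>h_def vec_eq_iff)
  have nonneg: "0 \<le> (\<Sum>i\<in>loads N. damping N $ i / 2 * (\<nu>' $ i - frequency x y $ i)\<^sup>2)" for \<nu>'
    using damping_pos by (intro sum_nonneg) (simp add: less_imp_le)
  have "is_arg_max ?L (\<lambda>\<nu>. \<nu> \<in> vecs_on (loads N)) \<nu>h"
    unfolding is_arg_max_def jh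
  proof (intro conjI \<nu>h notI)
    assume "\<exists>\<nu>'. \<nu>' \<in> vecs_on (loads N) \<and> ?L \<nu>' > lagrangian N x (completed x y)"
    then obtain \<nu>' where "\<nu>' \<in> vecs_on (loads N)" "?L \<nu>' > lagrangian N x (completed x y)" by blast
    then show False using lagrangian_join_le[of \<nu>' x y] nonneg[of \<nu>'] by linarith
  qed
  then have max: "is_arg_max ?L (\<lambda>\<nu>. \<nu> \<in> vecs_on (loads N)) (nu_star N x y)"
    unfolding nu_star_def arg_max_on_def arg_max_def by (rule someI)
  then show mem: "nu_star N x y \<in> vecs_on (loads N)" by (simp add: is_arg_max_def)
  have "?L (nu_star N x y) \<ge> lagrangian N x (completed x y)"
    using max \<nu>h jh by (auto simp: is_arg_max_linorder)
  then have "(\<Sum>i\<in>loads N. damping N $ i / 2 * (nu_star N x y $ i - frequency x y $ i)\<^sup>2) = 0"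
    using lagrangian_join_le[OF mem, of x y] nonneg[of "nu_star N x y"] by linarith
  then have "\<forall>i\<in>loads N. damping N $ i / 2 * (nu_star N x y $ i - frequency x y $ i)\<^sup>2 = 0"
    using damping_pos by (subst (asm) sum_nonneg_eq_0_iff) (auto simp: less_imp_le)
  then have load: "nu_star N x y $ i = frequency x y $ i" if "i \<in> loads N" for i
    using that damping_pos[of i] by fastforce
  have "nu_star N x y $ i = frequency x y $ i" if "i \<notin> generators N" for i
    using load that by (simp add: loads_def)
  then show "join_nu N y (nu_star N x y) = completed x y"
    using gen by (auto simp: join_nu_def completed_def y vec_eq_iff)
qed

lemma reduced_lagrangian_eq: "reduced_lagrangian N x y = lagrangian N x (completed x y)"
  by (simp add: reduced_lagrangian_def join_nu_star)

lemma reduced_lagrangian_ge: "lagrangian N x (completed x' y) \<le> reduced_lagrangian N x y"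
proof -
  have "0 \<le> (\<Sum>i\<in>loads N. damping N $ i / 2 * (nu_star N x' y $ i - frequency x y $ i)\<^sup>2)"
    using damping_pos by (intro sum_nonneg) (simp add: less_imp_le)
  then show ?thesis
    using lagrangian_join_le[OF nu_star_loads[where x = x' and y = y], where x = x and y = y, unfolded join_nu_star]
    unfolding reduced_lagrangian_eq by linarith
qed

lemma continuous_frequency: "continuous_on UNIV (\<lambda>z. frequency (fst z) (snd z))"
proof -
  have eq: "frequency (fst z) (snd z) = (\<chi> i. if i \<in> generators N then fst (snd (snd z)) $ i
     else load_frequency i (fst (snd z) $ i) ((inc *v snd (fst z)) $ i))" for z
    by (simp add: frequency_def case_prod_unfold)
  have c: "continuous_on UNIV (\<lambda>z::('n primal \<times> ('n, 'k) dual). if i \<in> generators N then fst (snd (snd z)) $ i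
     else load_frequency i (fst (snd z) $ i) ((inc *v snd (fst z)) $ i))" for i
  proof (cases "i \<in> generators N")
    case True
    then show ?thesis by (auto intro!: continuous_intros)
  next
    case False
    have "continuous_on UNIV (\<lambda>z::('n primal \<times> ('n, 'k) dual). (fst (snd z) $ i, (inc *v snd (fst z)) $ i))"
      by (intro continuous_intros linear_continuous_on_compose[OF _ matrix_vector_mul_linear])
    from continuous_on_compose2[OF continuous_load_frequency this] False show ?thesis by simp
  qed
  then show ?thesis unfolding eq by (intro continuous_on_vec_lambda c)
qed

lemma continuous_completed: "continuous_on UNIV (\<lambda>z. completed (fst z) (snd z))"
  unfolding completed_def case_prod_unfold
  using continuous_frequency by (auto intro!: continuous_intros simp: case_prod_unfold)

lemma continuous_grad_x: "continuous_on UNIV grad_x"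
  unfolding grad_x_def case_prod_unfold
  by (intro continuous_intros linear_continuous_on_compose[OF _ matrix_vector_mul_linear])

lemma continuous_demands: "continuous_on UNIV demands"
  unfolding demands_def
  by (intro continuous_on_vec_lambda continuous_on_compose2[OF continuous_demand] continuous_intros) auto

lemma continuous_grad_dual: "continuous_on UNIV (\<lambda>z. grad_dual (fst z) (snd z))"
  unfolding grad_dual_def case_prod_unfold flow_def
  by (intro continuous_intros linear_continuous_on_compose[OF _ matrix_vector_mul_linear]
      continuous_on_compose2[OF continuous_demands]) auto

lemma gradient_primal: "gradient (\<lambda>x. reduced_lagrangian N x y) x = grad_x (completed x y)"
proof (rule gradient_eqI, rule GDERIV_between_tangents)
  have "continuous_on UNIV (\<lambda>x. completed x y)"
  proof -
    have "continuous_on UNIV (\<lambda>x::'n primal. (x, y))" by (intro continuous_intros)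
    from continuous_on_compose2[OF continuous_completed this] show ?thesis by simp
  qed
  then have "continuous_on UNIV (\<lambda>x. grad_x (completed x y))"
    by (rule continuous_on_compose2[OF continuous_grad_x]) auto
  then show "isCont (\<lambda>x. grad_x (completed x y)) x" by (metis continuous_on_eq_continuous_at open_UNIV UNIV_I)
  fix x'
  have "(x' - x) \<bullet> grad_x (completed x y) \<le> reduced_lagrangian N x' y - reduced_lagrangian N x y"
    using reduced_lagrangian_ge[of x' x y] lagrangian_affine_primal[of x' "completed x y" x] reduced_lagrangian_eq[of x y] by linarith
  moreover have "reduced_lagrangian N x' y - reduced_lagrangian N x y \<le> (x' - x) \<bullet> grad_x (completed x' y)"
    using reduced_lagrangian_ge[of x x' y] lagrangian_affine_primal[of x' "completed x' y" x] reduced_lagrangian_eq[of x' y] by linarith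
  ultimately show "reduced_lagrangian N x' y - reduced_lagrangian N x y
      \<in> closed_segment ((x' - x) \<bullet> grad_x (completed x y)) ((x' - x) \<bullet> grad_x (completed x' y))"
    by (simp add: closed_segment_eq_real_ivl)
qed

lemma reduced_lagrangian_concave:
  "reduced_lagrangian N x y' - reduced_lagrangian N x y \<le> (y' - y) \<bullet> grad_dual x (completed x y)"
proof -
  obtain l \<nu> r l' \<nu>' r' where "completed x y = (l, \<nu>, r)" "completed x y' = (l', \<nu>', r')"
    by (cases "completed x y"; cases "completed x y'")
  moreover obtain \<pi> \<rho>p \<rho>m \<pi>' \<rho>p' \<rho>m' where "r = (\<pi>, \<rho>p, \<rho>m)" "r' = (\<pi>', \<rho>p', \<rho>m')"
    by (cases r; cases r')
  moreover have "0 \<le> (\<Sum>i\<in>UNIV. damping N $ i / 2 * (\<nu>' $ i - \<nu> $ i)\<^sup>2)"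
    using damping_pos by (intro sum_nonneg) (simp add: less_imp_le)
  ultimately have "lagrangian N x (completed x y') - lagrangian N x (completed x y) \<le> (completed x y' - completed x y) \<bullet> grad_dual x (completed x y)"
    using lagrangian_concave_dual[of x l' \<nu>' \<pi>' \<rho>p' \<rho>m' l \<nu> \<pi> \<rho>p \<rho>m] by simp
  then show ?thesis by (simp add: reduced_lagrangian_eq inner_completed_diff)
qed

lemma gradient_dual: "gradient (\<lambda>y. reduced_lagrangian N x y) y = grad_dual x (completed x y)"
proof (rule gradient_eqI, rule GDERIV_between_tangents)
  have "continuous_on UNIV (\<lambda>y. (x, completed x y))"
  proof -
    have "continuous_on UNIV (\<lambda>y::('n, 'k) dual. (x, y))" by (intro continuous_intros)
    from continuous_on_compose2[OF continuous_completed this] have "continuous_on UNIV (\<lambda>y. completed x y)" by simp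
    then show ?thesis by (intro continuous_intros)
  qed
  from continuous_on_compose2[OF continuous_grad_dual this]
  have "continuous_on UNIV (\<lambda>y. grad_dual x (completed x y))" by simp
  then show "isCont (\<lambda>y. grad_dual x (completed x y)) y" by (metis continuous_on_eq_continuous_at open_UNIV UNIV_I)
  fix y'
  have "(y' - y) \<bullet> grad_dual x (completed x y') \<le> reduced_lagrangian N x y' - reduced_lagrangian N x y"
    using reduced_lagrangian_concave[of x y y'] by (simp add: inner_diff_left)
  then show "reduced_lagrangian N x y' - reduced_lagrangian N x y
      \<in> closed_segment ((y' - y) \<bullet> grad_dual x (completed x y)) ((y' - y) \<bullet> grad_dual x (completed x y'))"
    using reduced_lagrangian_concave[of x y' y] by (auto simp: closed_segment_eq_real_ivl)
qed

lemma primal_dual_eq: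
  "primal_dual N X Y (x, y) = (- gain X (grad_x (completed x y)), gain Y (proj_rho y (grad_dual x (completed x y))))"
  by (simp add: primal_dual_def gradient_primal gradient_dual)

lemma equilibria_eq:
  "equilibria N = {(x, y) \<in> state_space N. grad_x (completed x y) = 0 \<and> proj_rho y (grad_dual x (completed x y)) = 0}"
  by (simp add: equilibria_def gradient_primal gradient_dual)


section \<open>The saddle-point operator\<close>

lemma flow_diff: "flow (a - b) = flow a - flow b"
  by (simp only: flow_def matrix_vector_mult_diff_distrib)

lemma grad_x_diff: "grad_x \<sigma> - grad_x \<sigma>' = grad_x (\<sigma> - \<sigma>')"
  by (cases \<sigma>; cases \<sigma>') (simp add: grad_x_def matrix_vector_mult_diff_distrib del: transpose_matrix_vector)

text \<open>
  The duality pairing of the saddle-point operator at two multipliers.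
\<close>
definition dissipation :: "('n, 'k) dual \<Rightarrow> ('n, 'k) dual \<Rightarrow> real" where
  "dissipation = (\<lambda>(l, \<nu>, _) (l', \<nu>', _).
     (\<Sum>i\<in>UNIV. (demand N i (l $ i + \<nu> $ i) - demand N i (l' $ i + \<nu>' $ i)) * ((l $ i + \<nu> $ i) - (l' $ i + \<nu>' $ i)))
     + (\<Sum>i\<in>UNIV. damping N $ i * (\<nu> $ i - \<nu>' $ i)\<^sup>2))"

text \<open>
  All bilinear terms of the saddle function cancel, because each constraint matrix occurs once in the primal and
  once, transposed and with opposite sign, in the dual gradient. Only the strictly concave terms in the prices
  and frequencies remain.
\<close>
lemma saddle_identity:
  "(x - x') \<bullet> (grad_x \<sigma> - grad_x \<sigma>') - (\<sigma> - \<sigma>') \<bullet> (grad_dual x \<sigma> - grad_dual x' \<sigma>') = dissipation \<sigma> \<sigma>'"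
proof -
  obtain \<phi> P \<phi>' P' where x: "x = (\<phi>, P)" "x' = (\<phi>', P')" by (cases x; cases x')
  obtain l \<nu> \<pi> \<rho>p \<rho>m where s: "\<sigma> = (l, \<nu>, \<pi>, \<rho>p, \<rho>m)" by (cases \<sigma>)
  obtain l' \<nu>' \<pi>' \<rho>p' \<rho>m' where s': "\<sigma>' = (l', \<nu>', \<pi>', \<rho>p', \<rho>m')" by (cases \<sigma>')
  define \<Delta> where "\<Delta> = demands (l + \<nu>) - demands (l' + \<nu>')"
  have dual: "grad_dual x \<sigma> - grad_dual x' \<sigma>' =
      (- \<Delta> - lap *v (\<phi> - \<phi>'), - \<Delta> - diag (damping N) *v (\<nu> - \<nu>') - inc *v (P - P'),
       area *v flow (\<phi> - \<phi>'), flow (\<phi> - \<phi>'), - flow (\<phi> - \<phi>'))"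
    unfolding x s s' \<Delta>_def grad_dual_def
    by (simp add: matrix_vector_mult_diff_distrib flow_diff)
  have prim: "grad_x \<sigma> - grad_x \<sigma>' =
      (- (lap *v (l - l') - (inc ** B_mat N ** transpose area) *v (\<pi> - \<pi>') - (inc ** B_mat N) *v ((\<rho>p - \<rho>p') - (\<rho>m - \<rho>m'))),
       - (transpose inc *v (\<nu> - \<nu>')))"
    unfolding grad_x_diff s s' by (simp add: grad_x_def del: transpose_matrix_vector)
  have "(P - P') \<bullet> (transpose inc *v (\<nu> - \<nu>')) = (\<nu> - \<nu>') \<bullet> (inc *v (P - P'))"
    by (metis inner_transpose inner_commute)
  moreover have "\<Delta> \<bullet> (l - l') + \<Delta> \<bullet> (\<nu> - \<nu>') + (diag (damping N) *v (\<nu> - \<nu>')) \<bullet> (\<nu> - \<nu>') = dissipation \<sigma> \<sigma>'"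
  proof -
    have "\<Delta> \<bullet> (l - l') + \<Delta> \<bullet> (\<nu> - \<nu>') = \<Delta> \<bullet> ((l + \<nu>) - (l' + \<nu>'))"
      by (simp add: inner_add_right inner_diff_right)
    then show ?thesis
      by (simp add: dissipation_def s s' \<Delta>_def demands_def matrix_vector_diag inner_vec_def power2_eq_square mult.assoc)
  qed
  ultimately show ?thesis
    unfolding dual prim unfolding x s s' diff_Pair inner_Pair inner_minus_right inner_diff_right[of "\<phi> - \<phi>'"]
      inner_inc_B inner_area_price inner_laplacian_commute[of "\<phi> - \<phi>'"]
    by (simp add: inner_diff_left inner_diff_right inner_commute[of \<Delta>] inner_commute[of "diag (damping N) *v (\<nu> - \<nu>')"])
qed

lemma saddle_identity_reduced:
  "(x - x') \<bullet> (grad_x (completed x y) - grad_x (completed x' y')) - (y - y') \<bullet> (grad_dual x (completed x y) - grad_dual x' (completed x' y'))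
   = dissipation (completed x y) (completed x' y')"
proof -
  have "(completed x y - completed x' y') \<bullet> grad_dual x (completed x y) = (y - y') \<bullet> grad_dual x (completed x y)"
    using inner_completed_diff[of x' y' x y] by (simp add: inner_diff_left)
  then have "(completed x y - completed x' y') \<bullet> (grad_dual x (completed x y) - grad_dual x' (completed x' y'))
      = (y - y') \<bullet> (grad_dual x (completed x y) - grad_dual x' (completed x' y'))"
    by (simp add: inner_diff_right inner_completed_diff)
  then show ?thesis using saddle_identity[of x x' "completed x y" "completed x' y'"] by simp
qed

lemma dissipation_nonneg: "0 \<le> dissipation \<sigma> \<sigma>'"
  unfolding dissipation_def case_prod_unfold
  by (intro add_nonneg_nonneg sum_nonneg demand_monotone mult_nonneg_nonneg zero_le_power2 less_imp_le[OF damping_pos])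

lemma dissipation_zero:
  assumes "dissipation (l, \<nu>, r) (l', \<nu>', r') = 0"
  shows "l = l'" and "\<nu> = \<nu>'"
proof -
  let ?a = "\<lambda>i. (demand N i (l $ i + \<nu> $ i) - demand N i (l' $ i + \<nu>' $ i)) * ((l $ i + \<nu> $ i) - (l' $ i + \<nu>' $ i))"
  let ?b = "\<lambda>i. damping N $ i * (\<nu> $ i - \<nu>' $ i)\<^sup>2"
  have a: "0 \<le> ?a i" and b: "0 \<le> ?b i" for i
    using demand_monotone damping_pos[of i] by auto
  have "sum ?a UNIV + sum ?b UNIV = 0" using assms by (simp add: dissipation_def)
  moreover have "0 \<le> sum ?a UNIV" "0 \<le> sum ?b UNIV" using a b by (intro sum_nonneg; blast)+
  ultimately have "sum ?a UNIV = 0" "sum ?b UNIV = 0" by linarith+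
  then have a0: "?a i = 0" and b0: "?b i = 0" for i
    using sum_nonneg_eq_0_iff[of UNIV ?a] sum_nonneg_eq_0_iff[of UNIV ?b] a b by auto
  have n: "\<nu> $ i = \<nu>' $ i" for i using b0[of i] damping_pos[of i] by simp
  then show "\<nu> = \<nu>'" by (simp add: vec_eq_iff)
  have "l $ i = l' $ i" for i using demand_product_zero_imp_eq[OF a0, of i] n[of i] by simp
  then show "l = l'" by (simp add: vec_eq_iff)
qed

section \<open>Equilibria are KKT points\<close>

lemma line_ends_distinct: "e \<in> lines N \<Longrightarrow> fst e \<noteq> snd e"
  using net unfolding network_def by (metis prod.collapse)

lemma transpose_inc_component:
  "(transpose inc *v \<theta>) $ e = (if e \<in> lines N then \<theta> $ fst e - \<theta> $ snd e else 0)"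
proof -
  have "(transpose inc *v \<theta>) $ e = (\<Sum>i\<in>UNIV. inc $ i $ e * \<theta> $ i)"
    by (simp add: matrix_vector_mult_def transpose_def del: transpose_matrix_vector)
  also have "\<dots> = (\<Sum>i\<in>UNIV. (if e \<in> lines N then (if i = fst e then \<theta> $ i else 0) - (if i = snd e then \<theta> $ i else 0) else 0))"
    using line_ends_distinct[of e] by (intro sum.cong) (auto simp: incidence_def)
  also have "\<dots> = (if e \<in> lines N then \<theta> $ fst e - \<theta> $ snd e else 0)"
    by (simp add: sum_subtractf)
  finally show ?thesis .
qed

lemma flow_component: "flow \<theta> $ e = susceptance N $ e * (transpose inc *v \<theta>) $ e"
  by (simp add: flow_def B_mat_def matrix_vector_diag del: transpose_matrix_vector)

lemma flow_off_lines: "e \<notin> lines N \<Longrightarrow> flow \<theta> $ e = 0"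
  by (simp add: flow_component transpose_inc_component del: transpose_matrix_vector)

lemma susceptance_pos: "e \<in> lines N \<Longrightarrow> susceptance N $ e > 0"
  using net by (simp add: network_def)

lemma P_max_off_lines: "e \<notin> lines N \<Longrightarrow> P_max N $ e = 0"
  using net unfolding network_def vecs_on_def by blast

lemma area_off_areas: "k \<notin> areas N \<Longrightarrow> (area *v f) $ k = 0"
  by (simp add: area_incidence_def matrix_vector_mult_def)

lemma laplacian_zero_imp:
  assumes "lap *v \<theta> = 0"
  shows "transpose inc *v \<theta> = 0"
proof -
  define g where "g e = susceptance N $ e * ((transpose inc *v \<theta>) $ e)\<^sup>2" for e
  have "sum g UNIV = (transpose inc *v \<theta>) \<bullet> flow \<theta>"
    unfolding g_def inner_vec_def flow_component
    by (intro sum.cong) (simp_all add: power2_eq_square mult_ac del: transpose_matrix_vector)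
  then have sum: "sum g UNIV = 0"
    using assms inner_laplacian[of \<theta> \<theta>] by (simp del: transpose_matrix_vector)
  have nn: "0 \<le> g e" for e
    using susceptance_pos[of e] transpose_inc_component[of \<theta> e] unfolding g_def
    by (cases "e \<in> lines N") (simp_all del: transpose_matrix_vector)
  have "(transpose inc *v \<theta>) $ e = 0" for e
  proof (cases "e \<in> lines N")
    case True
    have "g e = 0" using sum_nonneg_eq_0_iff[of UNIV g] sum nn by (simp del: split_paired_All)
    then show ?thesis using susceptance_pos[OF True] unfolding g_def by (simp del: transpose_matrix_vector)
  next
    case False
    then show ?thesis by (simp add: transpose_inc_component del: transpose_matrix_vector)
  qed
  then show ?thesis by (simp add: vec_eq_iff del: transpose_matrix_vector)
qed

lemma sum_inc: "(\<Sum>i\<in>UNIV. (inc *v f) $ i) = 0"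
proof -
  have "transpose inc *v (\<chi> i. 1) = 0"
    by (simp add: vec_eq_iff transpose_inc_component del: transpose_matrix_vector)
  then have "(\<chi> i. 1) \<bullet> (inc *v f) = 0" by (metis inner_transpose inner_zero_left)
  then show ?thesis by (simp add: inner_vec_def)
qed

lemma kernel_transpose_inc:
  assumes "transpose inc *v \<nu> = 0"
  shows "\<nu> $ i = \<nu> $ j"
proof -
  have edge: "\<nu> $ a = \<nu> $ b" if "(a, b) \<in> lines N" for a b
    using transpose_inc_component[of \<nu> "(a, b)"] assms that by (simp del: transpose_matrix_vector)
  have "(i, j) \<in> (lines N \<union> (lines N)\<inverse>)\<^sup>*" using net by (simp add: network_def)
  then show ?thesis
  proof (induction rule: rtrancl_induct)
    case (step a b)
    then show ?case using edge[of a b] edge[of b a] by auto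
  qed simp
qed

text \<open>
  At an equilibrium the frequency deviation is the same at all buses of the connected network, while the damping
  terms \<open>D \<nu>\<close> are net injections and add up to zero.
\<close>
lemma frequency_zero:
  assumes ker: "transpose inc *v \<nu> = 0" and bal: "diag (damping N) *v \<nu> = inc *v f"
  shows "\<nu> = 0"
proof -
  have "(\<Sum>i\<in>UNIV. damping N $ i * \<nu> $ i) = 0"
    using sum_inc[of f] unfolding bal[symmetric] by (simp add: matrix_vector_diag)
  moreover have "(\<Sum>i\<in>UNIV. damping N $ i) * \<nu> $ j = (\<Sum>i\<in>UNIV. damping N $ i * \<nu> $ i)" for j
    unfolding sum_distrib_right
    by (rule sum.cong[OF refl], rule arg_cong[OF kernel_transpose_inc[OF ker]])
  moreover have "(\<Sum>i\<in>UNIV. damping N $ i) > 0"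
    using damping_pos by (intro sum_pos) auto
  ultimately show ?thesis by (auto simp add: vec_eq_iff)
qed

lemma pos_proj_eq_0_iff: "pos_proj \<rho> a = 0 \<longleftrightarrow> (\<forall>e. a $ e \<le> 0 \<and> (\<rho> $ e > 0 \<longrightarrow> a $ e = 0))"
  unfolding pos_proj_def vec_eq_iff by (auto simp: not_less)

text \<open>
  These are the KKT conditions of OLC; that the common frequency deviation is zero follows from the network
  equations.
\<close>
lemma equilibrium_conditions:
  fixes x y l \<nu> \<pi> \<rho>p \<rho>m \<phi> P
  assumes eq: "(x, y) \<in> equilibria N" and f: "completed x y = (l, \<nu>, \<pi>, \<rho>p, \<rho>m)" and x: "x = (\<phi>, P)"
  shows "\<nu> = 0" and "lap *v \<phi> = P_in N - demands l" and "inc *v P = P_in N - demands l"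
    and "area *v flow \<phi> = P_hat N"
    and "lap *v l = (inc ** B_mat N ** transpose area) *v \<pi> + (inc ** B_mat N) *v (\<rho>p - \<rho>m)"
    and "\<And>e. flow \<phi> $ e \<le> P_max N $ e" "\<And>e. P_min N $ e \<le> flow \<phi> $ e"
    and "\<And>e. \<rho>p $ e \<ge> 0" "\<And>e. \<rho>m $ e \<ge> 0"
    and "\<And>e. \<rho>p $ e > 0 \<Longrightarrow> flow \<phi> $ e = P_max N $ e" "\<And>e. \<rho>m $ e > 0 \<Longrightarrow> flow \<phi> $ e = P_min N $ e"
proof -
  obtain \<nu>0 where y: "y = (l, \<nu>0, \<pi>, \<rho>p, \<rho>m)"
    using f by (cases y) (auto simp: completed_def)
  have gx: "grad_x (l, \<nu>, \<pi>, \<rho>p, \<rho>m) = 0" and gd: "proj_rho y (grad_dual x (l, \<nu>, \<pi>, \<rho>p, \<rho>m)) = 0"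
    and st: "(x, y) \<in> state_space N"
    using eq f by (auto simp: equilibria_eq)
  show "\<rho>p $ e \<ge> 0" "\<rho>m $ e \<ge> 0" for e using st by (auto simp: state_space_def x y simp del: split_paired_All)
  have ker: "transpose inc *v \<nu> = 0"
    and price: "lap *v l - (inc ** B_mat N ** transpose area) *v \<pi> - (inc ** B_mat N) *v (\<rho>p - \<rho>m) = 0"
    using gx by (simp_all add: grad_x_def zero_prod_def del: transpose_matrix_vector)
  have gl: "P_in N - demands (l + \<nu>) - lap *v \<phi> = 0"
    and gn: "P_in N - demands (l + \<nu>) - diag (damping N) *v \<nu> - inc *v P = 0"
    and gp: "area *v flow \<phi> - P_hat N = 0"
    and gr: "pos_proj \<rho>p (flow \<phi> - P_max N) = 0" "pos_proj \<rho>m (P_min N - flow \<phi>) = 0"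
    using gd unfolding grad_dual_def proj_rho_def x y zero_prod_def prod.case prod.inject by blast+
  have "diag (damping N) *v \<nu> = inc *v (flow \<phi> - P)"
    using gl gn by (simp add: matrix_vector_mult_diff_distrib laplacian_flow algebra_simps)
  then show nu: "\<nu> = 0" using frequency_zero[OF ker] by blast
  show "lap *v \<phi> = P_in N - demands l" using gl nu by (simp add: algebra_simps)
  show "inc *v P = P_in N - demands l" using gn nu by (simp add: algebra_simps)
  show "area *v flow \<phi> = P_hat N" using gp by simp
  show "lap *v l = (inc ** B_mat N ** transpose area) *v \<pi> + (inc ** B_mat N) *v (\<rho>p - \<rho>m)"
    using price by (simp add: algebra_simps)
  show "flow \<phi> $ e \<le> P_max N $ e" "P_min N $ e \<le> flow \<phi> $ e" 
    "\<rho>p $ e > 0 \<Longrightarrow> flow \<phi> $ e = P_max N $ e" "\<rho>m $ e > 0 \<Longrightarrow> flow \<phi> $ e = P_min N $ e" for e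
    using gr unfolding pos_proj_eq_0_iff by (auto simp del: split_paired_All)
qed

lemma congestion_price_nonneg:
  assumes "\<And>e. a $ e \<le> c $ e" "\<And>e. \<rho> $ e \<ge> 0" "\<And>e. \<rho> $ e > 0 \<Longrightarrow> b $ e = c $ e"
  shows "\<rho> \<bullet> a \<le> \<rho> \<bullet> (b :: real^'m::finite)"
  unfolding inner_vec_def
proof (rule sum_mono)
  fix e show "\<rho> $ e \<bullet> a $ e \<le> \<rho> $ e \<bullet> b $ e"
    using assms(1,2,3)[of e] by (cases "\<rho> $ e = 0") (auto intro!: mult_left_mono simp: less_le)
qed

text \<open>
  Weak duality: the tangent inequality at the price \<open>l\<close> reduces the cost difference to \<open>l
  \<bullet> (d' - d)\<close>. Stationarity in the angles turns this into flow differences weighted by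
  \<open>\<pi>\<close> and \<open>\<rho>\<close>; the \<open>\<pi>\<close> part vanishes since area exchanges
  are prescribed, and complementary slackness gives the \<open>\<rho>\<close> part its sign. Only line flows
  matter, which is why any \<open>\<theta>\<close> with the angle differences of \<open>\<phi>\<close> will do.
\<close>
lemma equilibrium_optimal:
  assumes eq: "(x, y) \<in> equilibria N"
  shows "olc_optimal_point N (x, y)"
proof -
  obtain \<phi> P where x: "x = (\<phi>, P)" by (cases x)
  obtain l \<nu> \<pi> \<rho>p \<rho>m where f: "completed x y = (l, \<nu>, \<pi>, \<rho>p, \<rho>m)" by (cases "completed x y")
  note E = equilibrium_conditions[OF eq f x]
  let ?d = "\<chi> i. demand N i (l $ i + \<nu> $ i)"
  have d: "?d = demands l" by (simp add: demands_def E(1))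
  have "olc_optimal N ?d \<nu> \<theta>" if \<theta>: "transpose inc *v \<theta> = transpose inc *v \<phi>" for \<theta>
    unfolding olc_optimal_def
  proof (intro conjI allI impI)
    have flow: "flow \<theta> = flow \<phi>" by (simp only: flow_def \<theta>)
    have mem: "demand N i s \<in> demand_range N i" for i s
      using demand_interior_demand interior_subset by blast
    show "olc_feasible N ?d \<nu> \<theta>"
      unfolding olc_feasible_def area_flow flow_eq laplacian_flow flow d
      using E mem by (simp add: demands_def laplacian_flow)
    fix d' \<omega>' \<theta>' assume feas: "olc_feasible N d' \<omega>' \<theta>'"
    then have f': "d' = P_in N - lap *v \<theta>'" "area *v flow \<theta>' = P_hat N"
      "\<And>e. e \<in> lines N \<Longrightarrow> P_min N $ e \<le> flow \<theta>' $ e \<and> flow \<theta>' $ e \<le> P_max N $ e"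
      unfolding olc_feasible_def area_flow flow_eq by (auto simp: algebra_simps)
    have lim: "flow \<theta>' $ e \<le> P_max N $ e" "P_min N $ e \<le> flow \<theta>' $ e" for e
      using f'(3)[of e] flow_off_lines[of e \<theta>'] P_max_off_lines[of e]
      by (cases "e \<in> lines N"; simp add: P_min_def)+
    show "(\<Sum>i\<in>UNIV. extended_cost N i (?d $ i)) \<le> (\<Sum>i\<in>UNIV. extended_cost N i (d' $ i))"
    proof (cases "\<forall>i. d' $ i \<in> demand_interior i")
      case False
      then have "(\<Sum>i\<in>UNIV. extended_cost N i (d' $ i)) = \<infinity>"
        by (subst sum_Pinfty) (auto simp: extended_cost_def)
      then show ?thesis by simp
    next
      case True
      have dd: "d' - demands l = lap *v (\<phi> - \<theta>')"
        using E(2) f'(1) by (simp add: matrix_vector_mult_diff_distrib)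
      have "l \<bullet> (d' - demands l) = (\<phi> - \<theta>') \<bullet> (lap *v l)"
        unfolding dd by (rule inner_laplacian_commute)
      also have "\<dots> = \<pi> \<bullet> (area *v flow (\<phi> - \<theta>')) + (\<rho>p - \<rho>m) \<bullet> flow (\<phi> - \<theta>')"
        by (simp only: E(5) inner_add_right inner_area_price inner_inc_B)
      also have "\<dots> = (\<rho>p \<bullet> flow \<phi> - \<rho>p \<bullet> flow \<theta>') - (\<rho>m \<bullet> flow \<phi> - \<rho>m \<bullet> flow \<theta>')"
        using E(4) f'(2) by (simp add: flow_diff matrix_vector_mult_diff_distrib inner_diff_right inner_diff_left)
      finally have lin: "l \<bullet> (d' - demands l) = (\<rho>p \<bullet> flow \<phi> - \<rho>p \<bullet> flow \<theta>') - (\<rho>m \<bullet> flow \<phi> - \<rho>m \<bullet> flow \<theta>')" .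
      have "\<rho>p \<bullet> flow \<theta>' \<le> \<rho>p \<bullet> flow \<phi>"
        by (rule congestion_price_nonneg[where c = "P_max N"]) (use lim E in auto)
      moreover have "\<rho>m \<bullet> (- flow \<theta>') \<le> \<rho>m \<bullet> (- flow \<phi>)"
        by (rule congestion_price_nonneg[where c = "- P_min N"]) (use lim E in auto)
      ultimately have "0 \<le> l \<bullet> (d' - demands l)" unfolding lin by simp
      also have "\<dots> = (\<Sum>i\<in>UNIV. l $ i * (d' $ i - demand N i (l $ i)))"
        by (simp add: inner_vec_def demands_def)
      also have "\<dots> \<le> (\<Sum>i\<in>UNIV. cost N i (d' $ i) - cost N i (demand N i (l $ i)))"
      proof (rule sum_mono)
        fix i
        show "l $ i * (d' $ i - demand N i (l $ i)) \<le> cost N i (d' $ i) - cost N i (demand N i (l $ i))"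
          using cost_ge_tangent_at_demand[OF True[rule_format], of i "l $ i"] by linarith
      qed
      finally have "(\<Sum>i\<in>UNIV. cost N i (demand N i (l $ i))) \<le> (\<Sum>i\<in>UNIV. cost N i (d' $ i))"
        by (simp add: sum_subtractf)
      then show ?thesis
        using True demand_interior_demand by (simp add: extended_cost_def E(1))
    qed
  qed
  then show ?thesis
    by (simp add: olc_optimal_point_def join_nu_star x f[unfolded x] del: transpose_matrix_vector)
qed


section \<open>Existence of equilibria\<close>

lemma matrix_vector_mult_minus_right: "A *v (- x) = - (A *v x)" for A :: "real^'m^'l"
  using matrix_vector_mult_diff_distrib[of A 0 x] by simp

abbreviation dispatch :: "real^('n \<times> 'n) \<Rightarrow> real^'n" where
  "dispatch f \<equiv> P_in N - inc *v f"

text \<open>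
  Line flows instead of angles: angles are determined only up to a common shift and form an unbounded set,
  whereas the flows live in a compact polytope.
\<close>
definition feasible_flows :: "(real^('n \<times> 'n)) set" where
  "feasible_flows = range flow \<inter> {f. area *v f = P_hat N} \<inter> cbox (P_min N) (P_max N)"

definition total_cost :: "real^('n \<times> 'n) \<Rightarrow> real" where
  "total_cost f = (\<Sum>i\<in>UNIV. cost N i (dispatch f $ i))"

lemma linear_flow: "linear flow"
  unfolding flow_def[abs_def] by (intro linear_compose[unfolded o_def, OF matrix_vector_mul_linear matrix_vector_mul_linear])

lemma compact_feasible_flows: "compact feasible_flows"
proof -
  have "closed (range flow)"
    using linear_flow by (intro closed_subspace linear_subspace_image) auto
  moreover have "closed {f. area *v f = P_hat N}"
    by (intro closed_Collect_eq linear_continuous_on_compose[OF _ matrix_vector_mul_linear] continuous_intros)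
  ultimately show ?thesis
    unfolding feasible_flows_def by (intro closed_Int_compact closed_Int compact_cbox)
qed

lemma cost_bounded_below: "u \<in> demand_interior i \<Longrightarrow> cost N i (demand N i 0) \<le> cost N i u"
  using cost_ge_tangent_at_demand[of u i 0] by simp

lemma isCont_cost: "u \<in> demand_interior i \<Longrightarrow> isCont (cost N i) u"
  using cost_derivative(1) DERIV_isCont by blast

lemma continuous_dispatch: "continuous_on UNIV dispatch"
  by (intro continuous_intros linear_continuous_on_compose[OF _ matrix_vector_mul_linear])

lemma dispatch_component_tendsto:
  assumes "f \<longlonglongrightarrow> g"
  shows "(\<lambda>n. dispatch (f n) $ i) \<longlonglongrightarrow> dispatch g $ i"
proof -
  have "isCont dispatch g" using continuous_dispatch by (metis continuous_on_eq_continuous_at open_UNIV UNIV_I)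
  then show ?thesis using assms by (intro tendsto_vec_nth isCont_tendsto_compose[of _ dispatch])
qed

text \<open>
  A limit dispatch at the boundary of a demand range is impossible, since one cost would exceed every bound
  while the other costs are bounded from below.
\<close>
lemma closed_sublevel:
  "closed {f \<in> feasible_flows. (\<forall>i. dispatch f $ i \<in> demand_interior i) \<and> total_cost f \<le> c}"
  unfolding closed_sequential_limits
proof (intro allI impI, elim conjE)
  fix f g assume f: "\<forall>n. f n \<in> {f \<in> feasible_flows. (\<forall>i. dispatch f $ i \<in> demand_interior i) \<and> total_cost f \<le> c}"
    and lim: "f \<longlonglongrightarrow> g"
  have int: "dispatch (f n) $ i \<in> demand_interior i" and le: "total_cost (f n) \<le> c" and ff: "f n \<in> feasible_flows" for n i
    using f by blast+
  have g: "g \<in> feasible_flows"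
    using compact_imp_closed[OF compact_feasible_flows] ff lim closed_sequentially by blast
  have inside: "dispatch g $ i \<in> demand_interior i" for i
  proof (rule ccontr)
    assume out: "dispatch g $ i \<notin> demand_interior i"
    have clos: "dispatch g $ i \<in> closure (demand_interior i)"
      unfolding closure_sequential
      by (rule exI[of _ "\<lambda>n. dispatch (f n) $ i"]) (intro conjI allI int dispatch_component_tendsto lim)
    \<comment> \<open>a cost at bus \<open>i\<close> above this level cannot be compensated by the other buses\<close>
    define K where "K = c - (\<Sum>j\<in>UNIV - {i}. cost N j (demand N j 0))"
    obtain d where d: "d > 0" "\<And>u. u \<in> demand_interior i \<Longrightarrow> \<bar>u - dispatch g $ i\<bar> < d \<Longrightarrow> cost N i u > K"
      using cost_blows_up[OF clos out] by blast
    obtain n where n: "\<bar>dispatch (f n) $ i - dispatch g $ i\<bar> < d"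
      using LIMSEQ_D[OF dispatch_component_tendsto[OF lim, of i] d(1)] by (metis order_refl real_norm_def)
    have "c = K + (\<Sum>j\<in>UNIV - {i}. cost N j (demand N j 0))" by (simp add: K_def)
    also have "\<dots> < cost N i (dispatch (f n) $ i) + (\<Sum>j\<in>UNIV - {i}. cost N j (dispatch (f n) $ j))"
      by (intro add_less_le_mono sum_mono d(2) cost_bounded_below int n)
    also have "\<dots> = total_cost (f n)" unfolding total_cost_def by (rule sum.remove[symmetric]) auto
    finally show False using le[of n] by simp
  qed
  have "(\<lambda>n. total_cost (f n)) \<longlonglongrightarrow> total_cost g"
    unfolding total_cost_def
    by (intro tendsto_sum isCont_tendsto_compose[OF isCont_cost] inside dispatch_component_tendsto lim)
  then have "total_cost g \<le> c" using le by (intro LIMSEQ_le_const2) auto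
  then show "g \<in> {f \<in> feasible_flows. (\<forall>i. dispatch f $ i \<in> demand_interior i) \<and> total_cost f \<le> c}"
    using g inside by blast
qed

lemma optimal_flow_exists:
  "\<exists>f\<in>feasible_flows. (\<forall>i. dispatch f $ i \<in> demand_interior i) \<and>
     (\<forall>f'\<in>feasible_flows. (\<forall>i. dispatch f' $ i \<in> demand_interior i) \<longrightarrow> total_cost f \<le> total_cost f')"
proof -
  obtain d \<omega> \<theta> where feas: "olc_feasible N d \<omega> \<theta>" and int: "\<And>i. d $ i \<in> demand_interior i"
    using slater unfolding olc_strictly_feasible_def by blast
  define f1 where "f1 = flow \<theta>"
  have d: "dispatch f1 = d" "area *v f1 = P_hat N"
    and box: "\<And>e. e \<in> lines N \<Longrightarrow> P_min N $ e \<le> f1 $ e \<and> f1 $ e \<le> P_max N $ e"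
    using feas unfolding olc_feasible_def area_flow flow_eq laplacian_flow f1_def by (auto simp: algebra_simps)
  have box': "P_min N $ e \<le> f1 $ e \<and> f1 $ e \<le> P_max N $ e" for e
    using box[of e] flow_off_lines[of e \<theta>] P_max_off_lines[of e]
    by (cases "e \<in> lines N") (auto simp: P_min_def f1_def)
  have f1: "f1 \<in> feasible_flows"
    using d(2) box' by (auto simp: feasible_flows_def f1_def mem_box_cart simp del: split_paired_All)
  define S where "S = {f \<in> feasible_flows. (\<forall>i. dispatch f $ i \<in> demand_interior i) \<and> total_cost f \<le> total_cost f1}"
  have "S = feasible_flows \<inter> S" by (auto simp: S_def)
  then have "compact S"
    using compact_Int_closed[OF compact_feasible_flows closed_sublevel[of "total_cost f1"]] S_def by metis
  moreover have "dispatch f1 $ i \<in> demand_interior i" for i unfolding d(1) by (rule int)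
  then have "f1 \<in> S" unfolding S_def using f1 by blast
  moreover have "continuous_on S total_cost"
    unfolding total_cost_def
  proof (intro continuous_on_sum)
    fix i
    have "continuous_on (demand_interior i) (cost N i)"
      using isCont_cost by (blast intro: continuous_at_imp_continuous_on)
    moreover have "continuous_on S (\<lambda>f. dispatch f $ i)"
      using continuous_dispatch continuous_on_subset by (blast intro: continuous_on_component)
    ultimately show "continuous_on S (\<lambda>f. cost N i (dispatch f $ i))"
      by (rule continuous_on_compose2) (auto simp: S_def)
  qed
  ultimately obtain f where f: "f \<in> S" "\<And>f'. f' \<in> S \<Longrightarrow> total_cost f \<le> total_cost f'"
    using continuous_attains_inf[of S total_cost] by blast
  have "total_cost f \<le> total_cost f'"
    if f': "f' \<in> feasible_flows" "\<forall>i. dispatch f' $ i \<in> demand_interior i" for f'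
  proof (cases "total_cost f' \<le> total_cost f1")
    case True
    then have "f' \<in> S" unfolding S_def using f' by blast
    then show ?thesis by (rule f(2))
  next
    case False
    then show ?thesis using f(2)[OF \<open>f1 \<in> S\<close>] by simp
  qed
  moreover have "f \<in> feasible_flows" "\<forall>i. dispatch f $ i \<in> demand_interior i"
    using f(1) unfolding S_def by blast+
  ultimately show ?thesis by blast
qed

text \<open>
  Along a direction that respects the active limits, small steps stay feasible and keep all demands inside their
  open ranges, so the derivative of the total cost cannot be negative.
\<close>
lemma first_order_condition:
  assumes f: "f \<in> feasible_flows" "\<And>i. dispatch f $ i \<in> demand_interior i"
    and opt: "\<And>f'. f' \<in> feasible_flows \<Longrightarrow> (\<And>i. dispatch f' $ i \<in> demand_interior i) \<Longrightarrow> total_cost f \<le> total_cost f'"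
    and h: "h \<in> range flow" "area *v h = 0"
    and up: "\<And>e. f $ e = P_max N $ e \<Longrightarrow> h $ e \<le> 0" and down: "\<And>e. f $ e = P_min N $ e \<Longrightarrow> 0 \<le> h $ e"
  shows "(\<chi> i. marginal_cost i (dispatch f $ i)) \<bullet> (inc *v h) \<le> 0"
proof (rule ccontr)
  let ?D = "(\<chi> i. marginal_cost i (dispatch f $ i)) \<bullet> (inc *v h)"
  assume "\<not> ?D \<le> 0"
  define c where "c t = total_cost (f + t *\<^sub>R h)" for t
  have disp: "dispatch (f + t *\<^sub>R h) $ i = dispatch f $ i - t * (inc *v h) $ i" for t i
    by (simp add: matrix_vector_right_distrib matrix_vector_mult_scaleR)
  have "(c has_real_derivative (\<Sum>i\<in>UNIV. marginal_cost i (dispatch f $ i) * - (inc *v h) $ i)) (at 0)"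
    unfolding c_def total_cost_def disp
  proof (intro DERIV_sum)
    fix i
    have "(cost N i has_real_derivative marginal_cost i (dispatch f $ i)) (at (dispatch f $ i - 0 * (inc *v h) $ i))"
      using cost_derivative(1)[OF f(2)] by simp
    moreover have "((\<lambda>t. dispatch f $ i - t * (inc *v h) $ i) has_real_derivative - (inc *v h) $ i) (at 0)"
      by (auto intro!: derivative_eq_intros)
    ultimately show "((\<lambda>t. cost N i (dispatch f $ i - t * (inc *v h) $ i)) has_real_derivative
        marginal_cost i (dispatch f $ i) * - (inc *v h) $ i) (at 0)"
      by (rule DERIV_chain2)
  qed
  moreover have "(\<Sum>i\<in>UNIV. marginal_cost i (dispatch f $ i) * - (inc *v h) $ i) = - ?D"
    by (simp add: inner_vec_def sum_negf)
  ultimately have "(c has_real_derivative - ?D) (at 0)" by simp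
  from DERIV_neg_dec_right[OF this] \<open>\<not> ?D \<le> 0\<close> obtain d where d: "d > 0" "\<And>t. 0 < t \<Longrightarrow> t < d \<Longrightarrow> c t < c 0"
    by auto
  have ev_d: "\<forall>\<^sub>F t in at_right (0::real). 0 < t \<and> t < d"
    unfolding eventually_at_right_field using d(1) by blast
  have "\<forall>\<^sub>F t in at_right 0. P_min N $ e \<le> (f + t *\<^sub>R h) $ e \<and> (f + t *\<^sub>R h) $ e \<le> P_max N $ e" for e
  proof -
    have fe: "P_min N $ e \<le> f $ e" "f $ e \<le> P_max N $ e"
      using f(1) by (auto simp: feasible_flows_def mem_box_cart simp del: split_paired_All)
    have lim: "((\<lambda>t. f $ e + t * h $ e) \<longlongrightarrow> f $ e) (at_right 0)"
      by (auto intro!: tendsto_eq_intros)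
    have pos: "\<forall>\<^sub>F t in at_right (0::real). 0 < t" by (rule eventually_at_right_less)
    have "\<forall>\<^sub>F t in at_right 0. f $ e + t * h $ e \<le> P_max N $ e"
    proof (cases "f $ e = P_max N $ e")
      case True
      show ?thesis using pos by eventually_elim (use up[OF True] True in \<open>simp add: mult_nonneg_nonpos\<close>)
    next
      case False
      then have "f $ e < P_max N $ e" using fe by simp
      from order_tendstoD(2)[OF lim this] show ?thesis by eventually_elim simp
    qed
    moreover have "\<forall>\<^sub>F t in at_right 0. P_min N $ e \<le> f $ e + t * h $ e"
    proof (cases "f $ e = P_min N $ e")
      case True
      show ?thesis using pos by eventually_elim (use down[OF True] True in simp)
    next
      case False
      then have "P_min N $ e < f $ e" using fe by simp
      from order_tendstoD(1)[OF lim this] show ?thesis by eventually_elim simp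
    qed
    ultimately show ?thesis by eventually_elim simp
  qed
  then have ev_box: "\<forall>\<^sub>F t in at_right 0. \<forall>e. P_min N $ e \<le> (f + t *\<^sub>R h) $ e \<and> (f + t *\<^sub>R h) $ e \<le> P_max N $ e"
    by (rule eventually_all_finite)
  have "\<forall>\<^sub>F t in at_right 0. dispatch (f + t *\<^sub>R h) $ i \<in> demand_interior i" for i
  proof -
    have "((\<lambda>t. dispatch (f + t *\<^sub>R h) $ i) \<longlongrightarrow> dispatch f $ i) (at_right 0)"
      unfolding disp by (auto intro!: tendsto_eq_intros)
    then show ?thesis using f(2) by (rule topological_tendstoD[OF _ open_interior])
  qed
  then have ev_int: "\<forall>\<^sub>F t in at_right 0. \<forall>i. dispatch (f + t *\<^sub>R h) $ i \<in> demand_interior i"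
    by (rule eventually_all_finite)
  have "\<forall>\<^sub>F t in at_right (0::real). False"
    using ev_d ev_box ev_int
  proof eventually_elim
    case (elim t)
    have "f + t *\<^sub>R h \<in> range flow"
    proof -
      have sub: "subspace (range flow)" by (rule linear_subspace_image[OF linear_flow subspace_UNIV])
      have "f \<in> range flow" using f(1) unfolding feasible_flows_def by blast
      then show ?thesis by (rule subspace_add[OF sub _ subspace_scale[OF sub h(1)]])
    qed
    moreover have "area *v (f + t *\<^sub>R h) = P_hat N"
      using f(1) h(2) by (simp add: feasible_flows_def matrix_vector_right_distrib matrix_vector_mult_scaleR)
    moreover have "f + t *\<^sub>R h \<in> cbox (P_min N) (P_max N)"
      unfolding mem_box_cart using elim(2) by blast
    ultimately have "f + t *\<^sub>R h \<in> feasible_flows" unfolding feasible_flows_def by blast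
    then have "total_cost f \<le> c t" unfolding c_def using elim(3) by (intro opt) blast+
    moreover have "c 0 = total_cost f" by (simp add: c_def)
    ultimately show False using d(2)[of t] elim(1) by simp
  qed
  then show False by simp
qed

text \<open>
  The possible values of the price mismatch on the right-hand side of stationarity in the angles, with
  multipliers supported on the lines that are congested in the flow \<open>f\<close>.
\<close>
definition price_cone :: "real^('n \<times> 'n) \<Rightarrow> (real^'n) set" where
  "price_cone f = {(inc ** B_mat N ** transpose area) *v \<pi> + (inc ** B_mat N) *v (\<rho>p - \<rho>m) | \<pi> \<rho>p \<rho>m.
     \<pi> \<in> vecs_on (areas N) \<and> \<rho>p \<in> vecs_on (lines N) \<and> \<rho>m \<in> vecs_on (lines N) \<and>
     (\<forall>e. 0 \<le> \<rho>p $ e \<and> (0 < \<rho>p $ e \<longrightarrow> f $ e = P_max N $ e)) \<and>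
     (\<forall>e. 0 \<le> \<rho>m $ e \<and> (0 < \<rho>m $ e \<longrightarrow> f $ e = P_min N $ e))}"

lemma price_coneI:
  assumes "\<pi> \<in> vecs_on (areas N)" "\<rho>p \<in> vecs_on (lines N)" "\<rho>m \<in> vecs_on (lines N)"
    and "\<And>e. 0 \<le> \<rho>p $ e" "\<And>e. 0 < \<rho>p $ e \<Longrightarrow> f $ e = P_max N $ e"
    and "\<And>e. 0 \<le> \<rho>m $ e" "\<And>e. 0 < \<rho>m $ e \<Longrightarrow> f $ e = P_min N $ e"
    and "v = (inc ** B_mat N ** transpose area) *v \<pi> + (inc ** B_mat N) *v (\<rho>p - \<rho>m)"
  shows "v \<in> price_cone f"
  unfolding price_cone_def using assms by blast

lemma convex_cone_price_cone: "convex_cone (price_cone f)"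
  unfolding convex_cone_iff
proof (intro conjI ballI allI impI)
  show "0 \<in> price_cone f"
    by (rule price_coneI[where \<pi> = 0 and \<rho>p = 0 and \<rho>m = 0]) (simp_all add: vecs_on_def)
next
  fix u v assume "u \<in> price_cone f" "v \<in> price_cone f"
  then obtain \<pi> \<rho>p \<rho>m \<pi>' \<rho>p' \<rho>m' where
    u: "u = (inc ** B_mat N ** transpose area) *v \<pi> + (inc ** B_mat N) *v (\<rho>p - \<rho>m)"
      "\<pi> \<in> vecs_on (areas N)" "\<rho>p \<in> vecs_on (lines N)" "\<rho>m \<in> vecs_on (lines N)"
      "\<And>e. 0 \<le> \<rho>p $ e" "\<And>e. 0 < \<rho>p $ e \<Longrightarrow> f $ e = P_max N $ e"
      "\<And>e. 0 \<le> \<rho>m $ e" "\<And>e. 0 < \<rho>m $ e \<Longrightarrow> f $ e = P_min N $ e"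
    and v: "v = (inc ** B_mat N ** transpose area) *v \<pi>' + (inc ** B_mat N) *v (\<rho>p' - \<rho>m')"
      "\<pi>' \<in> vecs_on (areas N)" "\<rho>p' \<in> vecs_on (lines N)" "\<rho>m' \<in> vecs_on (lines N)"
      "\<And>e. 0 \<le> \<rho>p' $ e" "\<And>e. 0 < \<rho>p' $ e \<Longrightarrow> f $ e = P_max N $ e"
      "\<And>e. 0 \<le> \<rho>m' $ e" "\<And>e. 0 < \<rho>m' $ e \<Longrightarrow> f $ e = P_min N $ e"
    unfolding price_cone_def mem_Collect_eq by blast
  show "u + v \<in> price_cone f"
  proof (rule price_coneI[where \<pi> = "\<pi> + \<pi>'" and \<rho>p = "\<rho>p + \<rho>p'" and \<rho>m = "\<rho>m + \<rho>m'"])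
    show "\<pi> + \<pi>' \<in> vecs_on (areas N)" "\<rho>p + \<rho>p' \<in> vecs_on (lines N)" "\<rho>m + \<rho>m' \<in> vecs_on (lines N)"
      using u v by (auto simp: vecs_on_def)
    show "0 \<le> (\<rho>p + \<rho>p') $ e" "0 \<le> (\<rho>m + \<rho>m') $ e" for e
      using u(5,7) v(5,7) by simp_all
    show "f $ e = P_max N $ e" if "0 < (\<rho>p + \<rho>p') $ e" for e
      using that u(5,6)[of e] v(5,6)[of e] by (cases "0 < \<rho>p $ e") auto
    show "f $ e = P_min N $ e" if "0 < (\<rho>m + \<rho>m') $ e" for e
      using that u(7,8)[of e] v(7,8)[of e] by (cases "0 < \<rho>m $ e") auto
    show "u + v = (inc ** B_mat N ** transpose area) *v (\<pi> + \<pi>') + (inc ** B_mat N) *v (\<rho>p + \<rho>p' - (\<rho>m + \<rho>m'))"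
      unfolding u(1) v(1) by (simp add: matrix_vector_right_distrib matrix_vector_mult_diff_distrib)
  qed
next
  fix u and c :: real assume "u \<in> price_cone f" and c: "0 \<le> c"
  then obtain \<pi> \<rho>p \<rho>m where
    u: "u = (inc ** B_mat N ** transpose area) *v \<pi> + (inc ** B_mat N) *v (\<rho>p - \<rho>m)"
      "\<pi> \<in> vecs_on (areas N)" "\<rho>p \<in> vecs_on (lines N)" "\<rho>m \<in> vecs_on (lines N)"
      "\<And>e. 0 \<le> \<rho>p $ e" "\<And>e. 0 < \<rho>p $ e \<Longrightarrow> f $ e = P_max N $ e"
      "\<And>e. 0 \<le> \<rho>m $ e" "\<And>e. 0 < \<rho>m $ e \<Longrightarrow> f $ e = P_min N $ e"
    unfolding price_cone_def mem_Collect_eq by blast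
  show "c *\<^sub>R u \<in> price_cone f"
  proof (rule price_coneI[where \<pi> = "c *\<^sub>R \<pi>" and \<rho>p = "c *\<^sub>R \<rho>p" and \<rho>m = "c *\<^sub>R \<rho>m"])
    show "c *\<^sub>R \<pi> \<in> vecs_on (areas N)" "c *\<^sub>R \<rho>p \<in> vecs_on (lines N)" "c *\<^sub>R \<rho>m \<in> vecs_on (lines N)"
      using u by (auto simp: vecs_on_def)
    show "0 \<le> (c *\<^sub>R \<rho>p) $ e" "0 \<le> (c *\<^sub>R \<rho>m) $ e" for e
      using u(5,7) c by simp_all
    show "f $ e = P_max N $ e" if "0 < (c *\<^sub>R \<rho>p) $ e" for e
      using that u(5,6)[of e] c by (auto simp: zero_less_mult_iff)
    show "f $ e = P_min N $ e" if "0 < (c *\<^sub>R \<rho>m) $ e" for e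
      using that u(7,8)[of e] c by (auto simp: zero_less_mult_iff)
    show "c *\<^sub>R u = (inc ** B_mat N ** transpose area) *v (c *\<^sub>R \<pi>) + (inc ** B_mat N) *v (c *\<^sub>R \<rho>p - c *\<^sub>R \<rho>m)"
      unfolding u(1) scaleR_diff_right[symmetric] matrix_vector_mult_scaleR scaleR_add_right ..
  qed
qed

text \<open>
  Farkas' lemma: the price cone contains the convex cone generated by finitely many columns, which is a
  polyhedron and therefore closed. A point outside it would be separated by a vector \<open>a\<close>, and the
  flow of \<open>- a\<close> would be a feasible direction violating the hypothesis.
\<close>
lemma multipliers_exist:
  assumes dir: "\<And>h. h \<in> range flow \<Longrightarrow> area *v h = 0 \<Longrightarrow> (\<And>e. f $ e = P_max N $ e \<Longrightarrow> h $ e \<le> 0) \<Longrightarrow>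
      (\<And>e. f $ e = P_min N $ e \<Longrightarrow> 0 \<le> h $ e) \<Longrightarrow> l \<bullet> (inc *v h) \<le> 0"
  shows "lap *v l \<in> price_cone f"
proof -
  let ?A = "\<lambda>k. (inc ** B_mat N ** transpose area) *v axis k 1"
  let ?R = "\<lambda>e. (inc ** B_mat N) *v axis e 1"
  define G where "G = ?A ` areas N \<union> (\<lambda>k. - ?A k) ` areas N
     \<union> ?R ` {e \<in> lines N. f $ e = P_max N $ e} \<union> (\<lambda>e. - ?R e) ` {e \<in> lines N. f $ e = P_min N $ e}"
  have finG: "finite G" by (auto simp: G_def)
  have axis_nn: "0 \<le> axis e (1::real) $ e'" for e e' :: "'n \<times> 'n" by (simp add: axis_def)
  have axis_lines: "axis e (1::real) \<in> vecs_on (lines N)" if "e \<in> lines N" for e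
    using that by (auto simp: vecs_on_def axis_def)
  have axis_areas: "axis k (1::real) \<in> vecs_on (areas N)" "- axis k (1::real) \<in> vecs_on (areas N)" if "k \<in> areas N" for k
    using that by (auto simp: vecs_on_def axis_def)
  have zero: "(0::real^'m::finite) \<in> vecs_on A" for A by (simp add: vecs_on_def)
  have "?A k \<in> price_cone f" "- ?A k \<in> price_cone f" if "k \<in> areas N" for k
  proof -
    show "?A k \<in> price_cone f"
      by (rule price_coneI[where \<pi> = "axis k 1" and \<rho>p = 0 and \<rho>m = 0])
         (use axis_areas[OF that] zero in auto)
    show "- ?A k \<in> price_cone f"
      by (rule price_coneI[where \<pi> = "- axis k 1" and \<rho>p = 0 and \<rho>m = 0])
         (use axis_areas[OF that] zero in \<open>auto simp: matrix_vector_mult_minus_right\<close>)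
  qed
  moreover have "?R e \<in> price_cone f" if "e \<in> lines N" "f $ e = P_max N $ e" for e
    by (rule price_coneI[where \<pi> = 0 and \<rho>p = "axis e 1" and \<rho>m = 0])
       (use axis_lines[OF that(1)] axis_nn that(2) zero in \<open>auto simp: axis_def split: if_splits\<close>)
  moreover have "- ?R e \<in> price_cone f" if "e \<in> lines N" "f $ e = P_min N $ e" for e
    by (rule price_coneI[where \<pi> = 0 and \<rho>p = 0 and \<rho>m = "axis e 1"])
       (use axis_lines[OF that(1)] axis_nn that(2) zero in \<open>auto simp: axis_def matrix_vector_mult_minus_right split: if_splits\<close>)
  ultimately have "G \<subseteq> price_cone f" by (auto simp: G_def)
  then have hull: "convex_cone hull G \<subseteq> price_cone f"
    by (rule hull_minimal) (rule convex_cone_price_cone)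
  have "lap *v l \<in> convex_cone hull G"
  proof (rule ccontr)
    assume out: "lap *v l \<notin> convex_cone hull G"
    have "closed (convex_cone hull G)"
      by (rule polyhedron_imp_closed[OF polyhedron_convex_cone_hull[OF finG]])
    from separating_hyperplane_closed_point[OF convex_convex_cone_hull this out]
    obtain a b where ab: "a \<bullet> (lap *v l) < b" "\<And>v. v \<in> convex_cone hull G \<Longrightarrow> b < a \<bullet> v" by blast
    have b: "b < 0" using ab(2)[OF convex_cone_hull_contains_0] by simp
    have cone: "0 \<le> a \<bullet> v" if v: "v \<in> G" for v
    proof (rule ccontr)
      assume neg: "\<not> 0 \<le> a \<bullet> v"
      \<comment> \<open>scaling \<open>v\<close> until its value reaches the separating level \<open>b < 0\<close>\<close>
      define r where "r = b / (a \<bullet> v)"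
      have "0 \<le> r" using neg b by (simp add: r_def divide_nonpos_neg)
      then have "r *\<^sub>R v \<in> convex_cone hull G"
        using v hull_inc[of v G convex_cone] by (intro convex_cone_hull_mul) auto
      from ab(2)[OF this] show False using neg by (simp add: r_def)
    qed
    have aA: "a \<bullet> ?A k = (area *v flow a) $ k" and aR: "a \<bullet> ?R e = flow a $ e" for k e
      by (simp_all add: inner_area_price inner_inc_B inner_axis inner_commute[of "axis _ _"] del: transpose_matrix_vector)
    have "l \<bullet> (inc *v flow (- a)) \<le> 0"
    proof (rule dir)
      have neg: "flow (- a) = - flow a" using flow_diff[of 0 a] by (simp add: flow_def)
      show "area *v flow (- a) = 0"
      proof -
        have "(area *v flow a) $ k = 0" for k
        proof (cases "k \<in> areas N")
          case True
          then have "?A k \<in> G" "- ?A k \<in> G" by (auto simp: G_def)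
          from cone[OF this(1)] cone[OF this(2)] show ?thesis by (simp add: aA)
        next
          case False
          then show ?thesis by (rule area_off_areas)
        qed
        then show ?thesis unfolding neg by (simp add: vec_eq_iff matrix_vector_mult_minus_right)
      qed
      show "flow (- a) $ e \<le> 0" if "f $ e = P_max N $ e" for e
      proof (cases "e \<in> lines N")
        case True
        then have "?R e \<in> G" using that by (auto simp: G_def)
        from cone[OF this] show ?thesis by (simp add: aR neg)
      qed (simp add: flow_off_lines)
      show "0 \<le> flow (- a) $ e" if "f $ e = P_min N $ e" for e
      proof (cases "e \<in> lines N")
        case True
        then have "- ?R e \<in> G" using that by (auto simp: G_def)
        from cone[OF this] show ?thesis by (simp add: aR neg)
      qed (simp add: flow_off_lines)
    qed simp
    also have "l \<bullet> (inc *v flow (- a)) = - (a \<bullet> (lap *v l))"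
      using inner_laplacian_commute[of l "- a"] by (simp add: laplacian_flow)
    finally show False using ab(1) b by linarith
  qed
  then show ?thesis using hull by blast
qed

text \<open>
  An optimal flow together with its Lagrange multipliers, at zero frequency deviation, is an equilibrium.
\<close>
lemma equilibria_nonempty: "equilibria N \<noteq> {}"
proof -
  obtain f where f: "f \<in> feasible_flows" "\<And>i. dispatch f $ i \<in> demand_interior i"
    "\<And>f'. f' \<in> feasible_flows \<Longrightarrow> (\<And>i. dispatch f' $ i \<in> demand_interior i) \<Longrightarrow> total_cost f \<le> total_cost f'"
    using optimal_flow_exists by blast
  define l where "l = (\<chi> i. marginal_cost i (dispatch f $ i))"
  have "lap *v l \<in> price_cone f"
    using first_order_condition[OF f] unfolding l_def by (intro multipliers_exist) blast
  then obtain \<pi> \<rho>p \<rho>m where price: "lap *v l = (inc ** B_mat N ** transpose area) *v \<pi> + (inc ** B_mat N) *v (\<rho>p - \<rho>m)"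
    and mem: "\<pi> \<in> vecs_on (areas N)" "\<rho>p \<in> vecs_on (lines N)" "\<rho>m \<in> vecs_on (lines N)"
    and \<rho>p: "\<And>e. 0 \<le> \<rho>p $ e" "\<And>e. 0 < \<rho>p $ e \<Longrightarrow> f $ e = P_max N $ e"
    and \<rho>m: "\<And>e. 0 \<le> \<rho>m $ e" "\<And>e. 0 < \<rho>m $ e \<Longrightarrow> f $ e = P_min N $ e"
    unfolding price_cone_def by blast
  obtain \<theta> where \<theta>: "f = flow \<theta>" using f(1) by (auto simp: feasible_flows_def)
  have d: "demands l = dispatch f"
    using demand_marginal_cost[OF f(2)] by (simp add: demands_def l_def vec_eq_iff)
  have load: "load_frequency i (l $ i) ((inc *v f) $ i) = 0" for i
  proof (rule load_frequency_unique[symmetric])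
    have "demand N i (l $ i) = dispatch f $ i" using d by (metis demands_def vec_lambda_beta)
    then show "P_in N $ i - demand N i (l $ i + 0) - damping N $ i * 0 - (inc *v f) $ i = 0" by simp
  qed
  define y where "y = (l, 0::real^'n, \<pi>, \<rho>p, \<rho>m)"
  have completed: "completed (\<theta>, f) y = (l, 0, \<pi>, \<rho>p, \<rho>m)"
    by (simp add: completed_def y_def frequency_def load vec_eq_iff)
  have box: "P_min N $ e \<le> f $ e" "f $ e \<le> P_max N $ e" for e
    using f(1) by (auto simp: feasible_flows_def mem_box_cart simp del: split_paired_All)
  have "grad_x (completed (\<theta>, f) y) = 0"
    unfolding completed by (simp add: grad_x_def price zero_prod_def)
  moreover have "proj_rho y (grad_dual (\<theta>, f) (completed (\<theta>, f) y)) = 0"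
  proof -
    have "pos_proj \<rho>p (f - P_max N) = 0" "pos_proj \<rho>m (P_min N - f) = 0"
      unfolding pos_proj_eq_0_iff using box \<rho>p(2) \<rho>m(2) by (auto simp del: split_paired_All)
    moreover have "area *v f = P_hat N" using f(1) by (simp add: feasible_flows_def)
    ultimately show ?thesis
      unfolding completed by (simp add: y_def grad_dual_def proj_rho_def d laplacian_flow \<theta>[symmetric] zero_prod_def)
  qed
  moreover have "((\<theta>, f), y) \<in> state_space N"
  proof -
    have "f \<in> vecs_on (lines N)" using flow_off_lines unfolding \<theta> vecs_on_def by blast
    then show ?thesis unfolding state_space_def y_def using mem \<rho>p(1) \<rho>m(1) by (simp add: vecs_on_def)
  qed
  ultimately show ?thesis unfolding equilibria_eq by blast
qed

end


section \<open>Gains and the weighted distance\<close>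

lemma gain_inner_Basis: "b \<in> Basis \<Longrightarrow> gain g z \<bullet> b = (g \<bullet> b) * (z \<bullet> b)"
  unfolding gain_def by (simp add: inner_sum_left inner_Basis if_distrib sum.delta cong: if_cong)

lemma linear_gain: "linear (gain g)"
  by (rule linearI; rule euclidean_eqI) (simp_all add: gain_inner_Basis inner_add_left algebra_simps)

lemma gain_Pair: "gain (a, b) (x, y) = (gain a x, gain b y)"
  by (rule euclidean_eqI) (auto simp: gain_inner_Basis Basis_prod_def)

lemma gain_inner_pos:
  assumes "\<And>b. b \<in> Basis \<Longrightarrow> g \<bullet> b > 0" and "gain g v \<bullet> v = 0"
  shows "v = 0"
proof (rule euclidean_eqI)
  have eq: "(\<Sum>b\<in>Basis. (g \<bullet> b) * (v \<bullet> b)\<^sup>2) = 0"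
    using assms(2) by (subst (asm) euclidean_inner) (simp add: gain_inner_Basis power2_eq_square mult.assoc)
  fix b :: 'a assume b: "b \<in> Basis"
  have "(g \<bullet> b) * (v \<bullet> b)\<^sup>2 = 0"
    using sum_nonneg_eq_0_iff[THEN iffD1, OF finite_Basis _ eq] assms(1) b by (simp add: less_imp_le)
  then show "v \<bullet> b = 0 \<bullet> b" using assms(1)[OF b] by simp
qed

text \<open>
  The squared norm in which distances to equilibria do not increase along trajectories: weights reciprocal to the
  gains cancel the gains in the derivative along trajectories.
\<close>
definition weighted_sq :: "'z::euclidean_space \<Rightarrow> 'z \<Rightarrow> real" where
  "weighted_sq g z = (\<Sum>b\<in>Basis. (z \<bullet> b)\<^sup>2 / (g \<bullet> b))"

lemma norm_sq_Basis: "(norm z)\<^sup>2 = (\<Sum>b\<in>Basis. (z \<bullet> b)\<^sup>2)" for z :: "'z::euclidean_space"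
  unfolding power2_norm_eq_inner by (subst euclidean_inner) (simp add: power2_eq_square)

lemma weighted_sq_bounds:
  fixes g :: "'z::euclidean_space"
  assumes g: "\<And>b. b \<in> Basis \<Longrightarrow> g \<bullet> b > 0"
  obtains m M where "0 < m" "0 < M" "\<And>z. (norm z)\<^sup>2 \<le> m * weighted_sq g z" "\<And>z. weighted_sq g z \<le> M * (norm z)\<^sup>2"
proof -
  let ?m = "\<Sum>b\<in>Basis. g \<bullet> b" and ?M = "\<Sum>b\<in>Basis. 1 / (g \<bullet> b)"
  have pos: "0 < ?m" "0 < ?M" using g by (auto intro!: sum_pos simp: nonempty_Basis)
  have "(norm z)\<^sup>2 \<le> ?m * weighted_sq g z" for z
    unfolding norm_sq_Basis weighted_sq_def sum_distrib_left
  proof (rule sum_mono)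
    fix b :: 'z assume b: "b \<in> Basis"
    have "g \<bullet> b \<le> ?m" using g b by (intro member_le_sum) (auto simp: less_imp_le)
    then have "(g \<bullet> b) * ((z \<bullet> b)\<^sup>2 / (g \<bullet> b)) \<le> ?m * ((z \<bullet> b)\<^sup>2 / (g \<bullet> b))"
      using g[OF b] by (intro mult_right_mono) auto
    then show "(z \<bullet> b)\<^sup>2 \<le> ?m * ((z \<bullet> b)\<^sup>2 / (g \<bullet> b))" using g[OF b] by simp
  qed
  moreover have "weighted_sq g z \<le> ?M * (norm z)\<^sup>2" for z
    unfolding norm_sq_Basis weighted_sq_def sum_distrib_left
  proof (rule sum_mono)
    fix b :: 'z assume b: "b \<in> Basis"
    have "1 / (g \<bullet> b) \<le> ?M"
      by (rule member_le_sum[OF b, of "\<lambda>b. 1 / (g \<bullet> b)"]) (use g in \<open>auto simp: less_imp_le\<close>)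
    then have "1 / (g \<bullet> b) * (z \<bullet> b)\<^sup>2 \<le> ?M * (z \<bullet> b)\<^sup>2" by (intro mult_right_mono) auto
    then show "(z \<bullet> b)\<^sup>2 / (g \<bullet> b) \<le> ?M * (z \<bullet> b)\<^sup>2" by simp
  qed
  ultimately show thesis using that pos by blast
qed

lemma weighted_sq_derivative:
  "((\<lambda>z. weighted_sq g (z - p) / 2) has_derivative (\<lambda>h. \<Sum>b\<in>Basis. ((z - p) \<bullet> b) * (h \<bullet> b) / (g \<bullet> b))) (at z)"
proof -
  have inner: "((\<lambda>z. (z - p) \<bullet> b) has_derivative (\<lambda>h. h \<bullet> b)) (at z)" for b
    by (auto intro!: derivative_eq_intros)
  have der: "((\<lambda>z. \<Sum>b\<in>Basis. (1 / (2 * (g \<bullet> b))) * (((z - p) \<bullet> b) * ((z - p) \<bullet> b))) has_derivative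
      (\<lambda>h. \<Sum>b\<in>Basis. (1 / (2 * (g \<bullet> b))) * (((z - p) \<bullet> b) * (h \<bullet> b) + (h \<bullet> b) * ((z - p) \<bullet> b)))) (at z)"
    by (intro has_derivative_sum has_derivative_mult_right has_derivative_mult inner)
  have eq: "(\<lambda>z. \<Sum>b\<in>Basis. (1 / (2 * (g \<bullet> b))) * (((z - p) \<bullet> b) * ((z - p) \<bullet> b))) = (\<lambda>z. weighted_sq g (z - p) / 2)"
    unfolding weighted_sq_def sum_divide_distrib by (simp add: power2_eq_square mult.commute)
  have term_eq: "(1 / (2 * c)) * (x * y + y * x) = x * y / c" for c x y :: real
    by (simp add: mult.commute)
  show ?thesis using der unfolding eq term_eq .
qed

lemma weighted_sq_derivative_gain:
  assumes g: "\<And>b. b \<in> Basis \<Longrightarrow> g \<bullet> b > 0"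
  shows "(\<Sum>b\<in>Basis. (w \<bullet> b) * (gain g v \<bullet> b) / (g \<bullet> b)) = w \<bullet> v"
proof -
  have "(\<Sum>b\<in>Basis. (w \<bullet> b) * (gain g v \<bullet> b) / (g \<bullet> b)) = (\<Sum>b\<in>Basis. (w \<bullet> b) * (v \<bullet> b))"
    using g by (intro sum.cong refl) (fastforce simp: gain_inner_Basis)
  then show ?thesis by (simp add: euclidean_inner[symmetric])
qed

lemma weighted_sq_lipschitz:
  fixes g p :: "'z::euclidean_space"
  assumes g: "\<And>b. b \<in> Basis \<Longrightarrow> g \<bullet> b > 0"
  shows "\<exists>L. L-lipschitz_on (cball 0 R) (\<lambda>z. weighted_sq g (z - p) / 2)"
proof (cases "R \<ge> 0")
  case False
  then show ?thesis by (intro exI[of _ 0] lipschitz_onI) auto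
next
  case R: True
  let ?L = "\<Sum>b\<in>Basis. (R + norm p) / (g \<bullet> b)"
  show ?thesis
  proof (intro exI[of _ ?L] lipschitz_onI)
    show "0 \<le> ?L" using g R by (intro sum_nonneg divide_nonneg_nonneg) (auto simp: less_imp_le)
    fix u v :: 'z assume uv: "u \<in> cball 0 R" "v \<in> cball 0 R"
    have term_le: "\<bar>((u - p) \<bullet> b)\<^sup>2 / (g \<bullet> b) - ((v - p) \<bullet> b)\<^sup>2 / (g \<bullet> b)\<bar> \<le> 2 * (R + norm p) / (g \<bullet> b) * norm (u - v)"
      if b: "b \<in> Basis" for b
    proof -
      have 1: "\<bar>(u - v) \<bullet> b\<bar> \<le> norm (u - v)" by (rule Basis_le_norm[OF b])
      have "\<bar>(u + v - 2 *\<^sub>R p) \<bullet> b\<bar> \<le> norm (u + v - 2 *\<^sub>R p)" by (rule Basis_le_norm[OF b])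
      also have "\<dots> \<le> norm u + norm v + 2 * norm p"
        using norm_triangle_ineq4[of "u + v" "2 *\<^sub>R p"] norm_triangle_ineq[of u v] by simp
      also have "\<dots> \<le> 2 * (R + norm p)" using uv by simp
      finally have 2: "\<bar>(u + v - 2 *\<^sub>R p) \<bullet> b\<bar> \<le> 2 * (R + norm p)" .
      have "((u - p) \<bullet> b)\<^sup>2 - ((v - p) \<bullet> b)\<^sup>2 = ((u + v - 2 *\<^sub>R p) \<bullet> b) * ((u - v) \<bullet> b)"
        by (simp add: inner_diff_left inner_add_left power2_eq_square algebra_simps)
      then have "\<bar>((u - p) \<bullet> b)\<^sup>2 - ((v - p) \<bullet> b)\<^sup>2\<bar> \<le> 2 * (R + norm p) * norm (u - v)"
        using mult_mono[OF 2 1] R by (simp add: abs_mult)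
      then have "\<bar>((u - p) \<bullet> b)\<^sup>2 - ((v - p) \<bullet> b)\<^sup>2\<bar> / (g \<bullet> b) \<le> 2 * (R + norm p) * norm (u - v) / (g \<bullet> b)"
        using g[OF b] by (intro divide_right_mono) auto
      then show ?thesis using g[OF b] by (simp add: diff_divide_distrib[symmetric])
    qed
    have "\<bar>weighted_sq g (u - p) - weighted_sq g (v - p)\<bar>
        \<le> (\<Sum>b\<in>Basis. \<bar>((u - p) \<bullet> b)\<^sup>2 / (g \<bullet> b) - ((v - p) \<bullet> b)\<^sup>2 / (g \<bullet> b)\<bar>)"
      unfolding weighted_sq_def sum_subtractf[symmetric] by (rule sum_abs)
    also have "\<dots> \<le> (\<Sum>b\<in>Basis. 2 * (R + norm p) / (g \<bullet> b) * norm (u - v))"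
      by (rule sum_mono) (rule term_le)
    also have "\<dots> = 2 * (?L * norm (u - v))"
      unfolding sum_distrib_right sum_distrib_left by (rule sum.cong) (auto simp: mult_ac)
    finally have "\<bar>weighted_sq g (u - p) - weighted_sq g (v - p)\<bar> \<le> 2 * (?L * norm (u - v))" .
    then show "dist (weighted_sq g (u - p) / 2) (weighted_sq g (v - p) / 2) \<le> ?L * dist u v"
      unfolding dist_real_def dist_norm diff_divide_distrib[symmetric] by simp
  qed
qed

lemma nonincreasing_converges:
  fixes u :: "real \<Rightarrow> real"
  assumes dec: "\<And>s t. 0 \<le> s \<Longrightarrow> s \<le> t \<Longrightarrow> u t \<le> u s" and nn: "\<And>t. 0 \<le> t \<Longrightarrow> 0 \<le> u t"
  shows "\<exists>c. (u \<longlongrightarrow> c) at_top"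
proof -
  define c where "c = Inf (u ` {0..})"
  have bdd: "bdd_below (u ` {0..})" using nn by (intro bdd_belowI[of _ 0]) auto
  have "(u \<longlongrightarrow> c) at_top"
  proof (rule order_tendstoI)
    fix a assume a: "a < c"
    have "c \<le> u t" if "0 \<le> t" for t unfolding c_def using that bdd by (intro cInf_lower) auto
    then show "\<forall>\<^sub>F t in at_top. a < u t"
      using a unfolding eventually_at_top_linorder by (intro exI[of _ 0]) fastforce
  next
    fix a assume "c < a"
    then obtain s where "0 \<le> s" "u s < a"
      unfolding c_def using cInf_less_iff[of "u ` {0..}" a] bdd by auto
    then show "\<forall>\<^sub>F t in at_top. u t < a"
      using dec unfolding eventually_at_top_linorder by (meson le_less_trans)
  qed
  then show ?thesis by blast
qed


section \<open>Convergence of trajectories\<close>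

lemma Basis_prod_cases:
  assumes "b \<in> Basis"
  shows "(\<exists>u\<in>Basis. b = (u, 0)) \<or> (\<exists>v\<in>Basis. b = (0, v))"
  using assms unfolding Basis_prod_def by blast

lemma norm_pos_proj_le: "norm (pos_proj \<rho> a) \<le> norm a"
  by (rule norm_le_componentwise_cart) (simp add: pos_proj_def)

lemma norm_proj_rho_le: "norm (proj_rho y g) \<le> norm g"
proof -
  obtain gl gn gp gr gs where g: "g = (gl, gn, gp, gr, gs)" by (cases g)
  obtain l \<nu> \<pi> \<rho>p \<rho>m where y: "y = (l, \<nu>, \<pi>, \<rho>p, \<rho>m)" by (cases y)
  have "norm (pos_proj \<rho>p gr, pos_proj \<rho>m gs) \<le> norm (gr, gs)"
    unfolding norm_prod_def by (intro real_sqrt_le_mono add_mono power_mono) (simp_all add: norm_pos_proj_le)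
  then have "norm (gp, pos_proj \<rho>p gr, pos_proj \<rho>m gs) \<le> norm (gp, gr, gs)"
    unfolding norm_Pair[of gp] by (intro real_sqrt_le_mono add_mono power_mono) simp_all
  then have "norm (gn, gp, pos_proj \<rho>p gr, pos_proj \<rho>m gs) \<le> norm (gn, gp, gr, gs)"
    unfolding norm_Pair[of gn] by (intro real_sqrt_le_mono add_mono power_mono) simp_all
  then show ?thesis
    unfolding g y proj_rho_def prod.case norm_Pair[of gl] by (intro real_sqrt_le_mono add_mono power_mono) simp_all
qed

text \<open>
  The projection changes only components with \<open>\<rho> = 0\<close> and \<open>a \<le> 0\<close>, where
  replacing \<open>a\<close> by \<open>0\<close> moves in the favourable direction because \<open>\<rho>' \<ge>
  0\<close>.
\<close>
lemma inner_pos_proj_le: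
  assumes "\<And>e. 0 \<le> \<rho> $ e" "\<And>e. 0 \<le> \<rho>' $ e"
  shows "(\<rho> - \<rho>') \<bullet> pos_proj \<rho> a \<le> (\<rho> - \<rho>') \<bullet> a"
  unfolding inner_vec_def
proof (rule sum_mono)
  fix e
  show "(\<rho> - \<rho>') $ e \<bullet> pos_proj \<rho> a $ e \<le> (\<rho> - \<rho>') $ e \<bullet> a $ e"
  proof (cases "a $ e > 0 \<or> \<rho> $ e > 0")
    case False
    then have "\<rho> $ e = 0" "a $ e \<le> 0" using assms(1)[of e] by auto
    then show ?thesis using assms(2)[of e] False by (simp add: pos_proj_def mult_nonneg_nonpos)
  qed (simp add: pos_proj_def)
qed

locale olc_dynamics = olc N \<alpha>
  for N :: "('n::finite, 'k::finite) grid" and \<alpha> :: real +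
  fixes X :: "'n primal" and Y :: "('n, 'k) dual"
  assumes X_pos: "b \<in> Basis \<Longrightarrow> X \<bullet> b > 0" and Y_pos: "c \<in> Basis \<Longrightarrow> Y \<bullet> c > 0"
begin

abbreviation "system \<equiv> primal_dual N X Y"
abbreviation "gains \<equiv> (X, Y)"

definition direction :: "'n primal \<times> ('n, 'k) dual \<Rightarrow> 'n primal \<times> ('n, 'k) dual" where
  "direction = (\<lambda>(x, y). (- grad_x (completed x y), proj_rho y (grad_dual x (completed x y))))"

lemma system_eq: "system z = gain gains (direction z)"
proof -
  have "gain X (- a) = - gain X a" for a using linear_neg[OF linear_gain] .
  then show ?thesis by (cases z) (simp add: primal_dual_eq direction_def gain_Pair)
qed

lemma gains_pos:
  assumes "b \<in> Basis"
  shows "gains \<bullet> b > 0"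
proof -
  consider u where "b = (u, 0)" "u \<in> Basis" | v where "b = (0, v)" "v \<in> Basis"
    using Basis_prod_cases[OF assms] by blast
  then show ?thesis by cases (simp_all add: X_pos Y_pos)
qed

text \<open>
  For an equilibrium and a state this is nonnegative, and it vanishes exactly when the multipliers of the state are
  supported on lines that are congested at that equilibrium.
\<close>
definition congestion_slack :: "'n primal \<times> ('n, 'k) dual \<Rightarrow> 'n primal \<times> ('n, 'k) dual \<Rightarrow> real" where
  "congestion_slack = (\<lambda>((\<phi>', _), _) (_, (_, _, _, \<rho>p, \<rho>m)).
     \<rho>p \<bullet> (P_max N - flow \<phi>') + \<rho>m \<bullet> (flow \<phi>' - P_min N))"

definition decay :: "'n primal \<times> ('n, 'k) dual \<Rightarrow> 'n primal \<times> ('n, 'k) dual \<Rightarrow> real" where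
  "decay p z = dissipation (completed (fst z) (snd z)) (completed (fst p) (snd p)) + congestion_slack p z"

lemma congestion_slack_nonneg:
  assumes "p \<in> equilibria N" "z \<in> state_space N"
  shows "0 \<le> congestion_slack p z"
proof -
  obtain \<phi> P y where p: "p = ((\<phi>, P), y)" by (metis prod.collapse)
  obtain x l \<nu> \<pi> \<rho>p \<rho>m where z: "z = (x, l, \<nu>, \<pi>, \<rho>p, \<rho>m)" by (metis prod.collapse)
  obtain l' \<nu>' \<pi>' \<rho>p' \<rho>m' where f: "completed (\<phi>, P) y = (l', \<nu>', \<pi>', \<rho>p', \<rho>m')" by (metis prod.collapse)
  have lim: "flow \<phi> $ e \<le> P_max N $ e" "P_min N $ e \<le> flow \<phi> $ e" for e
    using equilibrium_conditions(6,7)[OF assms(1)[unfolded p] f refl] .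
  have "0 \<le> \<rho>p $ e" "0 \<le> \<rho>m $ e" for e
    using assms(2) by (auto simp: z state_space_def simp del: split_paired_All)
  then show ?thesis
    using lim unfolding congestion_slack_def p z prod.case inner_vec_def
    by (intro add_nonneg_nonneg sum_nonneg) auto
qed

text \<open>
  The pairing of the displacement with the unprojected field splits into the dissipation and the pairing with
  the field at the equilibrium, of which only the congestion terms survive; the projection helps.
\<close>
lemma decay_bound:
  assumes p: "p \<in> equilibria N" and z: "z \<in> state_space N"
  shows "(z - p) \<bullet> direction z \<le> - decay p z"
proof -
  obtain \<phi>' P' y' where p': "p = ((\<phi>', P'), y')" by (metis prod.collapse)
  obtain \<phi> P y where z': "z = ((\<phi>, P), y)" by (metis prod.collapse)
  obtain l \<nu> \<pi> \<rho>p \<rho>m where y: "y = (l, \<nu>, \<pi>, \<rho>p, \<rho>m)" by (metis prod.collapse)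
  obtain l' \<nu>' \<pi>' \<rho>p' \<rho>m' where y': "y' = (l', \<nu>', \<pi>', \<rho>p', \<rho>m')" by (metis prod.collapse)
  let ?\<sigma> = "completed (\<phi>, P) y" and ?\<sigma>' = "completed (\<phi>', P') y'"
  obtain n' where f': "?\<sigma>' = (l', n', \<pi>', \<rho>p', \<rho>m')" by (simp add: completed_def y')
  note E = equilibrium_conditions[OF p[unfolded p'] f' refl]
  obtain gl gn gp gr gs where g: "grad_dual (\<phi>, P) ?\<sigma> = (gl, gn, gp, gr, gs)" by (metis prod.collapse)
  have nn: "\<And>e. 0 \<le> \<rho>p $ e" "\<And>e. 0 \<le> \<rho>m $ e"
    using z by (auto simp: z' y state_space_def simp del: split_paired_All)
  have "(y - y') \<bullet> proj_rho y (grad_dual (\<phi>, P) ?\<sigma>) \<le> (y - y') \<bullet> grad_dual (\<phi>, P) ?\<sigma>"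
    unfolding g unfolding y y' proj_rho_def prod.case diff_Pair inner_Pair
    by (intro add_mono inner_pos_proj_le nn E(8,9) order_refl)
  moreover have "(\<phi> - \<phi>', P - P') \<bullet> (grad_x ?\<sigma> - grad_x ?\<sigma>') - (y - y') \<bullet> (grad_dual (\<phi>, P) ?\<sigma> - grad_dual (\<phi>', P') ?\<sigma>')
      = dissipation ?\<sigma> ?\<sigma>'"
    using saddle_identity_reduced[of "(\<phi>, P)" "(\<phi>', P')" y y'] by simp
  moreover have "grad_x ?\<sigma>' = 0" using p by (simp add: equilibria_eq p')
  moreover have "(y - y') \<bullet> grad_dual (\<phi>', P') ?\<sigma>' = - congestion_slack p z"
  proof -
    have gd: "grad_dual (\<phi>', P') ?\<sigma>' = (0, 0, 0, flow \<phi>' - P_max N, P_min N - flow \<phi>')"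
      unfolding f' by (simp add: grad_dual_def E(1,2,3,4))
    have "\<rho>p' $ e * (flow \<phi>' - P_max N) $ e = 0" "\<rho>m' $ e * (P_min N - flow \<phi>') $ e = 0" for e
      using E(8,10)[of e] E(9,11)[of e] by (cases "\<rho>p' $ e = 0"; cases "\<rho>m' $ e = 0"; simp add: less_le)+
    then have "\<rho>p' \<bullet> (flow \<phi>' - P_max N) = 0" "\<rho>m' \<bullet> (P_min N - flow \<phi>') = 0"
      unfolding inner_vec_def inner_real_def by (blast intro: sum.neutral)+
    then show ?thesis
      unfolding gd unfolding y y' by (simp add: congestion_slack_def p' z' y inner_diff_left inner_diff_right)
  qed
  ultimately show ?thesis
    unfolding decay_def direction_def p' z' by (simp add: inner_diff_right)
qed

definition lyapunov :: "'n primal \<times> ('n, 'k) dual \<Rightarrow> 'n primal \<times> ('n, 'k) dual \<Rightarrow> real" where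
  "lyapunov p z = weighted_sq gains (z - p) / 2"

lemma lyapunov_nonneg: "0 \<le> lyapunov p z"
  unfolding lyapunov_def weighted_sq_def
  using gains_pos by (intro divide_nonneg_nonneg sum_nonneg) (auto simp: less_imp_le)

definition lyapunov_deriv where
  "lyapunov_deriv p z h = (\<Sum>b\<in>Basis. ((z - p) \<bullet> b) * (h \<bullet> b) / (gains \<bullet> b))"

lemma lyapunov_derivative: "(lyapunov p has_derivative lyapunov_deriv p z) (at z)"
  unfolding lyapunov_def[abs_def] lyapunov_deriv_def[abs_def] by (rule weighted_sq_derivative)

lemma lyapunov_lipschitz: "\<exists>L. L-lipschitz_on (cball 0 R) (lyapunov p)"
  unfolding lyapunov_def[abs_def] using gains_pos by (rule weighted_sq_lipschitz)

lemma lyapunov_decay: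
  assumes "p \<in> equilibria N" "z \<in> state_space N"
  shows "lyapunov_deriv p z (system z) \<le> - decay p z"
proof -
  have "lyapunov_deriv p z (system z) = (z - p) \<bullet> direction z"
    unfolding lyapunov_deriv_def system_eq using gains_pos by (rule weighted_sq_derivative_gain)
  then show ?thesis using decay_bound[OF assms] by simp
qed

lemma decay_nonneg:
  assumes "p \<in> equilibria N" "z \<in> state_space N"
  shows "0 \<le> decay p z"
  unfolding decay_def using congestion_slack_nonneg[OF assms] dissipation_nonneg by simp

lemma lyapunov_nonincreasing:
  assumes sol: "caratheodory_solution system (state_space N) z" and p: "p \<in> equilibria N"
    and st: "0 \<le> s" "s \<le> t"
  shows "lyapunov p (z t) \<le> lyapunov p (z s)"
proof -
  have "lyapunov p (z t) - lyapunov p (z s) \<le> 0 * (t - s)"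
  proof (rule solution_increment_le[OF sol lyapunov_derivative lyapunov_lipschitz st])
    fix r assume "s < r" "r < t"
    then have "z r \<in> state_space N" using sol st unfolding caratheodory_solution_def by simp
    then show "lyapunov_deriv p (z r) (system (z r)) \<le> 0"
      using lyapunov_decay[OF p, of "z r"] decay_nonneg[OF p, of "z r"] by linarith
  qed
  then show ?thesis by simp
qed

lemma trajectory_bounded:
  assumes sol: "caratheodory_solution system (state_space N) z"
  shows "bounded (z ` {0..})"
proof -
  obtain p where p: "p \<in> equilibria N" using equilibria_nonempty by blast
  obtain m M where m: "0 < m" "\<And>w. (norm w)\<^sup>2 \<le> m * weighted_sq gains w"
    using weighted_sq_bounds[OF gains_pos] by metis
  have "norm (z t - p) \<le> sqrt (m * weighted_sq gains (z 0 - p))" if "0 \<le> t" for t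
  proof (rule real_le_rsqrt)
    have "weighted_sq gains (z t - p) \<le> weighted_sq gains (z 0 - p)"
      using lyapunov_nonincreasing[OF sol p order_refl that] by (simp add: lyapunov_def)
    then have "m * weighted_sq gains (z t - p) \<le> m * weighted_sq gains (z 0 - p)"
      using m(1) by (intro mult_left_mono) auto
    then show "(norm (z t - p))\<^sup>2 \<le> m * weighted_sq gains (z 0 - p)" using m(2)[of "z t - p"] by linarith
  qed
  then have "z ` {0..} \<subseteq> cball p (sqrt (m * weighted_sq gains (z 0 - p)))"
    by (auto simp: dist_norm norm_minus_commute)
  then show ?thesis using bounded_cball bounded_subset by blast
qed

lemma continuous_on_grad_x_completed: "continuous_on UNIV (\<lambda>z. grad_x (completed (fst z) (snd z)))"
  by (rule continuous_on_compose2[OF continuous_grad_x continuous_completed]) auto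

lemma continuous_on_grad_dual_completed: "continuous_on UNIV (\<lambda>z. grad_dual (fst z) (completed (fst z) (snd z)))"
proof -
  have "continuous_on UNIV (\<lambda>z. (fst z, completed (fst z) (snd z)))"
    by (intro continuous_intros continuous_completed)
  from continuous_on_compose2[OF continuous_grad_dual this] show ?thesis by simp
qed

lemma velocity_bounded:
  assumes sol: "caratheodory_solution system (state_space N) z"
  obtains M where "\<And>t. 0 \<le> t \<Longrightarrow> norm (system (z t)) \<le> M"
proof -
  \<comment> \<open>the projected field is discontinuous, but it is dominated by the continuous unprojected one\<close>
  define H where "H w = norm (grad_x (completed (fst w) (snd w))) + norm (grad_dual (fst w) (completed (fst w) (snd w)))" for w
  obtain R where R: "\<forall>w\<in>z ` {0..}. norm w \<le> R"
    using trajectory_bounded[OF sol] unfolding bounded_iff by blast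
  have "continuous_on (cball 0 R) H"
    unfolding H_def
    by (intro continuous_intros continuous_on_subset[OF continuous_on_grad_x_completed] continuous_on_subset[OF continuous_on_grad_dual_completed]) auto
  then have "bounded (H ` cball 0 R)" by (intro compact_imp_bounded compact_continuous_image compact_cball)
  then obtain B where "\<forall>r\<in>H ` cball 0 R. norm r \<le> B" unfolding bounded_iff by blast
  then have B: "\<bar>H w\<bar> \<le> B" if "w \<in> cball 0 R" for w
    using imageI[OF that, of H] by (metis real_norm_def)
  obtain K where K: "K > 0" "\<And>v. norm (gain gains v) \<le> norm v * K"
    using bounded_linear.pos_bounded[OF linear_conv_bounded_linear[THEN iffD1, OF linear_gain[of gains]]] by blast
  show thesis
  proof (rule that[of "B * K"])
    fix t :: real assume "0 \<le> t"
    then have "z t \<in> cball 0 R" using R by simp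
    then have HB: "H (z t) \<le> B" using B[of "z t"] by simp
    have "norm (direction (z t)) \<le> H (z t)"
    proof -
      obtain x y where zt: "z t = (x, y)" by (metis prod.collapse)
      have "norm (direction (z t)) \<le> norm (grad_x (completed x y)) + norm (proj_rho y (grad_dual x (completed x y)))"
        unfolding direction_def zt prod.case using norm_Pair_le[of "- grad_x (completed x y)"] by simp
      then show ?thesis using norm_proj_rho_le[of y "grad_dual x (completed x y)"] by (simp add: H_def zt)
    qed
    then have "norm (direction (z t)) * K \<le> B * K" using HB K(1) by (intro mult_right_mono) auto
    then show "norm (system (z t)) \<le> B * K" unfolding system_eq using K(2)[of "direction (z t)"] by linarith
  qed
qed

lemma continuous_decay: "isCont (decay p) z"
proof -
  have "continuous_on UNIV (\<lambda>z. demand N i (fst (completed (fst z) (snd z)) $ i + fst (snd (completed (fst z) (snd z))) $ i))" for i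
    by (rule continuous_on_compose2[OF continuous_demand]) (auto intro!: continuous_intros continuous_completed)
  then have "continuous_on UNIV (decay p)"
    unfolding decay_def[abs_def] dissipation_def congestion_slack_def case_prod_unfold
    by (auto intro!: continuous_intros continuous_completed)
  then show ?thesis by (metis continuous_on_eq_continuous_at open_UNIV UNIV_I)
qed

lemma closed_state_space: "closed (state_space N)"
proof -
  have "closed {z. P \<longrightarrow> f z = (0::real)}" if "continuous_on UNIV f" for P and f :: "'n primal \<times> ('n, 'k) dual \<Rightarrow> real"
    using that by (cases P) (auto intro: closed_Collect_eq continuous_on_const)
  note c = this
  have eq: "state_space N = {z. (\<forall>e. e \<notin> lines N \<longrightarrow> snd (fst z) $ e = 0)} \<inter> {z. (\<forall>i. i \<notin> generators N \<longrightarrow> fst (snd (snd z)) $ i = 0)}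
     \<inter> {z. (\<forall>k. k \<notin> areas N \<longrightarrow> fst (snd (snd (snd z))) $ k = 0)} \<inter> {z. (\<forall>e. e \<notin> lines N \<longrightarrow> fst (snd (snd (snd (snd z)))) $ e = 0)}
     \<inter> {z. (\<forall>e. e \<notin> lines N \<longrightarrow> snd (snd (snd (snd (snd z)))) $ e = 0)} \<inter> {z. \<forall>e. 0 \<le> fst (snd (snd (snd (snd z)))) $ e}
     \<inter> {z. \<forall>e. 0 \<le> snd (snd (snd (snd (snd z)))) $ e}"
    unfolding state_space_def vecs_on_def by (auto simp: case_prod_unfold simp del: split_paired_All)
  show ?thesis
    unfolding eq by (intro closed_Int closed_Collect_all c closed_Collect_le continuous_intros)
qed

lemma omega_limit_in_state_space:
  assumes sol: "caratheodory_solution system (state_space N) z" and q: "q \<in> omega_limit z"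
  shows "q \<in> state_space N"
proof -
  obtain s where s: "filterlim s at_top sequentially" "(\<lambda>n. z (s n)) \<longlonglongrightarrow> q"
    using q unfolding omega_limit_def by blast
  have "\<forall>\<^sub>F n in sequentially. z (s n) \<in> state_space N"
    using s(1)[unfolded filterlim_at_top, rule_format, of 0]
    by eventually_elim (use sol in \<open>simp add: caratheodory_solution_def\<close>)
  then show ?thesis
    using Lim_in_closed_set[OF closed_state_space _ sequentially_bot s(2)] by blast
qed

lemma decay_zero_on_omega_limit:
  assumes sol: "caratheodory_solution system (state_space N) z" and p: "p \<in> equilibria N"
    and q: "q \<in> omega_limit z"
  shows "decay p q = 0"
proof -
  obtain M where M: "\<And>t. 0 \<le> t \<Longrightarrow> norm (system (z t)) \<le> M" using velocity_bounded[OF sol] by blast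
  have zS: "z t \<in> state_space N" if "0 \<le> t" for t using sol that unfolding caratheodory_solution_def by blast
  obtain c where c: "((\<lambda>t. lyapunov p (z t)) \<longlongrightarrow> c) at_top"
    using nonincreasing_converges[of "\<lambda>t. lyapunov p (z t)"] lyapunov_nonincreasing[OF sol p] lyapunov_nonneg by blast
  have "decay p q \<le> 0"
    by (rule decrease_rate_nonpos_at_omega_limit[OF sol M lyapunov_derivative lyapunov_lipschitz _ c continuous_decay q])
       (use lyapunov_decay[OF p zS] in auto)
  then show ?thesis using decay_nonneg[OF p omega_limit_in_state_space[OF sol q]] by linarith
qed

text \<open>
  If a linear functional is constant on the limit set, it converges along the trajectory, so applying the
  decrease-rate lemma to the functional and to its negative forces its continuous time derivative to vanish at
  limit points. This recovers one equation of the equilibrium at a time.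
\<close>
lemma stationary_functional:
  assumes sol: "caratheodory_solution system (state_space N) z"
    and const: "\<And>q. q \<in> omega_limit z \<Longrightarrow> a \<bullet> q = c"
    and w: "\<And>u. a \<bullet> system u = w u" "continuous_on UNIV w"
    and q: "q \<in> omega_limit z"
  shows "w q = 0"
proof -
  obtain M where M: "\<And>t. 0 \<le> t \<Longrightarrow> norm (system (z t)) \<le> M" using velocity_bounded[OF sol] by blast
  have conv: "((\<lambda>t. a \<bullet> z t) \<longlongrightarrow> c) at_top"
    by (rule converges_if_constant_on_omega_limit[OF trajectory_bounded[OF sol] _ const]) (intro continuous_intros)
  have lip: "\<exists>L. L-lipschitz_on (cball 0 R) (\<lambda>x. v \<bullet> x)" for R and v :: "'n primal \<times> ('n, 'k) dual"
    using inner_lipschitz by blast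
  have cont: "isCont w q" using w(2) by (metis continuous_on_eq_continuous_at open_UNIV UNIV_I)
  have "- w q \<le> 0"
    by (rule decrease_rate_nonpos_at_omega_limit[OF sol M inner_derivative[of a] lip _ conv _ q])
       (use w(1) cont in \<open>auto intro: continuous_minus\<close>)
  moreover have "w q \<le> 0"
    by (rule decrease_rate_nonpos_at_omega_limit[OF sol M inner_derivative[of "- a"] lip _ _ cont q])
       (use w(1) tendsto_minus[OF conv] in auto)
  ultimately show ?thesis by simp
qed

lemma inner_system_Basis: "b \<in> Basis \<Longrightarrow> b \<bullet> system u = (gains \<bullet> b) * (direction u \<bullet> b)"
  unfolding system_eq by (simp add: inner_commute[of b] gain_inner_Basis)

text \<open>
  Zero decay fixes \<open>l\<close> and the frequencies and gives complementary slackness. Constant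
  \<open>l\<close> forces power balance, which fixes the angle differences \<open>C\<^sup>T \<phi>\<close> and
  with them all line flows; hence area exchanges and limits are as at the reference equilibrium. Constant
  generator frequencies give the second balance equation. Constant \<open>C\<^sup>T \<phi>\<close> gives
  \<open>C\<^sup>T X g = 0\<close> for the gradient \<open>g\<close> in \<open>\<phi>\<close>; as
  \<open>g\<close> lies in the range of \<open>C\<close>, this means \<open>g \<bullet> X g = 0\<close>, so
  \<open>g = 0\<close>.
\<close>
lemma omega_limit_subset_equilibria:
  assumes sol: "caratheodory_solution system (state_space N) z" and q: "q \<in> omega_limit z"
  shows "q \<in> equilibria N"
proof -
  obtain p where p: "p \<in> equilibria N" using equilibria_nonempty by blast
  obtain \<phi>' P' l' \<nu>' \<pi>' \<rho>p' \<rho>m' where p': "p = ((\<phi>', P'), l', \<nu>', \<pi>', \<rho>p', \<rho>m')" by (metis prod.collapse)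
  obtain n' where f': "completed (\<phi>', P') (l', \<nu>', \<pi>', \<rho>p', \<rho>m') = (l', n', \<pi>', \<rho>p', \<rho>m')" by (simp add: completed_def)
  note E = equilibrium_conditions[OF p[unfolded p'] f' refl]
  \<comment> \<open>no decay at a limit point: prices, frequencies and congested lines as in the reference equilibrium\<close>
  have same: "fst (snd r) = l' \<and> frequency (fst r) (snd r) = 0 \<and> congestion_slack p r = 0" if r: "r \<in> omega_limit z" for r
  proof -
    obtain x l \<nu> \<pi> \<rho>p \<rho>m where r': "r = (x, l, \<nu>, \<pi>, \<rho>p, \<rho>m)" by (metis prod.collapse)
    have "decay p r = 0" by (rule decay_zero_on_omega_limit[OF sol p r])
    moreover have "0 \<le> congestion_slack p r"
      by (rule congestion_slack_nonneg[OF p omega_limit_in_state_space[OF sol r]])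
    moreover have "0 \<le> dissipation (completed (fst r) (snd r)) (completed (fst p) (snd p))" by (rule dissipation_nonneg)
    ultimately have slack: "congestion_slack p r = 0"
      and diss: "dissipation (completed (fst r) (snd r)) (completed (fst p) (snd p)) = 0"
      unfolding decay_def by linarith+
    have "dissipation (l, frequency x (snd r), \<pi>, \<rho>p, \<rho>m) (l', n', \<pi>', \<rho>p', \<rho>m') = 0"
      using diss f' by (simp add: r' p' completed_def)
    then have "l = l'" "frequency x (snd r) = n'" by (rule dissipation_zero)+
    then show ?thesis using slack E(1) by (simp add: r')
  qed
  have X1: "fst X \<bullet> b > 0" if "b \<in> Basis" for b :: "real^'n"
    using X_pos[of "(b, 0)"] that by (cases X) (auto simp: Basis_prod_def)
  have cont_nth: "continuous_on UNIV (\<lambda>u. fst (grad_dual (fst u) (completed (fst u) (snd u))) $ i)"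
      "continuous_on UNIV (\<lambda>u. fst (snd (grad_dual (fst u) (completed (fst u) (snd u)))) $ i)" for i
    by (intro continuous_intros continuous_on_grad_dual_completed)+
  have gl: "fst (grad_dual (fst r) (completed (fst r) (snd r))) = 0" if r: "r \<in> omega_limit z" for r
  proof -
    have "fst (grad_dual (fst r) (completed (fst r) (snd r))) $ i = 0" for i
    proof -
      define b :: "'n primal \<times> ('n, 'k) dual" where "b = (0, axis i 1, 0)"
      have b: "b \<in> Basis" by (auto simp: b_def Basis_prod_def axis_in_Basis_iff)
      have "(gains \<bullet> b) * fst (grad_dual (fst r) (completed (fst r) (snd r))) $ i = 0"
      proof (rule stationary_functional[OF sol, where a = b and c = "l' $ i"])
        show "b \<bullet> u = l' $ i" if "u \<in> omega_limit z" for u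
          using same[OF that] by (cases u) (auto simp: b_def inner_axis' inner_axis)
        show "b \<bullet> system u = (gains \<bullet> b) * fst (grad_dual (fst u) (completed (fst u) (snd u))) $ i" for u
          unfolding inner_system_Basis[OF b] by (simp add: b_def direction_def case_prod_unfold proj_rho_def inner_axis inner_prod_def)
      qed (use r cont_nth(1) in \<open>auto intro: continuous_on_mult_left\<close>)
      then show ?thesis using gains_pos[OF b] by simp
    qed
    then show ?thesis by (simp add: vec_eq_iff)
  qed
  have gn: "fst (snd (grad_dual (fst q) (completed (fst q) (snd q)))) = 0"
  proof -
    have "fst (snd (grad_dual (fst q) (completed (fst q) (snd q)))) $ i = 0" for i
    proof (cases "i \<in> generators N")
      case True
      define b :: "'n primal \<times> ('n, 'k) dual" where "b = (0, 0, axis i 1, 0)"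
      have b: "b \<in> Basis" by (auto simp: b_def Basis_prod_def axis_in_Basis_iff)
      have "(gains \<bullet> b) * fst (snd (grad_dual (fst q) (completed (fst q) (snd q)))) $ i = 0"
      proof (rule stationary_functional[OF sol, where a = b and c = 0])
        show "b \<bullet> u = 0" if u: "u \<in> omega_limit z" for u
        proof -
          have "frequency (fst u) (snd u) $ i = 0" using same[OF u] by simp
          then have "fst (snd (snd u)) $ i = 0" using True by (simp add: frequency_def case_prod_unfold)
          then show ?thesis by (simp add: b_def inner_prod_def inner_axis')
        qed
        show "b \<bullet> system u = (gains \<bullet> b) * fst (snd (grad_dual (fst u) (completed (fst u) (snd u)))) $ i" for u
          unfolding inner_system_Basis[OF b] by (simp add: b_def direction_def case_prod_unfold proj_rho_def inner_axis inner_prod_def)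
      qed (use q cont_nth(2) in \<open>auto intro: continuous_on_mult_left\<close>)
      then show ?thesis using gains_pos[OF b] by simp
    next
      case False
      then show ?thesis by (rule grad_dual_load)
    qed
    then show ?thesis by (simp add: vec_eq_iff)
  qed
  \<comment> \<open>power balance determines the angle differences\<close>
  have angles: "transpose inc *v fst (fst r) = transpose inc *v \<phi>'" if r: "r \<in> omega_limit z" for r
  proof -
    obtain \<phi> P l \<nu> \<pi> \<rho>p \<rho>m where r': "r = ((\<phi>, P), l, \<nu>, \<pi>, \<rho>p, \<rho>m)" by (metis prod.collapse)
    have l: "l = l'" and freq: "frequency (\<phi>, P) (l, \<nu>, \<pi>, \<rho>p, \<rho>m) = 0"
      using same[OF r] unfolding r' fst_conv snd_conv by blast+
    have "P_in N - demands l - lap *v \<phi> = 0"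
      using gl[OF r] by (simp add: r' grad_dual_def completed_def freq)
    then have "P_in N - demands l' - lap *v \<phi> = 0" unfolding l .
    then have "lap *v (\<phi> - \<phi>') = 0"
      using E(2) by (simp add: matrix_vector_mult_diff_distrib)
    from laplacian_zero_imp[OF this] show ?thesis
      by (simp add: r' matrix_vector_mult_diff_distrib del: transpose_matrix_vector)
  qed
  have gx: "fst (grad_x (completed (fst q) (snd q))) = 0"
  proof -
    define gp where "gp u = fst (grad_x (completed (fst u) (snd u)))" for u
    have cont: "continuous_on UNIV gp" unfolding gp_def by (intro continuous_intros continuous_on_grad_x_completed)
    have "(transpose inc *v gain (fst X) (gp q)) $ e = 0" for e
    proof -
      define a :: "'n primal \<times> ('n, 'k) dual" where "a = ((inc *v axis e 1, 0), 0)"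
      have tr: "(inc *v axis e 1) \<bullet> \<phi> = (transpose inc *v \<phi>) $ e" for \<phi>
        by (metis inner_axis inner_commute inner_real_def inner_transpose mult.right_neutral)
      have "- ((transpose inc *v gain (fst X) (gp q)) $ e) = 0"
      proof (rule stationary_functional[OF sol, where a = a and c = "(transpose inc *v \<phi>') $ e"])
        show "a \<bullet> u = (transpose inc *v \<phi>') $ e" if "u \<in> omega_limit z" for u
          using angles[OF that] tr[of "fst (fst u)"] by (simp add: a_def inner_prod_def del: transpose_matrix_vector)
        have Xg: "fst (gain X w) = gain (fst X) (fst w)" for w by (cases X; cases w) (simp add: gain_Pair)
        show "a \<bullet> system u = - ((transpose inc *v gain (fst X) (gp u)) $ e)" for u
          using tr[of "gain (fst X) (gp u)"]
          by (cases u) (simp add: a_def inner_prod_def primal_dual_eq Xg gp_def del: transpose_matrix_vector)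
        show "continuous_on UNIV (\<lambda>u. - ((transpose inc *v gain (fst X) (gp u)) $ e))"
          by (intro continuous_intros linear_continuous_on_compose[OF _ matrix_vector_mul_linear]
              linear_continuous_on_compose[OF cont linear_gain])
      qed (rule q)
      then show ?thesis by simp
    qed
    then have ker: "transpose inc *v gain (fst X) (gp q) = 0" by (simp add: vec_eq_iff del: transpose_matrix_vector)
    obtain u where u: "gp q = inc *v u"
    proof -
      obtain \<phi> P l \<nu> \<pi> \<rho>p \<rho>m where q': "q = ((\<phi>, P), l, \<nu>, \<pi>, \<rho>p, \<rho>m)" by (metis prod.collapse)
      have "gp q = inc *v (- (flow l - (B_mat N ** transpose area) *v \<pi> - B_mat N *v (\<rho>p - \<rho>m)))"
        unfolding gp_def q' completed_def grad_x_def laplacian_flow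
        by (simp add: matrix_vector_mult_minus_right matrix_vector_mult_diff_distrib matrix_vector_mul_assoc matrix_mul_assoc
            del: transpose_matrix_vector)
      then show thesis using that by blast
    qed
    have "gain (fst X) (gp q) \<bullet> gp q = (transpose inc *v gain (fst X) (gp q)) \<bullet> u"
      by (simp only: u inner_transpose)
    then have "gp q = 0" using gain_inner_pos[OF X1] ker by simp
    then show ?thesis by (simp add: gp_def)
  qed
  obtain \<phi> P l \<nu> \<pi> \<rho>p \<rho>m where q': "q = ((\<phi>, P), l, \<nu>, \<pi>, \<rho>p, \<rho>m)" by (metis prod.collapse)
  have l: "l = l'" and freq: "frequency (\<phi>, P) (l, \<nu>, \<pi>, \<rho>p, \<rho>m) = 0"
    using same[OF q] unfolding q' fst_conv snd_conv by blast+
  have "completed (fst q) (snd q) = (l, 0, \<pi>, \<rho>p, \<rho>m)" by (simp add: q' completed_def freq)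
  then have fq: "completed (fst q) (snd q) = (l', 0, \<pi>, \<rho>p, \<rho>m)" unfolding l .
  have flow: "flow \<phi> = flow \<phi>'" using angles[OF q] by (simp only: flow_def q' fst_conv)
  have st: "q \<in> state_space N" by (rule omega_limit_in_state_space[OF sol q])
  have nn: "0 \<le> \<rho>p $ e" "0 \<le> \<rho>m $ e" for e
    using st by (auto simp: q' state_space_def simp del: split_paired_All)
  have "grad_x (completed (fst q) (snd q)) = 0"
    using gx unfolding fq by (simp add: grad_x_def zero_prod_def)
  moreover have "proj_rho (snd q) (grad_dual (fst q) (completed (fst q) (snd q))) = 0"
  proof -
    have slack: "\<rho>p \<bullet> (P_max N - flow \<phi>) + \<rho>m \<bullet> (flow \<phi> - P_min N) = 0"
      using same[OF q] by (simp add: congestion_slack_def p' q' flow)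
    have lim: "flow \<phi> $ e \<le> P_max N $ e" "P_min N $ e \<le> flow \<phi> $ e" for e
      unfolding flow using E(6,7) .
    have t: "0 \<le> \<rho>p $ e * (P_max N - flow \<phi>) $ e" "0 \<le> \<rho>m $ e * (flow \<phi> - P_min N) $ e" for e
      using nn[of e] lim[of e] by simp_all
    have s: "0 \<le> \<rho>p \<bullet> (P_max N - flow \<phi>)" "0 \<le> \<rho>m \<bullet> (flow \<phi> - P_min N)"
      unfolding inner_vec_def inner_real_def using t by (blast intro: sum_nonneg)+
    have zero: "\<rho> $ e * v $ e = 0" if "\<rho> \<bullet> v = 0" "\<And>e. 0 \<le> \<rho> $ e * v $ e" for \<rho> v :: "real^('n \<times> 'n)" and e
    proof -
      have "(\<Sum>e\<in>UNIV. \<rho> $ e * v $ e) = 0" using that(1) by (simp add: inner_vec_def)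
      then show ?thesis using sum_nonneg_eq_0_iff[of UNIV "\<lambda>e. \<rho> $ e * v $ e"] that(2) by (simp del: split_paired_All)
    qed
    have "\<rho>p \<bullet> (P_max N - flow \<phi>) = 0" "\<rho>m \<bullet> (flow \<phi> - P_min N) = 0" using slack s by linarith+
    then have z: "\<rho>p $ e * (P_max N - flow \<phi>) $ e = 0" "\<rho>m $ e * (flow \<phi> - P_min N) $ e = 0" for e
      using zero t by blast+
    have "pos_proj \<rho>p (flow \<phi> - P_max N) = 0" "pos_proj \<rho>m (P_min N - flow \<phi>) = 0"
    proof -
      show "pos_proj \<rho>p (flow \<phi> - P_max N) = 0"
        unfolding pos_proj_eq_0_iff
      proof (intro allI conjI impI)
        fix e
        show "(flow \<phi> - P_max N) $ e \<le> 0" using lim(1)[of e] by simp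
        show "(flow \<phi> - P_max N) $ e = 0" if "0 < \<rho>p $ e" using z(1)[of e] that by simp
      qed
      show "pos_proj \<rho>m (P_min N - flow \<phi>) = 0"
        unfolding pos_proj_eq_0_iff
      proof (intro allI conjI impI)
        fix e
        show "(P_min N - flow \<phi>) $ e \<le> 0" using lim(2)[of e] by simp
        show "(P_min N - flow \<phi>) $ e = 0" if "0 < \<rho>m $ e" using z(2)[of e] that by simp
      qed
    qed
    moreover have "area *v flow \<phi> - P_hat N = 0" using E(4) by (simp add: flow)
    moreover have "P_in N - demands (l' + 0) - lap *v \<phi> = 0" using gl[OF q] unfolding fq by (simp add: grad_dual_def q')
    moreover have "P_in N - demands (l' + 0) - diag (damping N) *v 0 - inc *v P = 0"
      using gn unfolding fq by (simp add: grad_dual_def q')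
    ultimately show ?thesis
      unfolding fq by (simp add: grad_dual_def proj_rho_def q' zero_prod_def)
  qed
  ultimately show ?thesis using st unfolding equilibria_eq by (simp add: case_prod_unfold)
qed

text \<open>
  A limit point is an equilibrium, and the weighted distance to any equilibrium never increases, so closeness
  along one sequence of times is closeness from then on.
\<close>
lemma trajectory_converges:
  assumes sol: "caratheodory_solution system (state_space N) z"
  shows "\<exists>q\<in>equilibria N. (z \<longlongrightarrow> q) at_top"
proof -
  obtain r q where r: "strict_mono r" "(\<lambda>n. z (real (r n))) \<longlonglongrightarrow> q" "q \<in> omega_limit z"
    using sequence_has_omega_limit[OF trajectory_bounded[OF sol] filterlim_real_sequentially] by blast
  have q: "q \<in> equilibria N" by (rule omega_limit_subset_equilibria[OF sol r(3)])
  obtain c where c: "((\<lambda>t. lyapunov q (z t)) \<longlongrightarrow> c) at_top"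
    using nonincreasing_converges[of "\<lambda>t. lyapunov q (z t)"] lyapunov_nonincreasing[OF sol q] lyapunov_nonneg by blast
  have "filterlim (\<lambda>n. real (r n)) at_top sequentially"
    by (rule filterlim_compose[OF filterlim_real_sequentially filterlim_subseq[OF r(1)]])
  from filterlim_compose[OF c this] have "(\<lambda>n. lyapunov q (z (real (r n)))) \<longlonglongrightarrow> c" .
  moreover have "(\<lambda>n. lyapunov q (z (real (r n)))) \<longlonglongrightarrow> lyapunov q q"
    using has_derivative_continuous[OF lyapunov_derivative] r(2) by (rule isCont_tendsto_compose)
  moreover have "lyapunov q q = 0" by (simp add: lyapunov_def weighted_sq_def)
  ultimately have c0: "c = 0" using LIMSEQ_unique by metis
  obtain m M where m: "0 < m" "\<And>w. (norm w)\<^sup>2 \<le> m * weighted_sq gains w"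
    using weighted_sq_bounds[OF gains_pos] by metis
  have "((\<lambda>t. (norm (z t - q))\<^sup>2) \<longlongrightarrow> 0) at_top"
  proof (rule tendsto_sandwich[OF _ _ tendsto_const])
    show "\<forall>\<^sub>F t in at_top. (norm (z t - q))\<^sup>2 \<le> 2 * m * lyapunov q (z t)"
      using m(2) by (simp add: lyapunov_def)
    show "((\<lambda>t. 2 * m * lyapunov q (z t)) \<longlongrightarrow> 0) at_top"
      using tendsto_mult_left[OF c, of "2 * m"] c0 by simp
  qed simp
  then have "((\<lambda>t. sqrt ((norm (z t - q))\<^sup>2)) \<longlongrightarrow> sqrt 0) at_top" by (rule tendsto_real_sqrt)
  then have "(z \<longlongrightarrow> q) at_top" by (simp add: tendsto_norm_zero_iff LIM_zero_iff)
  then show ?thesis using q by blast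
qed

text \<open>
  The weighted distance to a nearby equilibrium never increases; the constant \<open>m M\<close> of the norm bounds
  does not depend on that equilibrium.
\<close>
lemma equilibria_stable:
  assumes "\<epsilon> > 0"
  shows "\<exists>\<delta>>0. \<forall>z. caratheodory_solution system (state_space N) z \<and> infdist (z 0) (equilibria N) < \<delta> \<longrightarrow>
        (\<forall>t\<ge>0. infdist (z t) (equilibria N) < \<epsilon>)"
proof -
  obtain m M where m: "0 < m" "0 < M" "\<And>w. (norm w)\<^sup>2 \<le> m * weighted_sq gains w" "\<And>w. weighted_sq gains w \<le> M * (norm w)\<^sup>2"
    using weighted_sq_bounds[OF gains_pos] by metis
  define \<delta> where "\<delta> = \<epsilon> / sqrt (m * M)"
  have mM: "0 < m * M" using m by simp
  have \<delta>: "\<delta> > 0" "m * M * \<delta>\<^sup>2 = \<epsilon>\<^sup>2" using mM m(1,2) assms by (simp_all add: \<delta>_def power_divide)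
  show ?thesis
  proof (intro exI[of _ \<delta>] conjI allI impI \<delta>(1))
    fix z and t :: real
    assume z: "caratheodory_solution system (state_space N) z \<and> infdist (z 0) (equilibria N) < \<delta>" and t: "0 \<le> t"
    then have "(INF p\<in>equilibria N. dist (z 0) p) < \<delta>"
      using infdist_notempty[OF equilibria_nonempty, of "z 0"] by simp
    then obtain p where p: "p \<in> equilibria N" "dist (z 0) p < \<delta>"
      using cINF_less_iff[OF equilibria_nonempty bdd_belowI2[of "equilibria N" 0 "dist (z 0)"]] zero_le_dist by blast
    have "weighted_sq gains (z t - p) \<le> weighted_sq gains (z 0 - p)"
      using lyapunov_nonincreasing[OF _ p(1) order_refl t, of z] z by (simp add: lyapunov_def)
    then have "(norm (z t - p))\<^sup>2 \<le> m * (M * (norm (z 0 - p))\<^sup>2)"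
      using m(3)[of "z t - p"] m(4)[of "z 0 - p"] m(1) by (meson mult_left_mono less_imp_le order_trans)
    also have "\<dots> < m * (M * \<delta>\<^sup>2)"
      using p(2) m(1,2) by (intro mult_strict_left_mono power_strict_mono) (auto simp: dist_norm)
    also have "\<dots> = \<epsilon>\<^sup>2" using \<delta>(2) by (simp add: mult.assoc)
    finally have "dist (z t) p < \<epsilon>" using assms by (simp add: dist_norm power_less_imp_less_base)
    then show "infdist (z t) (equilibria N) < \<epsilon>" using infdist_le[OF p(1), of "z t"] by linarith
  qed
qed

end

theorem theorem10:
  fixes N :: "('n::finite, 'k::finite) grid" and \<alpha> :: real
    and X :: "'n primal" and Y :: "('n, 'k) dual"
  assumes "network N"
    and "cost_assumption \<alpha> N"
    and "olc_strictly_feasible N"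
    and "\<forall>b\<in>Basis. X \<bullet> b > 0"
    and "\<forall>b\<in>Basis. Y \<bullet> b > 0"
  shows "globally_asymptotically_stable (primal_dual N X Y) (state_space N) (equilibria N) \<and>
    (\<forall>z. caratheodory_solution (primal_dual N X Y) (state_space N) z \<longrightarrow>
       (\<exists>!p. p \<in> equilibria N \<and> (z \<longlongrightarrow> p) at_top \<and> olc_optimal_point N p))"
proof -
  interpret olc_dynamics N \<alpha> X Y by unfold_locales (use assms in auto)
  show ?thesis
  proof (intro conjI allI impI)
    show "globally_asymptotically_stable system (state_space N) (equilibria N)"
      unfolding globally_asymptotically_stable_def
    proof (intro conjI allI impI)
      show "equilibria N \<noteq> {}" by (rule equilibria_nonempty)
      show "equilibria N \<subseteq> state_space N" by (auto simp: equilibria_def)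
      show "\<exists>\<delta>>0. \<forall>z. caratheodory_solution system (state_space N) z \<and> infdist (z 0) (equilibria N) < \<delta> \<longrightarrow>
        (\<forall>t\<ge>0. infdist (z t) (equilibria N) < \<epsilon>)" if "\<epsilon> > 0" for \<epsilon>
        using that by (rule equilibria_stable)
      fix z assume "caratheodory_solution system (state_space N) z"
      then obtain q where q: "q \<in> equilibria N" "(z \<longlongrightarrow> q) at_top" using trajectory_converges by blast
      have "((\<lambda>t. infdist (z t) (equilibria N)) \<longlongrightarrow> infdist q (equilibria N)) at_top"
        by (rule tendsto_infdist[OF q(2)])
      then show "((\<lambda>t. infdist (z t) (equilibria N)) \<longlongrightarrow> 0) at_top" using q(1) by simp
    qed
  next
    fix z assume "caratheodory_solution system (state_space N) z"
    then obtain q where q: "q \<in> equilibria N" "(z \<longlongrightarrow> q) at_top" using trajectory_converges by blast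
    have "olc_optimal_point N q" using equilibrium_optimal[of "fst q" "snd q"] q(1) by simp
    then show "\<exists>!p. p \<in> equilibria N \<and> (z \<longlongrightarrow> p) at_top \<and> olc_optimal_point N p"
      using q tendsto_unique[OF trivial_limit_at_top_linorder q(2)] by blast
  qed
qed

end
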